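(* Let $\mathbf{X}:\Omega\to\mathbb{R}^M$ have a smooth density $p$ with finite $G=\mathbb{E}[\|\nabla\ln p(\mathbf{X})\|^2]$. Let $\mathbf{Z}_t=\sqrt{1-\sigma_t^2}\,\mathbf{X}+\sigma_t\mathbf{U}$ with $\mathbf{U}\sim\mathcal{N}(0,\mathbf{I})$ independent of $\mathbf{X}$. Let $\hat{\mathbf{X}}_A$ be drawn from the conditional distribution $P(\mathbf{X}\mid\mathbf{Z}_t)$ (conditionally independent of $\mathbf{X}$ given $\mathbf{Z}_t$), and let $\hat{\mathbf{X}}_F$ be the flow-based reconstruction from $\mathbf{Z}_t$. Then $$\lim_{\sigma_t\to 0^+}\frac{\mathbb{E}[\|\hat{\mathbf{X}}_F-\mathbf{X}\|^2]}{\mathbb{E}[\|\hat{\mathbf{X}}_A-\mathbf{X}\|^2]}=\frac12 .$$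
   Context: Diffusion setup: $(\beta_t)_{t\ge0}$ is a positive continuous function and $\sigma_t^2=1-\exp(-\int_0^t\beta_\tau\,d\tau)$, so $\mathbf{Z}_t=\sqrt{1-\sigma_t^2}\,\mathbf{X}+\sigma_t\mathbf{U}$ is the solution at time $t$ of the SDE $d\mathbf{Z}_t=-\tfrac12\beta_t\mathbf{Z}_t\,dt+\sqrt{\beta_t}\,d\mathbf{W}_t$ with $\mathbf{Z}_0=\mathbf{X}$. Let $p_t$ be the density of $\mathbf{Z}_t$ ($p_0=p$). The probability flow ODE is $d\mathbf{z}_s=\big(-\tfrac12\beta_s\mathbf{z}_s-\tfrac12\beta_s\nabla\ln p_s(\mathbf{z}_s)\big)ds$. The flow-based reconstruction $\hat{\mathbf{X}}_F=\hat{\mathbf{Z}}_0$ is the value at time $0$ of the solution of this ODE run backward in time from time $t$ with initial condition $\mathbf{z}_t=\mathbf{Z}_t$. *)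

theory Defs
  imports "HOL-Analysis.Analysis"
begin

definition grad :: "('a::euclidean_space \<Rightarrow> real) \<Rightarrow> 'a \<Rightarrow> 'a" where
  "grad f x = (THE D. GDERIV f x :> D)"

fun dirderiv :: "'a::euclidean_space list \<Rightarrow> ('a \<Rightarrow> real) \<Rightarrow> 'a \<Rightarrow> real" where
  "dirderiv [] f = f"
| "dirderiv (v # vs) f = (\<lambda>x. frechet_derivative (dirderiv vs f) (at x) v)"

definition smooth :: "('a::euclidean_space \<Rightarrow> real) \<Rightarrow> bool" where
  "smooth f \<longleftrightarrow> (\<forall>vs x. dirderiv vs f differentiable (at x))"

definition sig :: "(real \<Rightarrow> real) \<Rightarrow> real \<Rightarrow> real" where
  "sig \<beta> t = sqrt (1 - exp (- integral {0..t} \<beta>))"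

definition gauss :: "real \<Rightarrow> 'a::euclidean_space \<Rightarrow> real" where
  "gauss s u = (2 * pi * s\<^sup>2) powr (- real DIM('a) / 2) * exp (- (norm u)\<^sup>2 / (2 * s\<^sup>2))"

(* joint density of (X, Z_t) at (x, z):  p(x) * phi_sigma(z - sqrt(1-sigma^2) x) *)
definition joint :: "('a::euclidean_space \<Rightarrow> real) \<Rightarrow> (real \<Rightarrow> real) \<Rightarrow> real \<Rightarrow> 'a \<Rightarrow> 'a \<Rightarrow> real" where
  "joint p \<beta> t x z = p x * gauss (sig \<beta> t) (z - sqrt (1 - (sig \<beta> t)\<^sup>2) *\<^sub>R x)"

definition dens :: "('a::euclidean_space \<Rightarrow> real) \<Rightarrow> (real \<Rightarrow> real) \<Rightarrow> real \<Rightarrow> 'a \<Rightarrow> real" where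
  "dens p \<beta> t z = (if t = 0 then p z else (\<integral>x. joint p \<beta> t x z \<partial>lborel))"

definition score :: "('a::euclidean_space \<Rightarrow> real) \<Rightarrow> (real \<Rightarrow> real) \<Rightarrow> real \<Rightarrow> 'a \<Rightarrow> 'a" where
  "score p \<beta> s z = grad (\<lambda>y. ln (dens p \<beta> s y)) z"

(* F t z is the flow-based reconstruction: value at time 0 of the solution of the
   probability flow ODE on [0,t] with terminal value z at time t *)
definition is_flow_reconstruction ::
  "('a::euclidean_space \<Rightarrow> real) \<Rightarrow> (real \<Rightarrow> real) \<Rightarrow> real \<Rightarrow> 'a \<Rightarrow> 'a \<Rightarrow> bool" where
  "is_flow_reconstruction p \<beta> t z x0 \<longleftrightarrow>
     (\<exists>\<phi>::real \<Rightarrow> 'a. continuous_on {0..t} \<phi> \<and> \<phi> t = z \<and> \<phi> 0 = x0 \<and>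
        (\<forall>s\<in>{0<..t}. (\<phi> has_vector_derivative
            (- (\<beta> s / 2) *\<^sub>R \<phi> s - (\<beta> s / 2) *\<^sub>R score p \<beta> s (\<phi> s))) (at s within {0..t})))"

definition flow_err :: "('a::euclidean_space \<Rightarrow> real) \<Rightarrow> (real \<Rightarrow> real) \<Rightarrow> ('a \<Rightarrow> 'a) \<Rightarrow> real \<Rightarrow> real" where
  "flow_err p \<beta> F t = (\<integral>x. \<integral>z. joint p \<beta> t x z * (norm (F z - x))\<^sup>2 \<partial>lborel \<partial>lborel)"

(* E ||X_A - X||^2 where X_A ~ P(X | Z_t), conditionally independent of X given Z_t:
   joint density of (X, Z_t, X_A) is p(x) phi(z - a x) * p(x') phi(z - a x') / p_t(z) *)
definition anc_err :: "('a::euclidean_space \<Rightarrow> real) \<Rightarrow> (real \<Rightarrow> real) \<Rightarrow> real \<Rightarrow> real" where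
  "anc_err p \<beta> t = (\<integral>z. \<integral>x. \<integral>x'.
      joint p \<beta> t x z * joint p \<beta> t x' z / dens p \<beta> t z * (norm (x' - x))\<^sup>2
      \<partial>lborel \<partial>lborel \<partial>lborel)"

end

theory Submission
  imports Defs "HOL-Probability.Probability"
begin

text \<open>
  In the coordinates \<open>y = z / sqrt (1 - \<sigma>\<^sup>2)\<close> and \<open>\<tau> = \<sigma>\<^sup>2 / (1 - \<sigma>\<^sup>2)\<close> the noisy variable is the data plus a
  centred Gaussian of covariance \<open>\<tau> I\<close>, its density \<open>q\<close> is the heat evolution of \<open>p\<close>, and the probability
  flow becomes \<open>y' = - S / 2\<close> with \<open>S = \<nabla> ln q\<close>. The Fisher information of \<open>q\<close> is at most that of \<open>p\<close>, so the
  posterior sampling error is \<open>2 M \<tau> + O(\<tau>\<^sup>2)\<close>. Since the flow transports \<open>q\<close> at time \<open>T\<close> to \<open>q\<close> at earlier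
  times, Cauchy-Schwarz in time bounds the mean squared displacement of the flow by \<open>T\<^sup>2 / 4\<close> times the
  Fisher information; hence the flow error is \<open>M \<tau> + o(\<tau>)\<close>.

  Only one inequality of the transport property is needed. It is proved by following a Lipschitz test
  function of compact support along the flow: over a step of length \<open>\<delta>\<close> the flow is replaced by an Euler
  step, the test function by a \<open>C\<^sup>1\<close> function, and the heat equation together with an integration by parts
  shows that the integral changes by \<open>o(\<delta>)\<close>.
\<close>

section \<open>The heat kernel\<close>

text \<open>The hypothesis supplies one backward trajectory for each end time and end point;
  measurability of \<open>F\<close> and a global Lipschitz or growth bound for the score are
  missing. A convexity fact takes their place. The posterior mean
  \<open>y + \<tau> *\<^sub>R hscore \<tau> y\<close> is a monotone map of \<open>y\<close>, so the
  squared distance of two trajectories divided by the time decreases. Trajectories that meet a given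
  ball at the early time therefore remain in one larger ball, and there compactness bounds the
  score. Of transport, the displacement estimate asks only an upper bound: the mean squared score
  along the flow at an intermediate time must not exceed the Fisher information of the heat
  evolution at that time. It is tested on compactly supported truncations, which Fatou's lemma
  removes. The score may be unbounded near time 0, so all this happens on \<open>{s0..T}\<close>
  before \<open>s0\<close> tends to 0. The ratio 1/2 reflects that posterior sampling pays the noise
  variance twice, once for each of two conditionally independent draws, while the flow moves points
  by order \<tau> in mean square root and pays it once.\<close>

definition hk :: "real \<Rightarrow> 'a::euclidean_space \<Rightarrow> real" where
  "hk \<tau> u = (2 * pi * \<tau>) powr (- real DIM('a) / 2) * exp (- (norm u)\<^sup>2 / (2 * \<tau>))"

lemma hk_pos: "\<tau> > 0 \<Longrightarrow> hk \<tau> u > 0"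
  by (simp add: hk_def)

lemma hk_nonneg: "hk \<tau> u \<ge> 0"
  by (simp add: hk_def)

lemma hk_measurable [measurable]: "hk \<tau> \<in> borel_measurable borel"
  unfolding hk_def by measurable

text \<open>Factorisation over the coordinates reduces every moment of the kernel to one-dimensional
  moments, through \<open>nn_integral_lborel_prod\<close>.\<close>

lemma hk_eq_prod_normal_density:
  fixes u :: "'a::euclidean_space"
  assumes "\<tau> > 0"
  shows "hk \<tau> u = (\<Prod>b\<in>Basis. normal_density 0 (sqrt \<tau>) (u \<bullet> b))"
proof -
  have "(2 * pi * \<tau>) powr (- real DIM('a) / 2) = (1 / sqrt (2 * pi * \<tau>)) ^ DIM('a)"
  proof -
    have "(1 / sqrt (2 * pi * \<tau>)) ^ DIM('a) = ((2 * pi * \<tau>) powr (-1/2)) ^ DIM('a)"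
      using assms by (simp add: powr_half_sqrt powr_minus_divide)
    also have "\<dots> = (2 * pi * \<tau>) powr (- real DIM('a) / 2)"
      using assms by (simp add: powr_realpow[symmetric] powr_powr)
    finally show ?thesis by simp
  qed
  moreover have "exp (- (norm u)\<^sup>2 / (2 * \<tau>)) = (\<Prod>b\<in>Basis. exp (- (u \<bullet> b)\<^sup>2 / (2 * \<tau>)))"
    unfolding exp_sum[OF finite_Basis, symmetric] power2_norm_eq_inner
    by (subst euclidean_inner)
      (simp add: sum_divide_distrib sum_negf power2_eq_square)
  ultimately show ?thesis
    using assms by (simp add: hk_def normal_density_def prod_dividef prod.distrib power_one_over)
qed

lemma nn_integral_normal_density: "\<sigma> > 0 \<Longrightarrow> (\<integral>\<^sup>+x. normal_density 0 \<sigma> x \<partial>lborel) = 1"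
  by (subst nn_integral_eq_integral) (auto simp: integrable_normal_density)

lemma nn_integral_normal_second_moment:
  assumes "\<sigma> > 0"
  shows "(\<integral>\<^sup>+x. normal_density 0 \<sigma> x * x\<^sup>2 \<partial>lborel) = ennreal (\<sigma>\<^sup>2)"
proof -
  have "has_bochner_integral lborel (\<lambda>x. normal_density 0 \<sigma> x * x ^ 2) (\<sigma>\<^sup>2)"
    using normal_moment_even[OF assms, of 0 1] assms by (simp add: power2_eq_square)
  then show ?thesis
    by (subst nn_integral_eq_integral) (auto simp: has_bochner_integral_iff)
qed

lemma nn_integral_hk: "\<tau> > 0 \<Longrightarrow> (\<integral>\<^sup>+u. hk \<tau> (u::'a::euclidean_space) \<partial>lborel) = 1"
  by (subst hk_eq_prod_normal_density, assumption, subst prod_ennreal[symmetric], simp,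
      subst nn_integral_lborel_prod)
    (auto simp: nn_integral_normal_density)

lemma nn_integral_hk_norm2:
  assumes "\<tau> > 0"
  shows "(\<integral>\<^sup>+u. hk \<tau> (u::'a::euclidean_space) * (norm u)\<^sup>2 \<partial>lborel) = ennreal (real DIM('a) * \<tau>)"
proof -
  have one: "(\<integral>\<^sup>+u. hk \<tau> (u::'a) * (u \<bullet> b)\<^sup>2 \<partial>lborel) = ennreal \<tau>" if b: "b \<in> Basis" for b
  proof -
    \<comment> \<open>Only the factor of the coordinate \<open>b\<close> carries the square, so the
      integral is the product of one second moment and of total masses 1.\<close>
    let ?f = "\<lambda>c x. ennreal (if c = b then normal_density 0 (sqrt \<tau>) x * x\<^sup>2 else normal_density 0 (sqrt \<tau>) x)"
    have "(\<integral>\<^sup>+u. hk \<tau> (u::'a) * (u \<bullet> b)\<^sup>2 \<partial>lborel) = (\<integral>\<^sup>+u. (\<Prod>c\<in>Basis. ?f c (u \<bullet> c)) \<partial>lborel)"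
    proof (rule nn_integral_cong)
      fix u :: 'a
      have "(\<Prod>c\<in>Basis. ?f c (u \<bullet> c)) = ennreal (\<Prod>c\<in>Basis. if c = b then normal_density 0 (sqrt \<tau>) (u \<bullet> c) * (u \<bullet> c)\<^sup>2 else normal_density 0 (sqrt \<tau>) (u \<bullet> c))"
        by (subst prod_ennreal[symmetric]) auto
      also have "(\<Prod>c\<in>Basis. if c = b then normal_density 0 (sqrt \<tau>) (u \<bullet> c) * (u \<bullet> c)\<^sup>2 else normal_density 0 (sqrt \<tau>) (u \<bullet> c))
         = (\<Prod>c\<in>Basis. normal_density 0 (sqrt \<tau>) (u \<bullet> c)) * (u \<bullet> b)\<^sup>2"
        using b by (simp add: prod.remove[OF finite_Basis b])
      finally show "ennreal (hk \<tau> u * (u \<bullet> b)\<^sup>2) = (\<Prod>c\<in>Basis. ?f c (u \<bullet> c))"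
        by (simp add: hk_eq_prod_normal_density[OF assms])
    qed
    also have "\<dots> = (\<Prod>c\<in>Basis. \<integral>\<^sup>+x. ?f c x \<partial>lborel)"
      by (subst nn_integral_lborel_prod) auto
    also have "\<dots> = (\<Prod>c\<in>(Basis::'a set). if c = b then ennreal \<tau> else 1)"
      using assms by (intro prod.cong refl)
        (auto simp: nn_integral_normal_second_moment nn_integral_normal_density)
    also have "\<dots> = ennreal \<tau>"
      using b by simp
    finally show ?thesis .
  qed
  have "(\<integral>\<^sup>+u. hk \<tau> (u::'a) * (norm u)\<^sup>2 \<partial>lborel) = (\<integral>\<^sup>+u. (\<Sum>b\<in>Basis. ennreal (hk \<tau> (u::'a) * (u \<bullet> b)\<^sup>2)) \<partial>lborel)"
  proof (rule nn_integral_cong)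
    fix u :: 'a
    have "(norm u)\<^sup>2 = (\<Sum>b\<in>Basis. (u \<bullet> b)\<^sup>2)"
      unfolding power2_norm_eq_inner by (subst euclidean_inner) (simp add: power2_eq_square)
    then show "ennreal (hk \<tau> u * (norm u)\<^sup>2) = (\<Sum>b\<in>Basis. ennreal (hk \<tau> u * (u \<bullet> b)\<^sup>2))"
      by (simp add: sum_ennreal hk_nonneg sum_distrib_left)
  qed
  also have "\<dots> = (\<Sum>b\<in>(Basis::'a set). ennreal \<tau>)"
    by (subst nn_integral_sum) (auto simp: one)
  also have "\<dots> = ennreal (real DIM('a) * \<tau>)"
    using assms by (simp add: ennreal_of_nat_eq_real_of_nat ennreal_mult)
  finally show ?thesis .
qed

text \<open>Jensen's inequality for the square root, obtained from the arithmetic-geometric mean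
  inequality with the optimal weight: \<open>c\<close> is the root mean square of the norm, and each
  of the two summands integrates to \<open>c / 2\<close>.\<close>

lemma nn_integral_hk_norm_le:
  assumes "\<tau> > 0"
  shows "(\<integral>\<^sup>+u. hk \<tau> (u::'a::euclidean_space) * norm u \<partial>lborel) \<le> ennreal (sqrt (real DIM('a) * \<tau>))"
proof -
  define c where "c = sqrt (real DIM('a) * \<tau>)"
  have c: "c > 0" "c\<^sup>2 = real DIM('a) * \<tau>" using assms by (auto simp: c_def)
  have "(\<integral>\<^sup>+u. hk \<tau> (u::'a) * norm u \<partial>lborel)
      \<le> (\<integral>\<^sup>+u. ennreal (c/2) * ennreal (hk \<tau> (u::'a)) + ennreal (1/(2*c)) * ennreal (hk \<tau> u * (norm u)\<^sup>2) \<partial>lborel)"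
  proof (rule nn_integral_mono)
    fix u :: 'a
    have "0 \<le> (norm u - c)\<^sup>2" by simp
    then have "norm u \<le> c/2 + (norm u)\<^sup>2 / (2*c)"
      using c by (simp add: field_simps power2_eq_square)
    from mult_left_mono[OF this hk_nonneg[of \<tau> u]]
    have "hk \<tau> u * norm u \<le> c/2 * hk \<tau> u + 1/(2*c) * (hk \<tau> u * (norm u)\<^sup>2)"
      by (simp add: field_simps)
    then show "ennreal (hk \<tau> u * norm u) \<le> ennreal (c/2) * ennreal (hk \<tau> u) + ennreal (1/(2*c)) * ennreal (hk \<tau> u * (norm u)\<^sup>2)"
      using c by (simp add: ennreal_mult[symmetric] ennreal_plus[symmetric] hk_nonneg del: ennreal_plus)
  qed
  also have "\<dots> = ennreal (c/2) * 1 + ennreal (1/(2*c)) * ennreal (c\<^sup>2)"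
    by (subst nn_integral_add) (auto simp: nn_integral_cmult nn_integral_hk nn_integral_hk_norm2 assms c)
  also have "\<dots> = ennreal (c/2 + 1/(2*c) * c\<^sup>2)"
    using c(1) by (simp only: ennreal_mult[symmetric] ennreal_plus[symmetric] mult_1_right) (simp add: ennreal_mult[symmetric] ennreal_plus[symmetric] del: ennreal_plus)
  also have "c/2 + 1/(2*c) * c\<^sup>2 = c"
    using c(1) by (simp add: power2_eq_square)
  finally show ?thesis by (simp add: c_def)
qed

lemma integrable_hk: "\<tau> > 0 \<Longrightarrow> integrable lborel (hk \<tau> :: 'a::euclidean_space \<Rightarrow> real)"
  by (rule integrableI_nonneg) (auto simp: hk_nonneg nn_integral_hk)

lemma integral_hk: "\<tau> > 0 \<Longrightarrow> (\<integral>u. hk \<tau> (u::'a::euclidean_space) \<partial>lborel) = 1"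
  by (subst integral_eq_nn_integral) (auto simp: hk_nonneg nn_integral_hk)

lemma nn_integral_lborel_translate:
  fixes f :: "'a::euclidean_space \<Rightarrow> ennreal"
  assumes [measurable]: "f \<in> borel_measurable borel"
  shows "(\<integral>\<^sup>+x. f (x + y) \<partial>lborel) = (\<integral>\<^sup>+u. f u \<partial>lborel)"
proof -
  have "(\<integral>\<^sup>+u. f u \<partial>lborel) = (\<integral>\<^sup>+u. f u \<partial>(distr lborel borel ((+) y)))"
    by (simp add: lborel_distr_plus)
  also have "\<dots> = (\<integral>\<^sup>+x. f (x + y) \<partial>lborel)"
    by (subst nn_integral_distr) (auto simp: add.commute)
  finally show ?thesis by simp
qed

lemma integral_lborel_translate:
  fixes f :: "'a::euclidean_space \<Rightarrow> 'b::{banach,second_countable_topology}"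
  assumes [measurable]: "f \<in> borel_measurable borel"
  shows "(\<integral>x. f (x + y) \<partial>lborel) = (\<integral>u. f u \<partial>lborel)"
proof -
  have "(\<integral>u. f u \<partial>lborel) = (\<integral>u. f u \<partial>(distr lborel borel ((+) y)))"
    by (simp add: lborel_distr_plus)
  also have "\<dots> = (\<integral>x. f (x + y) \<partial>lborel)"
    by (subst integral_distr) (auto simp: add.commute)
  finally show ?thesis by simp
qed

section \<open>Integrals of derivatives and derivatives of integrals\<close>

text \<open>Averaging \<open>\<partial>f\<close> over translates by \<open>\<theta> e\<close>, \<open>\<theta> \<in> [0,1]\<close>, turns its integral into
  the integral of \<open>f (x + e) - f x\<close>.\<close>
lemma integral_directional_derivative_eq_0:
  fixes f :: "'a::euclidean_space \<Rightarrow> real"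
  assumes deriv: "\<And>x. (f has_derivative f' x) (at x)"
    and cont: "continuous_on UNIV (\<lambda>x. f' x e)"
    and int: "integrable lborel f" and int': "integrable lborel (\<lambda>x. f' x e)"
  shows "(\<integral>x. f' x e \<partial>lborel) = 0"
proof -
  define D where "D x = f' x e" for x
  have [measurable]: "D \<in> borel_measurable borel"
    using cont unfolding D_def by (rule borel_measurable_continuous_onI)
  have [measurable]: "f \<in> borel_measurable borel"
    using deriv by (intro borel_measurable_continuous_onI)
      (auto intro: has_derivative_continuous continuous_at_imp_continuous_on)
  have ftc: "(\<integral>\<theta>. indicator {0..1} \<theta> *\<^sub>R D (x + \<theta> *\<^sub>R e) \<partial>lborel) = f (x + e) - f x" for x
  proof -
    have "((\<lambda>\<theta>. D (x + \<theta> *\<^sub>R e)) has_integral (f (x + 1 *\<^sub>R e) - f (x + 0 *\<^sub>R e))) {0..1}"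
    proof (rule fundamental_theorem_of_calculus)
      fix \<theta> :: real
      have "((\<lambda>\<theta>. f (x + \<theta> *\<^sub>R e)) has_derivative (\<lambda>h. f' (x + \<theta> *\<^sub>R e) (h *\<^sub>R e))) (at \<theta> within {0..1})"
        by (rule has_derivative_compose[of "\<lambda>\<theta>. x + \<theta> *\<^sub>R e", OF _ deriv])
          (auto intro!: derivative_eq_intros)
      moreover have "f' (x + \<theta> *\<^sub>R e) (h *\<^sub>R e) = h *\<^sub>R D (x + \<theta> *\<^sub>R e)" for h
        using linear_cmul[OF has_derivative_linear[OF deriv]] by (simp add: D_def)
      ultimately show "((\<lambda>\<theta>. f (x + \<theta> *\<^sub>R e)) has_vector_derivative D (x + \<theta> *\<^sub>R e)) (at \<theta> within {0..1})"
        by (simp add: has_vector_derivative_def)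
    qed simp
    moreover have "set_integrable lborel {0..1} (\<lambda>\<theta>. D (x + \<theta> *\<^sub>R e))"
      by (rule borel_integrable_atLeastAtMost') 
        (use cont in \<open>auto intro!: continuous_intros continuous_on_compose2[OF cont] simp: D_def\<close>)
    ultimately show ?thesis
      using set_borel_integral_eq_integral(2)[of "{0..1::real}" "\<lambda>\<theta>. D (x + \<theta> *\<^sub>R e)"]
      by (simp add: set_lebesgue_integral_def integral_unique)
  qed
  have "integrable (lborel \<Otimes>\<^sub>M lborel) (\<lambda>(\<theta>, x). indicator {0..1::real} \<theta> *\<^sub>R D (x + \<theta> *\<^sub>R e))"
  proof (rule lborel_pair.Fubini_integrable)
    show "(\<lambda>(\<theta>, x). indicator {0..1::real} \<theta> *\<^sub>R D (x + \<theta> *\<^sub>R e)) \<in> borel_measurable (lborel \<Otimes>\<^sub>M lborel)"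
      by measurable
    have "(\<integral>x. norm (indicator {0..1::real} \<theta> *\<^sub>R D (x + \<theta> *\<^sub>R e)) \<partial>lborel)
        = indicator {0..1} \<theta> * (\<integral>x. norm (D x) \<partial>lborel)" for \<theta>
      by (simp add: integral_lborel_translate[of "\<lambda>x. \<bar>D x\<bar>"] abs_mult)
    then show "integrable lborel (\<lambda>\<theta>. \<integral>x. norm (case (\<theta>, x) of (\<theta>, x) \<Rightarrow> indicator {0..1::real} \<theta> *\<^sub>R D (x + \<theta> *\<^sub>R e)) \<partial>lborel)"
      by simp
    have "integrable lborel (\<lambda>x. D (x + y))" for y
      using int' integrable_distr_eq[of "(+) y" lborel borel D]
      by (simp add: D_def[symmetric] lborel_distr_plus add.commute)
    then show "AE \<theta> in lborel. integrable lborel (\<lambda>x. case (\<theta>, x) of (\<theta>, x) \<Rightarrow> indicator {0..1::real} \<theta> *\<^sub>R D (x + \<theta> *\<^sub>R e))"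
      by auto
  qed
  then have "(\<integral>x. (\<integral>\<theta>. indicator {0..1} \<theta> *\<^sub>R D (x + \<theta> *\<^sub>R e) \<partial>lborel) \<partial>lborel)
     = (\<integral>\<theta>. (\<integral>x. indicator {0..1::real} \<theta> *\<^sub>R D (x + \<theta> *\<^sub>R e) \<partial>lborel) \<partial>lborel)"
    by (rule lborel_pair.Fubini_integral)
  also have "\<dots> = (\<integral>x. D x \<partial>lborel)"
    by (simp add: integral_lborel_translate[of D])
  finally have "(\<integral>x. D x \<partial>lborel) = (\<integral>x. f (x + e) - f x \<partial>lborel)"
    by (simp add: ftc del: real_scaleR_def)
  also have "\<dots> = 0"
  proof -
    have "integrable lborel (\<lambda>x. f (x + e))"
      using int integrable_distr_eq[of "(+) e" lborel borel f] by (simp add: lborel_distr_plus add.commute)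
    then show ?thesis
      using int by (simp add: integral_lborel_translate[of f])
  qed
  finally show ?thesis by (simp add: D_def)
qed

text \<open>Differentiation under the integral sign for vector parameters. The mean value inequality
  on the convex set \<open>W\<close> dominates the remainder quotient by \<open>2 * g x\<close>, and
  dominated convergence is applied along an arbitrary sequence tending to \<open>w\<close>.\<close>

lemma has_derivative_lebesgue_integral:
  fixes f :: "'w::euclidean_space \<Rightarrow> 'b::euclidean_space \<Rightarrow> 'c::euclidean_space"
  assumes W: "open W" "convex W" "w \<in> W"
    and int: "\<And>v. v \<in> W \<Longrightarrow> integrable M (f v)"
    and deriv: "\<And>v x. v \<in> W \<Longrightarrow> x \<in> space M \<Longrightarrow> ((\<lambda>v. f v x) has_derivative f' v x) (at v)"
    and bound: "\<And>v x h. v \<in> W \<Longrightarrow> x \<in> space M \<Longrightarrow> norm (f' v x h) \<le> g x * norm h"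
    and g: "integrable M g"
    and meas: "\<And>h. (\<lambda>x. f' w x h) \<in> borel_measurable M"
  shows "((\<lambda>v. \<integral>x. f v x \<partial>M) has_derivative (\<lambda>h. \<integral>x. f' w x h \<partial>M)) (at w)"
proof -
  have int': "integrable M (\<lambda>x. f' w x h)" for h
    by (rule Bochner_Integration.integrable_bound[of _ "\<lambda>x. g x * norm h"])
       (use bound[OF W(3)] g meas in \<open>auto intro!: AE_I2 order_trans[OF bound[OF W(3)]] mult_right_mono simp: abs_mult\<close>)
  have g0: "g x \<ge> 0" if "x \<in> space M" for x
  proof -
    obtain b :: 'w where "b \<in> Basis" using nonempty_Basis by blast
    then show ?thesis using order_trans[OF norm_ge_zero bound[OF W(3) that, of b]] by simp
  qed
  have lin: "bounded_linear (f' w x)" if "x \<in> space M" for x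
    using deriv[OF W(3) that] by (rule has_derivative_bounded_linear)
  have bl: "bounded_linear (\<lambda>h. \<integral>x. f' w x h \<partial>M)"
  proof (rule bounded_linear_intro)
    show "(\<integral>x. f' w x (a + b) \<partial>M) = (\<integral>x. f' w x a \<partial>M) + (\<integral>x. f' w x b \<partial>M)" for a b
      by (subst Bochner_Integration.integral_add[OF int' int', symmetric])
        (auto intro!: Bochner_Integration.integral_cong simp: bounded_linear.linear[OF lin] linear_add)
    show "(\<integral>x. f' w x (r *\<^sub>R a) \<partial>M) = r *\<^sub>R (\<integral>x. f' w x a \<partial>M)" for a r
    proof -
      have "(\<integral>x. f' w x (r *\<^sub>R a) \<partial>M) = (\<integral>x. r *\<^sub>R f' w x a \<partial>M)"
        by (rule Bochner_Integration.integral_cong)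
          (simp_all add: bounded_linear.linear[OF lin] linear_cmul)
      then show ?thesis by simp
    qed
    show "norm (\<integral>x. f' w x a \<partial>M) \<le> norm a * (\<integral>x. g x \<partial>M)" for a
    proof -
      have "norm (\<integral>x. f' w x a \<partial>M) \<le> (\<integral>x. g x * norm a \<partial>M)"
        by (rule Bochner_Integration.integral_norm_bound_integral[OF int' _ bound[OF W(3)]])
          (use g in simp_all)
      then show ?thesis by (simp add: mult.commute)
    qed
  qed
  have "((\<lambda>v. (1 / norm (v - w)) *\<^sub>R ((\<integral>x. f v x \<partial>M) - ((\<integral>x. f w x \<partial>M) + (\<integral>x. f' w x (v - w) \<partial>M)))) \<longlongrightarrow> 0) (at w)"
    unfolding tendsto_at_iff_sequentially
  proof (intro allI impI)
    fix X :: "nat \<Rightarrow> 'w"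
    assume X: "\<forall>i. X i \<in> UNIV - {w}" "X \<longlonglongrightarrow> w"
    have ev: "eventually (\<lambda>n. X n \<in> W) sequentially"
      using X(2) W by (auto dest: topological_tendstoD)
    then obtain N where N: "\<And>n. n \<ge> N \<Longrightarrow> X n \<in> W" by (auto simp: eventually_sequentially)
    define R where "R n x = (1 / norm (X n - w)) *\<^sub>R (f (X n) x - (f w x + f' w x (X n - w)))" for n x
    have XW: "X (n + N) \<in> W" for n using N by simp
    \<comment> \<open>Only the tail of the sequence is known to lie in \<open>W\<close>, where
      integrability and the bound hold; hence the shift by \<open>N\<close>.\<close>
    have "(\<lambda>n. \<integral>x. R (n + N) x \<partial>M) \<longlonglongrightarrow> (\<integral>x. 0 \<partial>M)"
    proof (rule integral_dominated_convergence[where w="\<lambda>x. 2 * g x"])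
      show "R (n + N) \<in> borel_measurable M" for n
        unfolding R_def using int[OF XW] int[OF W(3)] meas by measurable
      show "integrable M (\<lambda>x. 2 * g x)" using g by simp
      show "AE x in M. (\<lambda>n. R (n + N) x) \<longlonglongrightarrow> 0"
      proof (rule AE_I2)
        fix x assume "x \<in> space M"
        from deriv[OF W(3) this] have "((\<lambda>v. (1 / norm (v - w)) *\<^sub>R (f v x - (f w x + f' w x (v - w)))) \<longlongrightarrow> 0) (at w)"
          by (simp add: has_derivative_within)
        then have "(\<lambda>n. R n x) \<longlonglongrightarrow> 0"
          unfolding tendsto_at_iff_sequentially R_def using X by (auto simp: o_def)
        then show "(\<lambda>n. R (n + N) x) \<longlonglongrightarrow> 0" by (rule LIMSEQ_ignore_initial_segment)
      qed
      show "AE x in M. norm (R (n + N) x) \<le> 2 * g x" for n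
      proof (rule AE_I2)
        fix x assume x: "x \<in> space M"
        let ?v = "X (n + N)"
        have "norm (f ?v x - f w x) \<le> g x * norm (?v - w)"
        proof (rule differentiable_bound[OF W(2)])
          show "((\<lambda>v. f v x) has_derivative f' v x) (at v within W)" if "v \<in> W" for v
            using deriv[OF that x] by (rule has_derivative_at_withinI)
          show "onorm (f' v x) \<le> g x" if "v \<in> W" for v
            by (rule onorm_bound) (use g0[OF x] bound[OF that x] in auto)
        qed (use XW W in auto)
        moreover have "norm (f' w x (?v - w)) \<le> g x * norm (?v - w)"
          using bound[OF W(3) x] .
        ultimately have "norm (f ?v x - (f w x + f' w x (?v - w))) \<le> 2 * g x * norm (?v - w)"
          using norm_triangle_ineq4[of "f ?v x - f w x" "f' w x (?v - w)"] by (simp add: algebra_simps)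
        moreover have "norm (?v - w) > 0" using X(1) by auto
        ultimately show "norm (R (n + N) x) \<le> 2 * g x"
          by (simp add: R_def divide_simps)
      qed
    qed simp
    then have "(\<lambda>n. \<integral>x. R n x \<partial>M) \<longlonglongrightarrow> 0"
      by (simp add: LIMSEQ_offset[where k=N and f="\<lambda>n. \<integral>x. R n x \<partial>M"])
    moreover have "eventually (\<lambda>n. (\<integral>x. R n x \<partial>M) = (1 / norm (X n - w)) *\<^sub>R ((\<integral>x. f (X n) x \<partial>M) - ((\<integral>x. f w x \<partial>M) + (\<integral>x. f' w x (X n - w) \<partial>M)))) sequentially"
      using ev
    proof eventually_elim
      case (elim n)
      show ?case unfolding R_def
        using int[OF elim] int[OF W(3)] int' by simp
    qed
    ultimately have "(\<lambda>n. (1 / norm (X n - w)) *\<^sub>R ((\<integral>x. f (X n) x \<partial>M) - ((\<integral>x. f w x \<partial>M) + (\<integral>x. f' w x (X n - w) \<partial>M)))) \<longlonglongrightarrow> 0"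
      by (rule Lim_transform_eventually)
    then show "((\<lambda>v. (1 / norm (v - w)) *\<^sub>R ((\<integral>x. f v x \<partial>M) - ((\<integral>x. f w x \<partial>M) + (\<integral>x. f' w x (v - w) \<partial>M)))) \<circ> X) \<longlonglongrightarrow> 0"
      by (simp add: o_def)
  qed
  with bl show ?thesis by (simp add: has_derivative_within)
qed

section \<open>Derivatives of the heat kernel, with bounds uniform for times in a compact
  interval\<close>

definition hk_grad :: "real \<Rightarrow> 'a::euclidean_space \<Rightarrow> 'a" where
  "hk_grad \<tau> u = (- hk \<tau> u / \<tau>) *\<^sub>R u"

definition hk_hess :: "real \<Rightarrow> 'a::euclidean_space \<Rightarrow> 'a \<Rightarrow> 'a" where
  "hk_hess \<tau> u e = hk \<tau> u *\<^sub>R (((u \<bullet> e) / \<tau>\<^sup>2) *\<^sub>R u - (1 / \<tau>) *\<^sub>R e)"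

definition hk_lap :: "real \<Rightarrow> 'a::euclidean_space \<Rightarrow> real" where
  "hk_lap \<tau> u = hk \<tau> u * ((norm u)\<^sup>2 / \<tau>\<^sup>2 - real DIM('a) / \<tau>)"

lemma has_derivative_hk:
  assumes "\<tau> > 0"
  shows "(hk \<tau> has_derivative (\<lambda>e. hk_grad \<tau> u \<bullet> e)) (at u)"
proof -
  have eq: "hk \<tau> = (\<lambda>u::'a. (2 * pi * \<tau>) powr (- real DIM('a) / 2) * exp (- (u \<bullet> u) / (2 * \<tau>)))"
    by (simp add: hk_def power2_norm_eq_inner fun_eq_iff)
  define C where "C = (2 * pi * \<tau>) powr (- real DIM('a) / 2)"
  have "((\<lambda>u::'a. C * exp (- (u \<bullet> u) / (2 * \<tau>))) has_derivative
      (\<lambda>e. C * (exp (- (u \<bullet> u) / (2 * \<tau>)) * (- (u \<bullet> e) / \<tau>)))) (at u)"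
    using assms by (auto intro!: derivative_eq_intros simp: fun_eq_iff inner_commute)
  moreover have "hk_grad \<tau> u \<bullet> e = C * (exp (- (u \<bullet> u) / (2 * \<tau>)) * (- (u \<bullet> e) / \<tau>))" for e
    unfolding hk_grad_def eq by (simp add: C_def)
  ultimately show ?thesis
    by (simp add: eq C_def)
qed

lemma has_derivative_hk_grad:
  assumes "\<tau> > 0"
  shows "(hk_grad \<tau> has_derivative hk_hess \<tau> u) (at u)"
  unfolding hk_grad_def[abs_def]
  by (rule derivative_eq_intros has_derivative_hk[OF assms] refl)+
     (use assms in \<open>auto simp: hk_hess_def hk_grad_def fun_eq_iff algebra_simps power2_eq_square scaleR_add_left[symmetric]\<close>)

text \<open>The heat equation. The time is the variance of the kernel, so its generator is half the
  Laplacian; the same half turns up as the speed of the flow.\<close>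

lemma has_real_derivative_hk_time:
  assumes "\<tau> > 0"
  shows "((\<lambda>\<tau>. hk \<tau> (u::'a::euclidean_space)) has_real_derivative hk_lap \<tau> u / 2) (at \<tau>)"
proof -
  let ?d = "- real DIM('a) / 2"
  have "((\<lambda>\<tau>. hk \<tau> u) has_real_derivative
      (?d * (2 * pi * \<tau>) powr (?d - 1) * (2 * pi)) * exp (- (norm u)\<^sup>2 / (2 * \<tau>))
       + (2 * pi * \<tau>) powr ?d * (exp (- (norm u)\<^sup>2 / (2 * \<tau>)) * ((norm u)\<^sup>2 / (2 * \<tau>\<^sup>2)))) (at \<tau>)"
    unfolding hk_def
    using assms by (auto intro!: derivative_eq_intros simp: power2_eq_square)
  moreover have "(2 * pi * \<tau>) powr (?d - 1) = (2 * pi * \<tau>) powr ?d / (2 * pi * \<tau>)"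
    using assms by (simp add: powr_diff)
  moreover have "(?d * ((2 * pi * \<tau>) powr ?d / (2 * pi * \<tau>)) * (2 * pi)) * exp (- (norm u)\<^sup>2 / (2 * \<tau>))
       + (2 * pi * \<tau>) powr ?d * (exp (- (norm u)\<^sup>2 / (2 * \<tau>)) * ((norm u)\<^sup>2 / (2 * \<tau>\<^sup>2))) = hk_lap \<tau> u / 2"
    using assms by (simp add: hk_lap_def hk_def field_simps power2_eq_square)
  ultimately show ?thesis by (simp only:)
qed

lemma hk_lap_eq_trace_hk_hess:
  assumes "\<tau> > 0"
  shows "hk_lap \<tau> (u::'a::euclidean_space) = (\<Sum>b\<in>Basis. hk_hess \<tau> u b \<bullet> b)"
proof -
  have "(norm u)\<^sup>2 = (\<Sum>b\<in>Basis. (u \<bullet> b)\<^sup>2)"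
    unfolding power2_norm_eq_inner by (subst euclidean_inner) (simp add: power2_eq_square)
  moreover have "hk_hess \<tau> u b \<bullet> b = hk \<tau> u * ((u \<bullet> b)\<^sup>2 / \<tau>\<^sup>2 - 1 / \<tau>)" if "b \<in> Basis" for b
    using that by (simp add: hk_hess_def inner_diff_left power2_eq_square)
  ultimately show ?thesis
    by (simp add: hk_lap_def sum_distrib_left[symmetric] sum_subtractf sum_divide_distrib[symmetric])
qed

lemma continuous_on_hk:
  assumes "a > 0"
  shows "continuous_on ({a..b} \<times> UNIV) (\<lambda>(\<tau>, u::'a::euclidean_space). hk \<tau> u)"
  unfolding hk_def case_prod_beta
  using assms by (auto intro!: continuous_intros)

text \<open>Gaussian decay absorbs a quadratic weight, the highest degree occurring in
  \<open>hk_hess\<close> and \<open>hk_lap\<close>: the inequality \<open>t \<le> exp t\<close>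
  bounds the exponential times the squared norm by \<open>2 * \<tau>\<close>, and the normalising
  factor is largest at the smallest time \<open>a\<close>.\<close>

lemma hk_poly_bound:
  assumes "0 < a"
  obtains K where "K > 0" "\<And>\<tau> u. \<tau> \<in> {a..b} \<Longrightarrow> hk \<tau> (u::'a::euclidean_space) * (1 + norm u)\<^sup>2 \<le> K"
proof
  define C where "C = (2 * pi * a) powr (- real DIM('a) / 2)"
  have C: "C > 0" using assms by (simp add: C_def)
  \<comment> \<open>The maximum with 0 keeps the constant positive when the interval
    \<open>{a..b}\<close> is empty.\<close>
  show "C * (2 + 4 * max b 0) > 0" using C by (simp add: add_pos_nonneg)
  fix \<tau> :: real and u :: 'a assume \<tau>: "\<tau> \<in> {a..b}"
  define E where "E = exp (- (norm u)\<^sup>2 / (2 * \<tau>))"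
  have pos: "\<tau> > 0" using \<tau> assms by auto
  have E1: "E \<le> 1" "E \<ge> 0" using pos by (simp_all add: E_def)
  have E2: "E * (norm u)\<^sup>2 \<le> 2 * \<tau>"
  proof -
    let ?t = "(norm u)\<^sup>2 / (2 * \<tau>)"
    have "?t \<le> exp ?t" using exp_ge_add_one_self[of ?t] by linarith
    then have "?t * exp (- ?t) \<le> 1"
      using mult_right_mono[of ?t "exp ?t" "exp (- ?t)"] by (simp add: exp_minus)
    then show ?thesis using pos by (simp add: E_def field_simps)
  qed
  have "(1 + norm u)\<^sup>2 \<le> 2 + 2 * (norm u)\<^sup>2"
    using zero_le_power2[of "1 - norm u"] by (simp add: power2_eq_square algebra_simps)
  from mult_left_mono[OF this E1(2)] have "E * (1 + norm u)\<^sup>2 \<le> 2 + 4 * \<tau>"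
    using E1 E2 by (simp add: algebra_simps)
  also have "\<dots> \<le> 2 + 4 * max b 0" using \<tau> by auto
  finally have E3: "E * (1 + norm u)\<^sup>2 \<le> 2 + 4 * max b 0" .
  have "(2 * pi * \<tau>) powr (- real DIM('a) / 2) \<le> C"
    unfolding C_def by (rule powr_mono2') (use \<tau> assms in auto)
  from mult_mono[OF this E3] have "(2 * pi * \<tau>) powr (- real DIM('a) / 2) * (E * (1 + norm u)\<^sup>2) \<le> C * (2 + 4 * max b 0)"
    using C E1 by auto
  then show "hk \<tau> u * (1 + norm u)\<^sup>2 \<le> C * (2 + 4 * max b 0)"
    by (simp add: hk_def E_def mult.assoc)
qed

lemma hk_kernel_bounds:
  assumes "0 < a"
  obtains K where "K > 0"
    "\<And>\<tau> u. \<tau> \<in> {a..b} \<Longrightarrow> hk \<tau> (u::'a::euclidean_space) \<le> K"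
    "\<And>\<tau> u. \<tau> \<in> {a..b} \<Longrightarrow> norm (hk_grad \<tau> (u::'a)) \<le> K"
    "\<And>\<tau> u e. \<tau> \<in> {a..b} \<Longrightarrow> norm (hk_hess \<tau> (u::'a) e) \<le> K * norm e"
    "\<And>\<tau> u. \<tau> \<in> {a..b} \<Longrightarrow> \<bar>hk_lap \<tau> (u::'a)\<bar> \<le> K"
proof -
  obtain C where C: "C > 0" "\<And>\<tau> u. \<tau> \<in> {a..b} \<Longrightarrow> hk \<tau> (u::'a) * (1 + norm u)\<^sup>2 \<le> C"
    using hk_poly_bound[OF assms] by metis
  \<comment> \<open>\<open>?N\<close> adds up all inverse powers of the time that occur in the four
    kernels, taken at the smallest time; each kernel is then at most \<open>hk\<close> times the
    quadratic weight times \<open>?N\<close>.\<close>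
  let ?N = "1 + 1 / a + 1 / a\<^sup>2 + real DIM('a) / a"
  have N: "?N > 0" using assms by (auto intro!: add_pos_nonneg)
  have *: "hk \<tau> u * x \<le> C * ?N * y"
    if "\<tau> \<in> {a..b}" "x \<le> (1 + norm u)\<^sup>2 * ?N * y" "y \<ge> 0" for \<tau> x y and u :: 'a
  proof -
    have "hk \<tau> u * x \<le> hk \<tau> u * ((1 + norm u)\<^sup>2 * ?N * y)"
      using that(2) by (rule mult_left_mono) (simp add: hk_nonneg)
    also have "\<dots> = (hk \<tau> u * (1 + norm u)\<^sup>2) * (?N * y)" by (simp add: mult.assoc)
    also have "\<dots> \<le> C * (?N * y)"
      using C(2)[OF that(1)] N that(3) by (intro mult_right_mono) auto
    finally show ?thesis by (simp add: mult.assoc)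
  qed
  have inv: "1 / \<tau> \<le> 1 / a" "1 / \<tau>\<^sup>2 \<le> 1 / a\<^sup>2" "\<tau> > 0" if "\<tau> \<in> {a..b}" for \<tau>
    using that assms by (auto intro!: divide_left_mono power_mono)
  have sq: "1 \<le> (1 + norm u)\<^sup>2" "norm u \<le> (1 + norm u)\<^sup>2" "(norm u)\<^sup>2 \<le> (1 + norm u)\<^sup>2" for u :: 'a
    by (simp_all add: power2_eq_square algebra_simps add_nonneg_nonneg)
  have aux: "x * t \<le> X * (?N)" if "x \<le> X" "t \<le> ?N" "x \<ge> 0" "t \<ge> 0" for x X t
    using that N by (intro mult_mono) auto
  have le: "1 \<le> ?N" "1 / a \<le> ?N" "1/a\<^sup>2 + 1/a \<le> ?N" "1/a\<^sup>2 + real DIM('a) / a \<le> ?N"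
    using assms by (auto intro!: add_nonneg_nonneg)
  show ?thesis
  proof (rule that[of "C * ?N"])
    show "C * ?N > 0" using C N by simp
    fix \<tau> :: real and u e :: 'a assume \<tau>: "\<tau> \<in> {a..b}"
    note i = inv[OF \<tau>]
    show "hk \<tau> u \<le> C * ?N"
      using *[OF \<tau>, of 1 u 1] aux[OF sq(1)[of u] le(1)] by simp
    have "norm u * (1 / \<tau>) \<le> (1 + norm u)\<^sup>2 * ?N"
      using i le by (intro aux sq) auto
    then show "norm (hk_grad \<tau> u) \<le> C * ?N"
      using *[OF \<tau>, of "norm u * (1/\<tau>)" u 1] i(3) by (simp add: hk_grad_def hk_nonneg)
    have "norm (((u \<bullet> e) / \<tau>\<^sup>2) *\<^sub>R u - (1 / \<tau>) *\<^sub>R e) \<le> \<bar>u \<bullet> e\<bar> / \<tau>\<^sup>2 * norm u + 1 / \<tau> * norm e"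
      by (rule order_trans[OF norm_triangle_ineq4]) (use i in auto)
    also have "\<dots> \<le> (norm u * norm e) * (1 / \<tau>\<^sup>2) * norm u + 1 / \<tau> * norm e"
      by (auto intro!: mult_right_mono divide_right_mono Cauchy_Schwarz_ineq2)
    also have "\<dots> = ((norm u)\<^sup>2 * (1 / \<tau>\<^sup>2) + 1 * (1/\<tau>)) * norm e"
      by (simp add: power2_eq_square algebra_simps)
    also have "\<dots> \<le> ((1 + norm u)\<^sup>2 * (1 / a\<^sup>2) + (1 + norm u)\<^sup>2 * (1/a)) * norm e"
      using i sq[of u] by (intro mult_right_mono add_mono mult_mono) auto
    also have "\<dots> = ((1 + norm u)\<^sup>2 * (1 / a\<^sup>2 + 1 / a)) * norm e" by (simp add: algebra_simps)
    also have "\<dots> \<le> (1 + norm u)\<^sup>2 * ?N * norm e"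
      using le(3) by (intro mult_right_mono mult_left_mono) auto
    finally have "hk \<tau> u * norm (((u \<bullet> e) / \<tau>\<^sup>2) *\<^sub>R u - (1 / \<tau>) *\<^sub>R e) \<le> C * ?N * norm e"
      by (intro * \<tau>) auto
    then show "norm (hk_hess \<tau> u e) \<le> C * ?N * norm e"
      by (simp add: hk_hess_def hk_nonneg)
    have "\<bar>(norm u)\<^sup>2 / \<tau>\<^sup>2 - real DIM('a) / \<tau>\<bar> \<le> (norm u)\<^sup>2 * (1 / \<tau>\<^sup>2) + 1 * (real DIM('a) * (1 / \<tau>))"
      by (rule order_trans[OF abs_triangle_ineq4]) (use i in auto)
    also have "\<dots> \<le> (1 + norm u)\<^sup>2 * (1 / a\<^sup>2) + (1 + norm u)\<^sup>2 * (real DIM('a) * (1/a))"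
      using i sq[of u] by (intro add_mono mult_mono mult_left_mono) auto
    also have "\<dots> = (1 + norm u)\<^sup>2 * (1 / a\<^sup>2 + real DIM('a) / a)" by (simp add: algebra_simps)
    also have "\<dots> \<le> (1 + norm u)\<^sup>2 * ?N * 1"
      using le(4) by (simp add: mult_left_mono)
    finally have "hk \<tau> u * \<bar>(norm u)\<^sup>2 / \<tau>\<^sup>2 - real DIM('a) / \<tau>\<bar> \<le> C * ?N * 1"
      by (intro * \<tau>) auto
    then show "\<bar>hk_lap \<tau> u\<bar> \<le> C * ?N"
      by (simp add: hk_lap_def abs_mult hk_nonneg)
  qed
qed

section \<open>The heat evolution of an integrable function\<close>

definition heat :: "('a::euclidean_space \<Rightarrow> real) \<Rightarrow> real \<Rightarrow> 'a \<Rightarrow> real" where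
  "heat f \<tau> y = (\<integral>x. f x *\<^sub>R hk \<tau> (y - x) \<partial>lborel)"

text \<open>All derivatives are put on the kernel, so \<open>f\<close> may be any integrable
  function. That these integrals are the derivatives of \<open>heat\<close> is proved below.\<close>

definition heat_grad :: "('a::euclidean_space \<Rightarrow> real) \<Rightarrow> real \<Rightarrow> 'a \<Rightarrow> 'a" where
  "heat_grad f \<tau> y = (\<integral>x. f x *\<^sub>R hk_grad \<tau> (y - x) \<partial>lborel)"

definition heat_hess :: "('a::euclidean_space \<Rightarrow> real) \<Rightarrow> real \<Rightarrow> 'a \<Rightarrow> 'a \<Rightarrow> 'a" where
  "heat_hess f \<tau> y e = (\<integral>x. f x *\<^sub>R hk_hess \<tau> (y - x) e \<partial>lborel)"

definition heat_lap :: "('a::euclidean_space \<Rightarrow> real) \<Rightarrow> real \<Rightarrow> 'a \<Rightarrow> real" where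
  "heat_lap f \<tau> y = (\<integral>x. f x *\<^sub>R hk_lap \<tau> (y - x) \<partial>lborel)"

lemma hk_grad_measurable [measurable]: "hk_grad \<tau> \<in> borel_measurable borel"
  unfolding hk_grad_def by measurable

lemma hk_hess_measurable [measurable]: "(\<lambda>u. hk_hess \<tau> u e) \<in> borel_measurable borel"
  unfolding hk_hess_def by measurable

lemma hk_lap_measurable [measurable]: "hk_lap \<tau> \<in> borel_measurable borel"
  unfolding hk_lap_def by measurable

lemma continuous_on_hk_grad:
  assumes "a > 0"
  shows "continuous_on ({a..b} \<times> UNIV) (\<lambda>(\<tau>, u::'a::euclidean_space). hk_grad \<tau> u)"
  using continuous_on_hk[OF assms, of b, where 'a='a] assms
  unfolding hk_grad_def case_prod_beta by (auto intro!: continuous_intros)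

lemma continuous_on_hk_hess:
  assumes "a > 0"
  shows "continuous_on ({a..b} \<times> UNIV) (\<lambda>(\<tau>, u::'a::euclidean_space). hk_hess \<tau> u e)"
  using continuous_on_hk[OF assms, of b, where 'a='a] assms
  unfolding hk_hess_def case_prod_beta by (auto intro!: continuous_intros)

lemma continuous_on_hk_lap:
  assumes "a > 0"
  shows "continuous_on ({a..b} \<times> UNIV) (\<lambda>(\<tau>, u::'a::euclidean_space). hk_lap \<tau> u)"
  using continuous_on_hk[OF assms, of b, where 'a='a] assms
  unfolding hk_lap_def case_prod_beta by (auto intro!: continuous_intros)

lemma integrable_conv_bounded:
  fixes k :: "'a::euclidean_space \<Rightarrow> 'c::{banach,second_countable_topology}"
  assumes f: "integrable lborel f" and [measurable]: "k \<in> borel_measurable borel"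
    and k: "\<And>u. norm (k u) \<le> K"
  shows "integrable lborel (\<lambda>x. f x *\<^sub>R k (y - x))"
proof (rule Bochner_Integration.integrable_bound)
  show "integrable lborel (\<lambda>x. K * f x)" using f by simp
  have [measurable]: "f \<in> borel_measurable borel" using f by auto
  show "(\<lambda>x. f x *\<^sub>R k (y - x)) \<in> borel_measurable lborel" by measurable
  have "norm (f x *\<^sub>R k (y - x)) \<le> norm (K * f x)" for x
    using mult_right_mono[OF order_trans[OF k abs_ge_self], of "\<bar>f x\<bar>"]
    by (simp add: abs_mult mult.commute)
  then show "AE x in lborel. norm (f x *\<^sub>R k (y - x)) \<le> norm (K * f x)" by simp
qed

lemma norm_conv_bounded_le:
  fixes k :: "'a::euclidean_space \<Rightarrow> 'c::{banach,second_countable_topology}"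
  assumes f: "integrable lborel f" and [measurable]: "k \<in> borel_measurable borel"
    and k: "\<And>u. norm (k u) \<le> K"
  shows "norm (\<integral>x. f x *\<^sub>R k (y - x) \<partial>lborel) \<le> K * (\<integral>x. \<bar>f x\<bar> \<partial>lborel)"
proof -
  have "norm (\<integral>x. f x *\<^sub>R k (y - x) \<partial>lborel) \<le> (\<integral>x. K * \<bar>f x\<bar> \<partial>lborel)"
  proof (rule Bochner_Integration.integral_norm_bound_integral)
    show "integrable lborel (\<lambda>x. f x *\<^sub>R k (y - x))"
      using f k by (intro integrable_conv_bounded) auto
    show "norm (f x *\<^sub>R k (y - x)) \<le> K * \<bar>f x\<bar>" for x
      using mult_right_mono[OF k, of "\<bar>f x\<bar>"] by (simp add: mult.commute)
  qed (use f in simp)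
  then show ?thesis by simp
qed

lemma has_derivative_conv:
  fixes k :: "'a::euclidean_space \<Rightarrow> 'c::euclidean_space"
  assumes f: "integrable lborel f"
    and k: "\<And>u. norm (k u) \<le> K" and k': "\<And>u e. norm (k' u e) \<le> K * norm e"
    and deriv: "\<And>u. (k has_derivative k' u) (at u)"
    and [measurable]: "\<And>e. (\<lambda>u. k' u e) \<in> borel_measurable borel"
  shows "((\<lambda>y. \<integral>x. f x *\<^sub>R k (y - x) \<partial>lborel) has_derivative (\<lambda>e. \<integral>x. f x *\<^sub>R k' (y - x) e \<partial>lborel)) (at y)"
proof (rule has_derivative_lebesgue_integral[of UNIV])
  have [measurable]: "f \<in> borel_measurable borel" using f by auto
  have [measurable]: "k \<in> borel_measurable borel"
    using deriv by (intro borel_measurable_continuous_onI)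
      (auto intro: has_derivative_continuous continuous_at_imp_continuous_on)
  show "integrable lborel (\<lambda>x. f x *\<^sub>R k (v - x))" for v
    using f k by (intro integrable_conv_bounded) auto
  show "((\<lambda>v. f x *\<^sub>R k (v - x)) has_derivative (\<lambda>e. f x *\<^sub>R k' (v - x) e)) (at v)" for v x
    by (rule has_derivative_scaleR_right, rule has_derivative_compose[of "\<lambda>v. v - x", OF _ deriv])
      (auto intro!: derivative_eq_intros)
  show "norm (f x *\<^sub>R k' (v - x) h) \<le> (K * \<bar>f x\<bar>) * norm h" for v x h
    using mult_left_mono[OF k', of "\<bar>f x\<bar>"] by (simp add: mult_ac)
  show "integrable lborel (\<lambda>x. K * \<bar>f x\<bar>)" using f by simp
  show "(\<lambda>x. f x *\<^sub>R k' (y - x) h) \<in> borel_measurable lborel" for h by measurable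
qed auto

lemma continuous_on_conv:
  fixes k :: "real \<Rightarrow> 'a::euclidean_space \<Rightarrow> 'c::{banach,second_countable_topology}"
  assumes f: "integrable lborel f"
    and [measurable]: "\<And>\<tau>. k \<tau> \<in> borel_measurable borel"
    and k: "\<And>\<tau> u. \<tau> \<in> I \<Longrightarrow> norm (k \<tau> u) \<le> K"
    and cont: "continuous_on (I \<times> UNIV) (\<lambda>(\<tau>, u). k \<tau> u)"
  shows "continuous_on (I \<times> UNIV) (\<lambda>(\<tau>, y). \<integral>x. f x *\<^sub>R k \<tau> (y - x) \<partial>lborel)"
  unfolding continuous_on_sequentially
proof (intro allI ballI impI, elim conjE)
  fix X :: "nat \<Rightarrow> real \<times> 'a" and l
  assume l: "l \<in> I \<times> UNIV" and X: "\<forall>n. X n \<in> I \<times> UNIV" "X \<longlonglongrightarrow> l"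
  have [measurable]: "f \<in> borel_measurable borel" using f by auto
  have "(\<lambda>n. \<integral>x. f x *\<^sub>R k (fst (X n)) (snd (X n) - x) \<partial>lborel) \<longlonglongrightarrow> (\<integral>x. f x *\<^sub>R k (fst l) (snd l - x) \<partial>lborel)"
  proof (rule integral_dominated_convergence[where w="\<lambda>x. K * \<bar>f x\<bar>"])
    show "integrable lborel (\<lambda>x. K * \<bar>f x\<bar>)" using f by simp
    have "(\<lambda>n. k (fst (X n)) (snd (X n) - x)) \<longlonglongrightarrow> k (fst l) (snd l - x)" for x
    proof -
      have "(\<lambda>n. (fst (X n), snd (X n) - x)) \<longlonglongrightarrow> (fst l, snd l - x)"
        using X(2) by (auto intro!: tendsto_intros)
      moreover have "(fst l, snd l - x) \<in> I \<times> UNIV" "\<forall>n. (fst (X n), snd (X n) - x) \<in> I \<times> UNIV"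
        using l X(1) by (auto simp: mem_Times_iff)
      ultimately have "((\<lambda>(\<tau>, u). k \<tau> u) \<circ> (\<lambda>n. (fst (X n), snd (X n) - x))) \<longlonglongrightarrow> (\<lambda>(\<tau>, u). k \<tau> u) (fst l, snd l - x)"
        by (intro cont[unfolded continuous_on_sequentially, rule_format] conjI) auto
      then show ?thesis by (simp add: o_def)
    qed
    then show "AE x in lborel. (\<lambda>n. f x *\<^sub>R k (fst (X n)) (snd (X n) - x)) \<longlonglongrightarrow> f x *\<^sub>R k (fst l) (snd l - x)"
      by (auto intro!: tendsto_intros)
    have "norm (f x *\<^sub>R k (fst (X n)) (snd (X n) - x)) \<le> K * \<bar>f x\<bar>" for n x
      using mult_left_mono[OF k, of "fst (X n)" "\<bar>f x\<bar>"] X(1) by (auto simp: mult.commute mem_Times_iff)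
    then show "AE x in lborel. norm (f x *\<^sub>R k (fst (X n)) (snd (X n) - x)) \<le> K * \<bar>f x\<bar>" for n by simp
  qed auto
  then show "((\<lambda>(\<tau>, y). \<integral>x. f x *\<^sub>R k \<tau> (y - x) \<partial>lborel) \<circ> X) \<longlonglongrightarrow> (\<lambda>(\<tau>, y). \<integral>x. f x *\<^sub>R k \<tau> (y - x) \<partial>lborel) l"
    by (simp add: o_def case_prod_beta)
qed

lemma has_derivative_heat:
  assumes "integrable lborel f" "\<tau> > 0"
  shows "(heat f \<tau> has_derivative (\<lambda>e. heat_grad f \<tau> y \<bullet> e)) (at y)"
proof -
  obtain K where K: "K > 0" "\<And>\<tau>' u. \<tau>' \<in> {\<tau>..\<tau>} \<Longrightarrow> hk \<tau>' (u::'a) \<le> K"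
    "\<And>\<tau>' u. \<tau>' \<in> {\<tau>..\<tau>} \<Longrightarrow> norm (hk_grad \<tau>' (u::'a)) \<le> K"
    using hk_kernel_bounds[OF assms(2), of \<tau>] by metis
  have "\<bar>hk_grad \<tau> u \<bullet> e\<bar> \<le> K * norm e" for u e :: 'a
    using order_trans[OF Cauchy_Schwarz_ineq2 mult_right_mono[OF K(3)[of \<tau> u]]] by simp
  then have "((\<lambda>y. \<integral>x. f x *\<^sub>R hk \<tau> (y - x) \<partial>lborel) has_derivative (\<lambda>e. \<integral>x. f x *\<^sub>R (hk_grad \<tau> (y - x) \<bullet> e) \<partial>lborel)) (at y)"
    using K has_derivative_hk[OF assms(2)] by (intro has_derivative_conv assms) (auto simp: hk_nonneg)
  moreover have "(\<integral>x. f x *\<^sub>R (hk_grad \<tau> (y - x) \<bullet> e) \<partial>lborel) = heat_grad f \<tau> y \<bullet> e" for e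
  proof -
    have "integrable lborel (\<lambda>x. f x *\<^sub>R hk_grad \<tau> (y - x))"
      using K by (intro integrable_conv_bounded assms) auto
    from integral_inner_left[OF this] show ?thesis by (simp add: heat_grad_def)
  qed
  ultimately show ?thesis by (simp add: heat_def[abs_def])
qed

lemma has_derivative_heat_grad:
  assumes "integrable lborel f" "\<tau> > 0"
  shows "(heat_grad f \<tau> has_derivative heat_hess f \<tau> y) (at y)"
proof -
  obtain K where K: "K > 0" 
    "\<And>\<tau>' u. \<tau>' \<in> {\<tau>..\<tau>} \<Longrightarrow> norm (hk_grad \<tau>' (u::'a)) \<le> K"
    "\<And>\<tau>' u e. \<tau>' \<in> {\<tau>..\<tau>} \<Longrightarrow> norm (hk_hess \<tau>' (u::'a) e) \<le> K * norm e"
    using hk_kernel_bounds[OF assms(2), of \<tau>] by metis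
  then have "((\<lambda>y. \<integral>x. f x *\<^sub>R hk_grad \<tau> (y - x) \<partial>lborel) has_derivative (\<lambda>e. \<integral>x. f x *\<^sub>R hk_hess \<tau> (y - x) e \<partial>lborel)) (at y)"
    using has_derivative_hk_grad[OF assms(2)] by (intro has_derivative_conv assms) auto
  then show ?thesis by (simp add: heat_grad_def[abs_def] heat_hess_def[abs_def])
qed

lemma has_real_derivative_heat_time:
  fixes f :: "'a::euclidean_space \<Rightarrow> real"
  assumes "integrable lborel f" "\<tau> > 0"
  shows "((\<lambda>\<tau>. heat f \<tau> y) has_real_derivative heat_lap f \<tau> y / 2) (at \<tau>)"
proof -
  have a: "\<tau> / 2 > 0" using assms by simp
  obtain K where K: "K > 0" "\<And>\<tau>' u. \<tau>' \<in> {\<tau>/2..2*\<tau>} \<Longrightarrow> hk \<tau>' (u::'a) \<le> K"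
    "\<And>\<tau>' u. \<tau>' \<in> {\<tau>/2..2*\<tau>} \<Longrightarrow> \<bar>hk_lap \<tau>' (u::'a)\<bar> \<le> K"
    using hk_kernel_bounds[OF a, of "2*\<tau>"] by metis
  have [measurable]: "f \<in> borel_measurable borel" using assms by auto
  have "((\<lambda>\<tau>. \<integral>x. f x *\<^sub>R hk \<tau> (y - x) \<partial>lborel) has_derivative (\<lambda>h. \<integral>x. f x *\<^sub>R (h * (hk_lap \<tau> (y - x) / 2)) \<partial>lborel)) (at \<tau>)"
  \<comment> \<open>The window keeps the times away from 0, where the kernel bounds
    degenerate.\<close>
  proof (rule has_derivative_lebesgue_integral[of "{\<tau>/2<..<2*\<tau>}"])
    show "integrable lborel (\<lambda>x. f x *\<^sub>R hk v (y - x))" if "v \<in> {\<tau>/2<..<2*\<tau>}" for v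
      using K that by (intro integrable_conv_bounded[of _ _ K] assms) (auto simp: hk_nonneg)
    show "((\<lambda>v. f x *\<^sub>R hk v (y - x)) has_derivative (\<lambda>h. f x *\<^sub>R (h * (hk_lap v (y - x) / 2)))) (at v)"
      if "v \<in> {\<tau>/2<..<2*\<tau>}" for v x
    proof -
      have "v > 0" using that assms by auto
      from has_real_derivative_hk_time[OF this, of "y - x"] show ?thesis
        by (intro has_derivative_scaleR_right)
          (simp only: has_field_derivative_def mult.commute[of _ "hk_lap v (y - x) / 2"])
    qed
    show "norm (f x *\<^sub>R (h * (hk_lap v (y - x) / 2))) \<le> (K * \<bar>f x\<bar>) * norm h"
      if "v \<in> {\<tau>/2<..<2*\<tau>}" for v x h
    proof -
      have "\<bar>hk_lap v (y - x) / 2\<bar> \<le> K" using K(3)[of v "y - x"] K(1) that by auto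
      from mult_right_mono[OF this, of "\<bar>f x\<bar> * \<bar>h\<bar>"] show ?thesis by (simp add: abs_mult mult_ac)
    qed
    show "integrable lborel (\<lambda>x. K * \<bar>f x\<bar>)" using assms by simp
  qed (use assms in auto)
  moreover have "(\<integral>x. f x *\<^sub>R (h * (hk_lap \<tau> (y - x) / 2)) \<partial>lborel) = heat_lap f \<tau> y / 2 * h" for h
  proof -
    have "(\<integral>x. f x *\<^sub>R (h * (hk_lap \<tau> (y - x) / 2)) \<partial>lborel) = (\<integral>x. (h/2) * (f x *\<^sub>R hk_lap \<tau> (y - x)) \<partial>lborel)"
      by (rule Bochner_Integration.integral_cong) (auto simp: mult_ac)
    then show ?thesis by (simp add: heat_lap_def)
  qed
  ultimately show ?thesis by (simp only: heat_def[abs_def] has_field_derivative_def)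
qed

lemma heat_lap_eq_trace:
  assumes "integrable lborel f" "\<tau> > 0"
  shows "heat_lap f \<tau> (y::'a::euclidean_space) = (\<Sum>b\<in>Basis. heat_hess f \<tau> y b \<bullet> b)"
proof -
  obtain K where K: "K > 0" 
    "\<And>\<tau>' u e. \<tau>' \<in> {\<tau>..\<tau>} \<Longrightarrow> norm (hk_hess \<tau>' (u::'a) e) \<le> K * norm e"
    using hk_kernel_bounds[OF assms(2), of \<tau>] by metis
  have int: "integrable lborel (\<lambda>x. f x *\<^sub>R hk_hess \<tau> (y - x) b)" for b
    using K(2)[of \<tau> _ b] by (intro integrable_conv_bounded assms) auto
  have "(\<Sum>b\<in>Basis. heat_hess f \<tau> y b \<bullet> b) = (\<integral>x. (\<Sum>b\<in>Basis. (f x *\<^sub>R hk_hess \<tau> (y - x) b) \<bullet> b) \<partial>lborel)"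
    unfolding heat_hess_def
    by (subst Bochner_Integration.integral_sum)
      (simp_all only: integral_inner_left[OF int] integrable_inner_left[OF int])
  also have "\<dots> = heat_lap f \<tau> y"
    unfolding heat_lap_def
    by (rule Bochner_Integration.integral_cong)
      (auto simp: hk_lap_eq_trace_hk_hess[OF assms(2)] sum_distrib_left)
  finally show ?thesis by simp
qed

lemma continuous_on_heat:
  assumes "integrable lborel (f::'a::euclidean_space \<Rightarrow> real)" "0 < a"
  shows "continuous_on ({a..b} \<times> UNIV) (\<lambda>(\<tau>, y). heat f \<tau> y)"
    and "continuous_on ({a..b} \<times> UNIV) (\<lambda>(\<tau>, y). heat_grad f \<tau> y)"
    and "continuous_on ({a..b} \<times> UNIV) (\<lambda>(\<tau>, y). heat_lap f \<tau> y)"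
    and "continuous_on ({a..b} \<times> UNIV) (\<lambda>(\<tau>, y). heat_hess f \<tau> y e)"
proof -
  obtain K where K: "K > 0"
    "\<And>\<tau> u. \<tau> \<in> {a..b} \<Longrightarrow> hk \<tau> (u::'a::euclidean_space) \<le> K"
    "\<And>\<tau> u. \<tau> \<in> {a..b} \<Longrightarrow> norm (hk_grad \<tau> (u::'a)) \<le> K"
    "\<And>\<tau> u e. \<tau> \<in> {a..b} \<Longrightarrow> norm (hk_hess \<tau> (u::'a) e) \<le> K * norm e"
    "\<And>\<tau> u. \<tau> \<in> {a..b} \<Longrightarrow> \<bar>hk_lap \<tau> (u::'a)\<bar> \<le> K"
    using hk_kernel_bounds[OF assms(2)] by metis
  show "continuous_on ({a..b} \<times> UNIV) (\<lambda>(\<tau>, y). heat f \<tau> y)"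
    unfolding heat_def by (rule continuous_on_conv[OF assms(1), where K=K])
      (use K in \<open>auto simp: hk_nonneg continuous_on_hk assms\<close>)
  show "continuous_on ({a..b} \<times> UNIV) (\<lambda>(\<tau>, y). heat_grad f \<tau> y)"
    unfolding heat_grad_def by (rule continuous_on_conv[OF assms(1), where K=K])
      (use K in \<open>auto simp: continuous_on_hk_grad assms\<close>)
  show "continuous_on ({a..b} \<times> UNIV) (\<lambda>(\<tau>, y). heat_lap f \<tau> y)"
    unfolding heat_lap_def by (rule continuous_on_conv[OF assms(1), where K=K])
      (use K in \<open>auto simp: continuous_on_hk_lap assms\<close>)
  show "continuous_on ({a..b} \<times> UNIV) (\<lambda>(\<tau>, y). heat_hess f \<tau> y e)"
    unfolding heat_hess_def by (rule continuous_on_conv[OF assms(1), where K="K * norm e"])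
      (use K in \<open>auto simp: continuous_on_hk_hess assms\<close>)
qed

lemma norm_heat_hess_le:
  assumes "integrable lborel (f::'a::euclidean_space \<Rightarrow> real)" "0 < a"
  obtains K where "K > 0" "\<And>\<tau> y e. \<tau> \<in> {a..b} \<Longrightarrow> norm (heat_hess f \<tau> y e) \<le> K * norm e"
proof -
  obtain K where K: "K > 0"
    "\<And>\<tau> u e. \<tau> \<in> {a..b} \<Longrightarrow> norm (hk_hess \<tau> (u::'a) e) \<le> K * norm e"
    using hk_kernel_bounds[OF assms(2)] by metis
  let ?I = "\<integral>x. \<bar>f x\<bar> \<partial>lborel"
  show ?thesis
  proof (rule that[of "K * (?I + 1)"])
    have I: "?I \<ge> 0" by simp
    show "K * (?I + 1) > 0" using K(1) add_nonneg_pos[OF I zero_less_one] by (rule mult_pos_pos)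
    fix \<tau> y e assume "\<tau> \<in> {a..b}"
    then have "norm (heat_hess f \<tau> y e) \<le> (K * norm e) * ?I"
      unfolding heat_hess_def using K by (intro norm_conv_bounded_le assms) auto
    also have "\<dots> \<le> K * (?I + 1) * norm e" using K by (simp add: algebra_simps)
    finally show "norm (heat_hess f \<tau> y e) \<le> K * (?I + 1) * norm e" .
  qed
qed

section \<open>The heat evolution of a probability density and its score\<close>

lemma has_real_derivative_norm2_diff:
  fixes y y' :: "real \<Rightarrow> 'b::real_inner"
  assumes "(y has_vector_derivative v) (at t)" "(y' has_vector_derivative v') (at t)"
  shows "((\<lambda>t. (norm (y t - y' t))\<^sup>2) has_real_derivative 2 * ((y t - y' t) \<bullet> (v - v'))) (at t)"
  unfolding power2_norm_eq_inner has_field_derivative_def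
  using assms unfolding has_vector_derivative_def
  by (auto intro!: derivative_eq_intros simp: fun_eq_iff inner_diff_left inner_diff_right inner_commute algebra_simps)

locale prob_density =
  fixes p :: "'a::euclidean_space \<Rightarrow> real"
  assumes p_nonneg: "\<And>x. p x \<ge> 0"
    and p_int: "integrable lborel p"
    and p_one: "(\<integral>x. p x \<partial>lborel) = 1"
begin

lemma p_measurable [measurable]: "p \<in> borel_measurable borel"
  using p_int by auto

lemma integrable_p_hk: "\<tau> > 0 \<Longrightarrow> integrable lborel (\<lambda>x. p x * hk \<tau> (y - x))"
proof -
  assume \<tau>: "\<tau> > 0"
  obtain K where "\<And>\<tau>' u. \<tau>' \<in> {\<tau>..\<tau>} \<Longrightarrow> hk \<tau>' (u::'a) \<le> K"
    using hk_kernel_bounds[OF \<tau>, of \<tau>] by metis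
  then show ?thesis
    using integrable_conv_bounded[OF p_int, of "hk \<tau>" K y] by (auto simp: hk_nonneg)
qed

lemma integrable_p_hk_grad: "\<tau> > 0 \<Longrightarrow> integrable lborel (\<lambda>x. p x *\<^sub>R hk_grad \<tau> (y - x))"
proof -
  assume \<tau>: "\<tau> > 0"
  obtain K where "\<And>\<tau>' u. \<tau>' \<in> {\<tau>..\<tau>} \<Longrightarrow> norm (hk_grad \<tau>' (u::'a)) \<le> K"
    using hk_kernel_bounds[OF \<tau>, of \<tau>] by metis
  then show ?thesis
    using integrable_conv_bounded[OF p_int, of "hk_grad \<tau>" K y] by auto
qed

lemma heat_eq: "heat p \<tau> y = (\<integral>x. p x * hk \<tau> (y - x) \<partial>lborel)"
  by (simp add: heat_def)

lemma heat_pos: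
  assumes "\<tau> > 0"
  shows "heat p \<tau> y > 0"
proof -
  have nn: "heat p \<tau> y \<ge> 0"
    unfolding heat_eq by (intro integral_nonneg_AE AE_I2) (simp add: p_nonneg hk_nonneg)
  have "heat p \<tau> y \<noteq> 0"
  proof
    assume "heat p \<tau> y = 0"
    then have "AE x in lborel. p x * hk \<tau> (y - x) = 0"
      unfolding heat_eq
      by (subst (asm) integral_nonneg_eq_0_iff_AE[OF integrable_p_hk[OF assms]])
        (simp_all add: p_nonneg hk_nonneg)
    then have "AE x in lborel. p x = 0"
      using hk_pos[OF assms] by (auto simp: less_le)
    then have "(\<integral>x. p x \<partial>lborel) = 0"
      by (rule integral_eq_zero_AE)
    with p_one show False by simp
  qed
  with nn show ?thesis by simp
qed

lemma ennreal_heat: 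
  assumes "\<tau> > 0"
  shows "ennreal (heat p \<tau> y) = (\<integral>\<^sup>+x. ennreal (p x * hk \<tau> (y - x)) \<partial>lborel)"
  unfolding heat_eq
  by (rule nn_integral_eq_integral[symmetric]) (auto simp: integrable_p_hk assms p_nonneg hk_nonneg)

lemma heat_measurable [measurable]: "\<tau> > 0 \<Longrightarrow> heat p \<tau> \<in> borel_measurable borel"
  using has_derivative_heat[OF p_int] by (intro borel_measurable_continuous_onI)
      (auto intro: has_derivative_continuous continuous_at_imp_continuous_on)

lemma nn_integral_p: "(\<integral>\<^sup>+x. ennreal (p x) \<partial>lborel) = 1"
  by (subst nn_integral_eq_integral) (auto simp: p_int p_nonneg p_one)

lemma nn_integral_heat:
  assumes "\<tau> > 0"
  shows "(\<integral>\<^sup>+y. ennreal (heat p \<tau> y) \<partial>lborel) = 1"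
proof -
  have "(\<integral>\<^sup>+y. ennreal (heat p \<tau> y) \<partial>lborel) = (\<integral>\<^sup>+y. \<integral>\<^sup>+x. ennreal (p x * hk \<tau> (y - x)) \<partial>lborel \<partial>lborel)"
    by (simp add: ennreal_heat assms)
  also have "\<dots> = (\<integral>\<^sup>+x. \<integral>\<^sup>+y. ennreal (p x * hk \<tau> (y - x)) \<partial>lborel \<partial>lborel)"
    by (rule lborel_pair.Fubini'[symmetric]) measurable
  also have "\<dots> = (\<integral>\<^sup>+x. ennreal (p x) \<partial>lborel)"
  proof (rule nn_integral_cong)
    fix x
    have "(\<integral>\<^sup>+y. ennreal (p x * hk \<tau> (y - x)) \<partial>lborel) = ennreal (p x) * (\<integral>\<^sup>+y. ennreal (hk \<tau> (y + - x)) \<partial>lborel)"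
      by (simp add: ennreal_mult p_nonneg hk_nonneg nn_integral_cmult)
    also have "(\<integral>\<^sup>+y. ennreal (hk \<tau> (y + - x)) \<partial>lborel) = 1"
      by (subst nn_integral_lborel_translate) (auto simp: nn_integral_hk assms)
    finally show "(\<integral>\<^sup>+y. ennreal (p x * hk \<tau> (y - x)) \<partial>lborel) = ennreal (p x)" by simp
  qed
  also have "\<dots> = 1" by (rule nn_integral_p)
  finally show ?thesis .
qed

lemma integrable_heat: "\<tau> > 0 \<Longrightarrow> integrable lborel (heat p \<tau>)"
  by (rule integrableI_nonneg) (auto simp: nn_integral_heat less_imp_le[OF heat_pos])

lemma integral_heat: "\<tau> > 0 \<Longrightarrow> (\<integral>y. heat p \<tau> y \<partial>lborel) = 1"
  by (subst integral_eq_nn_integral) (auto simp: nn_integral_heat less_imp_le[OF heat_pos])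

definition hscore :: "real \<Rightarrow> 'a \<Rightarrow> 'a" where
  "hscore \<tau> y = (1 / heat p \<tau> y) *\<^sub>R heat_grad p \<tau> y"

text \<open>The Hessian of \<open>ln (heat p \<tau>)\<close> at \<open>y\<close>, applied to the
  direction \<open>e\<close>.\<close>

definition hscore_deriv :: "real \<Rightarrow> 'a \<Rightarrow> 'a \<Rightarrow> 'a" where
  "hscore_deriv \<tau> y e = (1 / heat p \<tau> y) *\<^sub>R heat_hess p \<tau> y e - (hscore \<tau> y \<bullet> e) *\<^sub>R hscore \<tau> y"

lemma heat_grad_eq_hscore: "\<tau> > 0 \<Longrightarrow> heat_grad p \<tau> y = heat p \<tau> y *\<^sub>R hscore \<tau> y"
  using heat_pos[of \<tau> y] by (simp add: hscore_def)

lemma has_derivative_hscore: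
  assumes "\<tau> > 0"
  shows "(hscore \<tau> has_derivative hscore_deriv \<tau> y) (at y)"
proof -
  let ?q = "heat p \<tau> y" and ?g = "heat_grad p \<tau> y"
  have "heat p \<tau> y \<noteq> 0" using heat_pos[OF assms, of y] by simp
  then have inv: "((\<lambda>y. inverse (heat p \<tau> y)) has_derivative (\<lambda>e. - (inverse ?q * (?g \<bullet> e) * inverse ?q))) (at y)"
    by (rule Deriv.has_derivative_inverse[OF _ has_derivative_heat[OF p_int assms]])
  have "((\<lambda>y. inverse (heat p \<tau> y) *\<^sub>R heat_grad p \<tau> y) has_derivative
     (\<lambda>e. inverse ?q *\<^sub>R heat_hess p \<tau> y e + (- (inverse ?q * (?g \<bullet> e) * inverse ?q)) *\<^sub>R ?g)) (at y)"
    by (rule has_derivative_scaleR[OF inv has_derivative_heat_grad[OF p_int assms]])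
  moreover have "inverse ?q *\<^sub>R heat_hess p \<tau> y e + (- (inverse ?q * (?g \<bullet> e) * inverse ?q)) *\<^sub>R ?g
      = hscore_deriv \<tau> y e" for e
    unfolding hscore_deriv_def hscore_def divide_inverse by simp
  ultimately show ?thesis by (simp add: hscore_def[abs_def] divide_inverse)
qed

lemma continuous_on_hscore:
  assumes "0 < a"
  shows "continuous_on ({a..b} \<times> UNIV) (\<lambda>(\<tau>, y). hscore \<tau> y)"
proof -
  have "heat p \<tau> y \<noteq> 0" if "\<tau> \<in> {a..b}" for \<tau> y using heat_pos[of \<tau> y] that assms by auto
  then show ?thesis
    unfolding hscore_def case_prod_beta
    using continuous_on_heat(1,2)[OF p_int assms, of b, unfolded case_prod_beta]
    by (auto intro!: continuous_intros)
qed

lemma hscore_measurable [measurable]: "\<tau> > 0 \<Longrightarrow> hscore \<tau> \<in> borel_measurable borel"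
  using has_derivative_hscore by (intro borel_measurable_continuous_onI)
      (auto intro: has_derivative_continuous continuous_at_imp_continuous_on)

text \<open>The evolved density is continuous and positive, hence bounded away from 0 on a compact
  set of times and points; this controls the quotients. The Lipschitz bound follows by the mean
  value inequality in the convex ball.\<close>

lemma hscore_local_bounds:
  assumes "0 < a"
  obtains V where "V > 0" "\<And>\<tau> y. \<tau> \<in> {a..b} \<Longrightarrow> norm y \<le> R \<Longrightarrow> norm (hscore \<tau> y) \<le> V"
    "\<And>\<tau> y e. \<tau> \<in> {a..b} \<Longrightarrow> norm y \<le> R \<Longrightarrow> norm (hscore_deriv \<tau> y e) \<le> V * norm e"
    "\<And>\<tau> y y'. \<tau> \<in> {a..b} \<Longrightarrow> norm y \<le> R \<Longrightarrow> norm y' \<le> R \<Longrightarrow> norm (hscore \<tau> y - hscore \<tau> y') \<le> V * norm (y - y')"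
proof -
  let ?C = "{a..b} \<times> cball (0::'a) R"
  have comp: "compact ?C" by (intro compact_Times) auto
  have "bounded ((\<lambda>(\<tau>, y). hscore \<tau> y) ` ?C)"
    by (intro compact_imp_bounded compact_continuous_image comp
        continuous_on_subset[OF continuous_on_hscore[OF assms]]) auto
  then obtain B1 where B1: "\<And>\<tau> y. \<tau> \<in> {a..b} \<Longrightarrow> norm y \<le> R \<Longrightarrow> norm (hscore \<tau> y) \<le> B1"
    unfolding bounded_iff by fastforce
  have "heat p \<tau> y \<noteq> 0" if "\<tau> \<in> {a..b}" for \<tau> y using heat_pos[of \<tau> y] that assms by auto
  then have "continuous_on ({a..b} \<times> UNIV) (\<lambda>(\<tau>, y). 1 / heat p \<tau> y)"
    unfolding case_prod_beta
    using continuous_on_heat(1)[OF p_int assms, of b, unfolded case_prod_beta]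
    by (auto intro!: continuous_intros)
  then have "bounded ((\<lambda>(\<tau>, y). 1 / heat p \<tau> y) ` ?C)"
    by (intro compact_imp_bounded compact_continuous_image comp) (auto elim: continuous_on_subset)
  then obtain B2 where B2: "\<And>\<tau> y. \<tau> \<in> {a..b} \<Longrightarrow> norm y \<le> R \<Longrightarrow> \<bar>1 / heat p \<tau> y\<bar> \<le> B2"
    unfolding bounded_iff by fastforce
  obtain K where K: "K > 0" "\<And>\<tau> y e. \<tau> \<in> {a..b} \<Longrightarrow> norm (heat_hess p \<tau> y e) \<le> K * norm e"
    using norm_heat_hess_le[OF p_int assms] by metis
  define V where "V = 1 + \<bar>B1\<bar> + (\<bar>B2\<bar> * K + \<bar>B1\<bar> * \<bar>B1\<bar>)"
  have V: "V > 0" "\<bar>B1\<bar> \<le> V" "\<bar>B2\<bar> * K + \<bar>B1\<bar> * \<bar>B1\<bar> \<le> V"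
    using K by (auto simp: V_def intro!: add_pos_nonneg add_nonneg_nonneg)
  have D: "norm (hscore_deriv \<tau> y e) \<le> V * norm e" if "\<tau> \<in> {a..b}" "norm y \<le> R" for \<tau> y e
  proof -
    have "norm (hscore_deriv \<tau> y e) \<le> \<bar>1 / heat p \<tau> y\<bar> * norm (heat_hess p \<tau> y e) + \<bar>hscore \<tau> y \<bullet> e\<bar> * norm (hscore \<tau> y)"
      unfolding hscore_deriv_def by (rule order_trans[OF norm_triangle_ineq4]) simp
    also have "\<dots> \<le> \<bar>B2\<bar> * (K * norm e) + (\<bar>B1\<bar> * norm e) * \<bar>B1\<bar>"
    proof (intro add_mono mult_mono)
      show "\<bar>1 / heat p \<tau> y\<bar> \<le> \<bar>B2\<bar>" using B2[OF that] by linarith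
      show "norm (hscore \<tau> y) \<le> \<bar>B1\<bar>" using B1[OF that] by linarith
      then show "\<bar>hscore \<tau> y \<bullet> e\<bar> \<le> \<bar>B1\<bar> * norm e"
        using order_trans[OF Cauchy_Schwarz_ineq2 mult_right_mono] by force
    qed (use K that in auto)
    also have "\<dots> = (\<bar>B2\<bar> * K + \<bar>B1\<bar> * \<bar>B1\<bar>) * norm e" by (simp add: algebra_simps)
    also have "\<dots> \<le> V * norm e" using V(3) by (rule mult_right_mono) simp
    finally show ?thesis .
  qed
  show ?thesis
  proof (rule that[OF V(1) _ D])
    show "norm (hscore \<tau> y) \<le> V" if "\<tau> \<in> {a..b}" "norm y \<le> R" for \<tau> y
      using B1[OF that] V by linarith
    show "norm (hscore \<tau> y - hscore \<tau> y') \<le> V * norm (y - y')"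
      if "\<tau> \<in> {a..b}" "norm y \<le> R" "norm y' \<le> R" for \<tau> y y'
    proof (rule differentiable_bound[of "cball 0 R"])
      show "(hscore \<tau> has_derivative hscore_deriv \<tau> x) (at x within cball 0 R)" for x
        by (rule has_derivative_at_withinI, rule has_derivative_hscore) (use that assms in auto)
      show "onorm (hscore_deriv \<tau> x) \<le> V" if "x \<in> cball 0 R" for x
        using that by (intro onorm_bound D \<open>\<tau> \<in> {a..b}\<close> less_imp_le[OF V(1)]) simp
      show "y \<in> cball 0 R" "y' \<in> cball 0 R" using that by simp_all
    qed simp
  qed
qed

section \<open>Monotonicity of the posterior mean\<close>

text \<open>Tweedie's formula: the mean of the data given the noisy value \<open>y\<close> is
  \<open>y + \<tau> *\<^sub>R hscore \<tau> y\<close>. It rests on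
  \<open>\<tau> *\<^sub>R hk_grad \<tau> (y - x)\<close> being \<open>x - y\<close> weighted by the
  kernel.\<close>

lemma has_bochner_integral_posterior_mean:
  assumes "\<tau> > 0"
  shows "has_bochner_integral lborel (\<lambda>x. (d \<bullet> x) * (p x * hk \<tau> (y - x) / heat p \<tau> y)) (d \<bullet> (y + \<tau> *\<^sub>R hscore \<tau> y))"
proof -
  let ?q = "heat p \<tau> y"
  have "has_bochner_integral lborel (\<lambda>x. p x *\<^sub>R hk_grad \<tau> (y - x)) (heat_grad p \<tau> y)"
    unfolding heat_grad_def using integrable_p_hk_grad[OF assms] by (rule has_bochner_integral_integrable)
  from has_bochner_integral_inner_right[OF this, of d]
  have 1: "has_bochner_integral lborel (\<lambda>x. d \<bullet> (p x *\<^sub>R hk_grad \<tau> (y - x))) (d \<bullet> heat_grad p \<tau> y)" by simp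
  have 2: "has_bochner_integral lborel (\<lambda>x. p x * hk \<tau> (y - x)) ?q"
    unfolding heat_eq using integrable_p_hk[OF assms] by (rule has_bochner_integral_integrable)
  have "has_bochner_integral lborel (\<lambda>x. (d \<bullet> y / ?q) * (p x * hk \<tau> (y - x)) + (\<tau> / ?q) * (d \<bullet> (p x *\<^sub>R hk_grad \<tau> (y - x))))
     ((d \<bullet> y / ?q) * ?q + (\<tau> / ?q) * (d \<bullet> heat_grad p \<tau> y))"
    by (intro has_bochner_integral_add has_bochner_integral_mult_right 1 2)
  moreover have "(d \<bullet> y / ?q) * (p x * hk \<tau> (y - x)) + (\<tau> / ?q) * (d \<bullet> (p x *\<^sub>R hk_grad \<tau> (y - x))) = (d \<bullet> x) * (p x * hk \<tau> (y - x) / ?q)" for x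
    using heat_pos[OF assms, of y] assms by (simp add: hk_grad_def inner_diff_right field_simps)
  moreover have "(d \<bullet> y / ?q) * ?q + (\<tau> / ?q) * (d \<bullet> heat_grad p \<tau> y) = d \<bullet> (y + \<tau> *\<^sub>R hscore \<tau> y)"
    using heat_pos[OF assms, of y] by (simp add: hscore_def inner_add_right)
  ultimately show ?thesis by simp
qed

text \<open>The posterior weights at \<open>y\<close> and \<open>y'\<close> differ by an exponential tilt along \<open>y - y'\<close>, so their
  difference changes sign exactly once in that direction.\<close>
lemma posterior_mean_monotone:
  assumes "\<tau> > 0"
  shows "(y - y') \<bullet> (y' + \<tau> *\<^sub>R hscore \<tau> y') \<le> (y - y') \<bullet> (y + \<tau> *\<^sub>R hscore \<tau> y)"
proof -
  define d where "d = y - y'"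
  define w where "w x = p x * hk \<tau> (y - x) / heat p \<tau> y" for x
  define w' where "w' x = p x * hk \<tau> (y' - x) / heat p \<tau> y'" for x
  define c where "c = exp ((- (d \<bullet> y') - (norm d)\<^sup>2 / 2) / \<tau>) * heat p \<tau> y' / heat p \<tau> y"
  have q: "heat p \<tau> y > 0" "heat p \<tau> y' > 0" using heat_pos[OF assms] by auto
  have c: "c > 0" using q by (simp add: c_def)
  have "has_bochner_integral lborel (\<lambda>x. p x * hk \<tau> (z - x) / heat p \<tau> z) 1" for z
    using heat_pos[OF assms, of z] integrable_p_hk[OF assms, of z]
    by (simp add: has_bochner_integral_iff heat_eq[symmetric])
  then have w: "has_bochner_integral lborel w 1" "has_bochner_integral lborel w' 1"
    by (simp_all add: w_def[abs_def] w'_def[abs_def])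
  have tilt: "w x = w' x * (c * exp (d \<bullet> x / \<tau>))" for x
  proof -
    have sq: "(norm (y - x))\<^sup>2 = (norm (y' - x))\<^sup>2 + 2 * (d \<bullet> y') - 2 * (d \<bullet> x) + (norm d)\<^sup>2"
      unfolding d_def power2_norm_eq_inner
      by (simp add: inner_diff_left inner_diff_right inner_commute algebra_simps)
    have "- (norm (y - x))\<^sup>2 / (2 * \<tau>) = - (norm (y' - x))\<^sup>2 / (2 * \<tau>) + (- (d \<bullet> y') - (norm d)\<^sup>2 / 2) / \<tau> + d \<bullet> x / \<tau>"
      unfolding sq using assms by (simp add: field_simps)
    then have "hk \<tau> (y - x) = hk \<tau> (y' - x) * exp ((- (d \<bullet> y') - (norm d)\<^sup>2 / 2) / \<tau>) * exp (d \<bullet> x / \<tau>)"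
      by (simp only: hk_def exp_add mult.assoc)
    then show ?thesis using q by (simp add: w_def w'_def c_def)
  qed
  \<comment> \<open>At \<open>d \<bullet> x = \<xi>\<close> the tilt factor equals 1: this is the
    level where the two weights cross.\<close>
  define \<xi> where "\<xi> = - \<tau> * ln c"
  have pos: "(d \<bullet> x - \<xi>) * (w x - w' x) \<ge> 0" for x
  proof -
    have w': "w' x \<ge> 0" using q by (simp add: w'_def p_nonneg hk_nonneg)
    have e: "c * exp (d \<bullet> x / \<tau>) = exp ((d \<bullet> x - \<xi>) / \<tau>)"
    proof -
      have "(d \<bullet> x - \<xi>) / \<tau> = ln c + d \<bullet> x / \<tau>" using assms by (simp add: \<xi>_def add_divide_distrib)
      then show ?thesis using c by (simp add: exp_add)
    qed
    have "(d \<bullet> x - \<xi>) * (exp ((d \<bullet> x - \<xi>) / \<tau>) - 1) \<ge> 0"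
    proof (cases "d \<bullet> x \<ge> \<xi>")
      case True
      then show ?thesis using assms by (intro mult_nonneg_nonneg) auto
    next
      case False
      then have "exp ((d \<bullet> x - \<xi>) / \<tau>) \<le> 1" using assms by (simp add: divide_le_0_iff)
      then show ?thesis using False by (intro mult_nonpos_nonpos) auto
    qed
    then have "w' x * ((d \<bullet> x - \<xi>) * (exp ((d \<bullet> x - \<xi>) / \<tau>) - 1)) \<ge> 0"
      using w' by (rule mult_nonneg_nonneg[rotated])
    also have "w' x * ((d \<bullet> x - \<xi>) * (exp ((d \<bullet> x - \<xi>) / \<tau>) - 1)) = (d \<bullet> x - \<xi>) * (w x - w' x)"
      unfolding tilt e by (simp only: algebra_simps)
    finally show ?thesis .
  qed
  \<comment> \<open>Both weights have mass 1, so subtracting \<xi> leaves the difference of the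
    means unchanged, while it makes the integrand nonnegative.\<close>
  have "has_bochner_integral lborel (\<lambda>x. ((d \<bullet> x) * w x - (d \<bullet> x) * w' x) - (\<xi> * w x - \<xi> * w' x))
     ((d \<bullet> (y + \<tau> *\<^sub>R hscore \<tau> y) - d \<bullet> (y' + \<tau> *\<^sub>R hscore \<tau> y')) - (\<xi> * 1 - \<xi> * 1))"
    using has_bochner_integral_posterior_mean[OF assms, of d y] has_bochner_integral_posterior_mean[OF assms, of d y']
    by (intro has_bochner_integral_diff has_bochner_integral_mult_right w) (simp_all add: w_def w'_def)
  then have "(\<integral>x. ((d \<bullet> x) * w x - (d \<bullet> x) * w' x) - (\<xi> * w x - \<xi> * w' x) \<partial>lborel)
      = d \<bullet> (y + \<tau> *\<^sub>R hscore \<tau> y) - d \<bullet> (y' + \<tau> *\<^sub>R hscore \<tau> y')"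
    by (simp add: has_bochner_integral_iff)
  moreover have "(\<integral>x. ((d \<bullet> x) * w x - (d \<bullet> x) * w' x) - (\<xi> * w x - \<xi> * w' x) \<partial>lborel) \<ge> 0"
    using pos by (intro integral_nonneg_AE AE_I2) (simp add: algebra_simps)
  ultimately show ?thesis by (simp add: d_def)
qed

section \<open>Trajectories of the flow\<close>

text \<open>The equation is imposed at interior times only. A trajectory may then start at time 0,
  where the formula for \<open>hscore\<close> loses its meaning and continuity is all that is
  known.\<close>

definition heat_traj :: "real \<Rightarrow> real \<Rightarrow> (real \<Rightarrow> 'a) \<Rightarrow> bool" where
  "heat_traj s0 T y \<longleftrightarrow> continuous_on {s0..T} y \<and>
     (\<forall>s\<in>{s0<..<T}. (y has_vector_derivative (- 1 / 2) *\<^sub>R hscore s (y s)) (at s))"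

lemma heat_traj_subset: "heat_traj s0 T y \<Longrightarrow> s0 \<le> s \<Longrightarrow> r \<le> T \<Longrightarrow> heat_traj s r y"
  unfolding heat_traj_def by (auto elim: continuous_on_subset)

text \<open>The squared distance has derivative minus the inner product of the differences of
  position and score. By monotonicity of the posterior mean this is at most the squared distance
  divided by the time. The expansion factor is thus independent of any Lipschitz constant of the
  score.\<close>

lemma heat_traj_dist_growth:
  assumes "0 < s" "s \<le> r" "heat_traj s r y" "heat_traj s r y'"
  shows "(norm (y r - y' r))\<^sup>2 / r \<le> (norm (y s - y' s))\<^sup>2 / s"
proof (rule DERIV_nonpos_imp_decreasing_open[OF assms(2)])
  show "continuous_on {s..r} (\<lambda>t. (norm (y t - y' t))\<^sup>2 / t)"
    using assms by (auto intro!: continuous_intros simp: heat_traj_def)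
  fix t assume t: "s < t" "t < r"
  let ?d = "y t - y' t" and ?S = "hscore t (y t) - hscore t (y' t)"
  have "(y has_vector_derivative (- 1 / 2) *\<^sub>R hscore t (y t)) (at t)"
    "(y' has_vector_derivative (- 1 / 2) *\<^sub>R hscore t (y' t)) (at t)"
    using assms(3,4) t by (auto simp: heat_traj_def)
  from has_real_derivative_norm2_diff[OF this]
  have "((\<lambda>t. (norm (y t - y' t))\<^sup>2) has_real_derivative - (?d \<bullet> ?S)) (at t)"
    by (simp add: inner_diff_right)
  then have "((\<lambda>t. (norm (y t - y' t))\<^sup>2 / t) has_real_derivative (- (?d \<bullet> ?S) * t - (norm ?d)\<^sup>2) / (t * t)) (at t)"
    using DERIV_divide[OF _ DERIV_ident, of _ _ t] t assms(1) by fastforce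
  moreover have "(- (?d \<bullet> ?S) * t - (norm ?d)\<^sup>2) / (t * t) \<le> 0"
    using posterior_mean_monotone[of t "y t" "y' t"] t assms(1)
    by (intro divide_nonpos_pos) (auto simp: inner_diff_right inner_diff_left inner_add_right power2_norm_eq_inner algebra_simps inner_commute)
  ultimately show "\<exists>D. ((\<lambda>t. (norm (y t - y' t))\<^sup>2 / t) has_real_derivative D) (at t) \<and> D \<le> 0" by blast
qed

text \<open>Gronwall's inequality toward earlier times: the squared distance has derivative at least
  \<open>- L\<close> times itself, so the exponential weight makes the product increasing.\<close>

lemma heat_traj_gronwall:
  assumes "s \<le> r" "heat_traj s r y" "heat_traj s r y'"
    and L: "\<And>t. s < t \<Longrightarrow> t < r \<Longrightarrow> norm (hscore t (y t) - hscore t (y' t)) \<le> L * norm (y t - y' t)"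
  shows "(norm (y s - y' s))\<^sup>2 * exp (L * s) \<le> (norm (y r - y' r))\<^sup>2 * exp (L * r)"
proof (rule DERIV_nonneg_imp_increasing_open[OF assms(1)])
  show "continuous_on {s..r} (\<lambda>t. (norm (y t - y' t))\<^sup>2 * exp (L * t))"
    using assms by (auto intro!: continuous_intros simp: heat_traj_def)
  fix t assume t: "s < t" "t < r"
  let ?d = "y t - y' t" and ?S = "hscore t (y t) - hscore t (y' t)"
  have "(y has_vector_derivative (- 1 / 2) *\<^sub>R hscore t (y t)) (at t)"
    "(y' has_vector_derivative (- 1 / 2) *\<^sub>R hscore t (y' t)) (at t)"
    using assms(2,3) t by (auto simp: heat_traj_def)
  from has_real_derivative_norm2_diff[OF this]
  have "((\<lambda>t. (norm (y t - y' t))\<^sup>2) has_real_derivative - (?d \<bullet> ?S)) (at t)"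
    by (simp add: inner_diff_right)
  then have "((\<lambda>t. (norm (y t - y' t))\<^sup>2 * exp (L * t)) has_real_derivative (L * (norm ?d)\<^sup>2 - ?d \<bullet> ?S) * exp (L * t)) (at t)"
    by (rule DERIV_cong[OF DERIV_mult[OF _ DERIV_fun_exp[OF DERIV_cmult_Id]]]) (simp add: algebra_simps)
  moreover have "?d \<bullet> ?S \<le> norm ?d * (L * norm ?d)"
    using order_trans[OF norm_cauchy_schwarz mult_left_mono[OF L[OF t] norm_ge_zero]] .
  then have "(L * (norm ?d)\<^sup>2 - ?d \<bullet> ?S) * exp (L * t) \<ge> 0"
    by (intro mult_nonneg_nonneg) (simp_all add: power2_eq_square mult_ac)
  ultimately show "\<exists>D. ((\<lambda>t. (norm (y t - y' t))\<^sup>2 * exp (L * t)) has_real_derivative D) (at t) \<and> 0 \<le> D" by blast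
qed

text \<open>Only \<open>y\<close> is known to stay in the ball of radius \<open>R\<close>, and the
  Lipschitz bound holds in radius \<open>R + 1\<close>, so a continuity argument is used. As long as
  the distance is at most 1, Gronwall's inequality applies and, by the closeness at the end time,
  returns a value below 1.\<close>

lemma heat_traj_stability:
  assumes "0 < s0" "s0 \<le> r" "r \<le> T" "heat_traj s0 r y" "heat_traj s0 r y'"
    and L: "L \<ge> 0" "\<And>t u v. t \<in> {s0..T} \<Longrightarrow> norm u \<le> R + 1 \<Longrightarrow> norm v \<le> R + 1 \<Longrightarrow>
        norm (hscore t u - hscore t v) \<le> L * norm (u - v)"
    and R: "\<And>t. t \<in> {s0..r} \<Longrightarrow> norm (y t) \<le> R"
    and close: "norm (y r - y' r) < exp (- L * T)"
    and s: "s \<in> {s0..r}"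
  shows "norm (y s - y' s) \<le> exp (L * T) * norm (y r - y' r)"
proof -
  have gron: "norm (y t - y' t) \<le> exp (L * T) * norm (y r - y' r)"
    if t: "t \<in> {s0..r}" and *: "\<And>v. t < v \<Longrightarrow> v < r \<Longrightarrow> norm (y v - y' v) \<le> 1" for t
  proof -
    have "(norm (y t - y' t))\<^sup>2 * exp (L * t) \<le> (norm (y r - y' r))\<^sup>2 * exp (L * r)"
    proof (rule heat_traj_gronwall)
      fix v assume v: "t < v" "v < r"
      have "norm (y' v) \<le> norm (y v) + norm (y v - y' v)"
        by (metis norm_minus_commute norm_triangle_sub)
      then show "norm (hscore v (y v) - hscore v (y' v)) \<le> L * norm (y v - y' v)"
        using R[of v] *[OF v] v t assms(3) by (intro L) auto
    qed (use t assms in \<open>auto elim: heat_traj_subset\<close>)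
    also have "exp (L * r) = exp (L * (r - t)) * exp (L * t)" by (simp add: exp_add[symmetric] algebra_simps)
    finally have "(norm (y t - y' t))\<^sup>2 \<le> (norm (y r - y' r))\<^sup>2 * exp (L * (r - t))" by simp
    also have "\<dots> \<le> (norm (y r - y' r))\<^sup>2 * exp (2 * (L * T))"
    proof -
      have "L * (r - t) \<le> L * T" using t assms by (intro mult_left_mono) auto
      moreover have "0 \<le> L * T" using L(1) assms by auto
      ultimately show ?thesis by (intro mult_left_mono) auto
    qed
    also have "\<dots> = (exp (L * T) * norm (y r - y' r))\<^sup>2"
      by (simp add: power_mult_distrib exp_double[symmetric] mult.commute)
    finally show ?thesis by (rule power2_le_imp_le) simp
  qed
  have lt1: "exp (L * T) * norm (y r - y' r) < 1"
    using close by (simp add: exp_minus field_simps)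
  \<comment> \<open>Time runs backward, so \<open>Sup A\<close> is the first time at which the
    distance has come up to 1; after it Gronwall's inequality is available, and at it the resulting
    bound is contradictory.\<close>
  define A where "A = {t \<in> {s0..r}. 1 \<le> norm (y t - y' t)}"
  have "A = {}"
  proof (rule ccontr)
    assume "A \<noteq> {}"
    moreover have "closed A"
      unfolding A_def using assms(4,5)
      by (intro continuous_on_closed_Collect_le closed_atLeastAtMost)
        (auto intro!: continuous_intros simp: heat_traj_def)
    moreover have "bounded A" unfolding A_def by (rule bounded_subset[of "{s0..r}"]) auto
    ultimately have "Sup A \<in> A" "\<And>t. t \<in> A \<Longrightarrow> t \<le> Sup A"
      by (auto intro!: closed_contains_Sup bounded_imp_bdd_above cSup_upper)
    note A = this
    have "norm (y (Sup A) - y' (Sup A)) \<le> exp (L * T) * norm (y r - y' r)"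
    proof (rule gron)
      show "Sup A \<in> {s0..r}" using A(1) by (simp add: A_def)
      fix v assume v: "Sup A < v" "v < r"
      then have "v \<notin> A" using A(2)[of v] by auto
      with v \<open>Sup A \<in> {s0..r}\<close> show "norm (y v - y' v) \<le> 1" by (auto simp: A_def)
    qed
    with lt1 \<open>Sup A \<in> A\<close> show False by (auto simp: A_def)
  qed
  then have "norm (y v - y' v) < 1" if "v \<in> {s0..r}" for v
    using that unfolding A_def by (metis (mono_tags, lifting) empty_Collect_eq not_le)
  then show ?thesis using s by (intro gron[OF s] less_imp_le) auto
qed

end

section \<open>Approximation of Lipschitz functions\<close>

lemma lborel_eq_distr_diff: "(lborel :: 'a::euclidean_space measure) = distr lborel borel (\<lambda>x. y - x)"
  using lborel_affine[of "-1" y] by (simp add: density_1)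

lemma integral_lborel_diff:
  fixes f :: "'a::euclidean_space \<Rightarrow> 'b::{banach,second_countable_topology}"
  assumes [measurable]: "f \<in> borel_measurable borel"
  shows "(\<integral>x. f (y - x) \<partial>lborel) = (\<integral>u. f u \<partial>lborel)"
proof -
  have "(\<integral>u. f u \<partial>lborel) = (\<integral>u. f u \<partial>(distr lborel borel (\<lambda>x. y - x)))"
    using lborel_eq_distr_diff[of y] by simp
  also have "\<dots> = (\<integral>x. f (y - x) \<partial>lborel)"
    by (subst integral_distr) simp_all
  finally show ?thesis by simp
qed

lemma lipschitz_derivative_bound:
  fixes f :: "'a::real_normed_vector \<Rightarrow> real"
  assumes "(f has_derivative f') (at x)" and L: "\<And>y. \<bar>f y - f x\<bar> \<le> L * norm (y - x)"
  shows "\<bar>f' e\<bar> \<le> L * norm e"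
proof -
  have "((\<lambda>t. f (x + t *\<^sub>R e)) has_derivative (\<lambda>t. f' (t *\<^sub>R e))) (at 0)"
    by (rule has_derivative_compose[of "\<lambda>t. x + t *\<^sub>R e"]) (use assms(1) in \<open>auto intro!: derivative_eq_intros\<close>)
  moreover have "f' (t *\<^sub>R e) = f' e * t" for t
    using linear_cmul[OF has_derivative_linear[OF assms(1)]] by simp
  ultimately have "((\<lambda>t. f (x + t *\<^sub>R e)) has_real_derivative f' e) (at 0)"
    by (simp add: has_field_derivative_def)
  then have "((\<lambda>t. \<bar>(f (x + t *\<^sub>R e) - f x) / t\<bar>) \<longlongrightarrow> \<bar>f' e\<bar>) (at 0)"
    by (intro tendsto_rabs) (simp add: has_field_derivative_iff)
  then show ?thesis
  proof (rule tendsto_upperbound)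
    have "\<bar>(f (x + t *\<^sub>R e) - f x) / t\<bar> \<le> L * norm e" if "t \<noteq> 0" for t
      using L[of "x + t *\<^sub>R e"] that by (simp add: field_simps)
    then show "eventually (\<lambda>t. \<bar>(f (x + t *\<^sub>R e) - f x) / t\<bar> \<le> L * norm e) (at 0)"
      by (auto simp: eventually_at_filter)
  qed simp
qed

text \<open>A C^1 version of the positive part of \<open>s - \<eta>\<close>. Beyond the threshold
  its derivative \<open>1 - \<eta>\<^sup>2 / s\<^sup>2\<close> starts at 0 and stays below 1, so
  composing with it preserves a Lipschitz constant.\<close>

definition soft_threshold :: "real \<Rightarrow> real \<Rightarrow> real" where
  "soft_threshold \<eta> s = (if s \<le> \<eta> then 0 else (s - \<eta>)\<^sup>2 / s)"

lemma has_real_derivative_soft_threshold: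
  assumes "\<eta> > 0"
  shows "(soft_threshold \<eta> has_real_derivative 1 - \<eta>\<^sup>2 / (max \<eta> s)\<^sup>2) (at s)"
proof -
  consider "s < \<eta>" | "s = \<eta>" | "s > \<eta>" by linarith
  then show ?thesis
  proof cases
    case 1
    have "((\<lambda>_. 0) has_real_derivative 0) (at s)" by simp
    then have "(soft_threshold \<eta> has_real_derivative 0) (at s)"
      by (rule has_field_derivative_transform_within_open[of _ _ _ "{..<\<eta>}"])
        (use 1 in \<open>auto simp: soft_threshold_def\<close>)
    then show ?thesis using 1 assms by (simp add: max_def)
  next
    case 2
    have "((\<lambda>t. \<bar>t - \<eta>\<bar> / \<eta>) \<longlongrightarrow> \<bar>\<eta> - \<eta>\<bar> / \<eta>) (at \<eta>)"
      using assms by (intro tendsto_intros) auto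
    then have lim: "((\<lambda>t. \<bar>t - \<eta>\<bar> / \<eta>) \<longlongrightarrow> 0) (at \<eta>)" by simp
    have "norm ((soft_threshold \<eta> t - soft_threshold \<eta> \<eta>) / (t - \<eta>)) \<le> \<bar>t - \<eta>\<bar> / \<eta>" for t
    proof (cases "t \<le> \<eta>")
      case False
      then have "(t - \<eta>) / t \<le> (t - \<eta>) / \<eta>" using assms by (intro divide_left_mono) auto
      with False show ?thesis using assms by (simp add: soft_threshold_def power2_eq_square)
    qed (use assms in \<open>simp add: soft_threshold_def\<close>)
    then have "((\<lambda>t. (soft_threshold \<eta> t - soft_threshold \<eta> \<eta>) / (t - \<eta>)) \<longlongrightarrow> 0) (at \<eta>)"
      by (intro Lim_null_comparison[OF _ lim]) auto
    then show ?thesis using 2 assms by (simp add: has_field_derivative_iff)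
  next
    case 3
    have "((\<lambda>s. (s - \<eta>)\<^sup>2 / s) has_real_derivative 1 - \<eta>\<^sup>2 / s\<^sup>2) (at s)"
      using 3 assms by (auto intro!: derivative_eq_intros simp: field_simps power2_eq_square)
    then have "(soft_threshold \<eta> has_real_derivative 1 - \<eta>\<^sup>2 / s\<^sup>2) (at s)"
      by (rule has_field_derivative_transform_within_open[of _ _ _ "{\<eta><..}"])
        (use 3 in \<open>auto simp: soft_threshold_def\<close>)
    then show ?thesis using 3 by (simp add: max_def)
  qed
qed

lemma soft_threshold_approx:
  assumes "\<eta> > 0" "s \<ge> 0"
  shows "\<bar>soft_threshold \<eta> s - s\<bar> \<le> 2 * \<eta>"
proof (cases "s \<le> \<eta>")
  case False
  then have "soft_threshold \<eta> s - s = \<eta> * (\<eta> / s) - 2 * \<eta>"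
    using assms by (simp add: soft_threshold_def field_simps power2_eq_square)
  moreover have "0 \<le> \<eta> / s" "\<eta> / s \<le> 1" using False assms by auto
  then have "0 \<le> \<eta> * (\<eta> / s)" "\<eta> * (\<eta> / s) \<le> \<eta>" using assms mult_left_mono[of "\<eta> / s" 1 \<eta>] by simp_all
  ultimately show ?thesis using assms by linarith
qed (use assms in \<open>auto simp: soft_threshold_def\<close>)

text \<open>The mollification \<open>heat h \<epsilon>\<close> has full support, but it is at most \<open>\<eta>\<close> wherever \<open>h\<close> vanishes;
  a soft threshold at level \<open>\<eta>\<close> restores the support of \<open>h\<close>.\<close>
lemma lipschitz_C1_approximation:
  fixes h :: "'a::euclidean_space \<Rightarrow> real"
  assumes h: "\<And>x. h x \<ge> 0" and L: "\<And>x y. \<bar>h x - h y\<bar> \<le> L * norm (x - y)"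
    and int: "integrable lborel h" and \<eta>: "\<eta> > 0"
  obtains k k' where "\<And>x. (k has_derivative (\<lambda>e. k' x \<bullet> e)) (at x)" "continuous_on UNIV k'"
    "\<And>x. norm (k' x) \<le> L" "\<And>x. \<bar>k x - h x\<bar> \<le> \<eta>" "\<And>x. h x = 0 \<Longrightarrow> k x = 0 \<and> k' x = 0"
proof -
  have L0: "L \<ge> 0"
  proof -
    obtain b :: 'a where "b \<in> Basis" using nonempty_Basis by blast
    then show ?thesis using order_trans[OF abs_ge_zero L[of b 0]] by simp
  qed
  \<comment> \<open>Mollifying costs \<open>c\<close> and thresholding at level \<open>c\<close>
    costs \<open>2 * c\<close>. The variance \<epsilon> makes the root mean square of the mollifying
    shift equal to \<open>c / (L + 1)\<close>, where the added 1 covers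
    \<open>L = 0\<close>.\<close>
  define c where "c = \<eta> / 3"
  define \<epsilon> where "\<epsilon> = (c / (L + 1))\<^sup>2 / real DIM('a)"
  have c: "c > 0" using \<eta> by (simp add: c_def)
  have \<epsilon>: "\<epsilon> > 0" using c L0 by (simp add: \<epsilon>_def)
  have sq: "L * sqrt (real DIM('a) * \<epsilon>) \<le> c"
  proof -
    have "sqrt (real DIM('a) * \<epsilon>) = c / (L + 1)" using c L0 by (simp add: \<epsilon>_def)
    moreover have "L * (c / (L + 1)) \<le> (L + 1) * (c / (L + 1))" using c L0 by (intro mult_right_mono) auto
    ultimately show ?thesis using c L0 by simp
  qed
  have [measurable]: "h \<in> borel_measurable borel" using int by auto
  define k0 where "k0 = heat h \<epsilon>"
  have k0_eq: "k0 x = (\<integral>u. h (x - u) * hk \<epsilon> u \<partial>lborel)" for x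
    unfolding k0_def heat_def
    by (subst integral_lborel_diff[of "\<lambda>u. h (x - u) * hk \<epsilon> u" x, symmetric]) simp_all
  have int2: "integrable lborel (\<lambda>u. h (x - u) * hk \<epsilon> u)" for x
  proof -
    obtain K where "\<And>\<tau>' u. \<tau>' \<in> {\<epsilon>..\<epsilon>} \<Longrightarrow> hk \<tau>' (u::'a) \<le> K"
      using hk_kernel_bounds[OF \<epsilon>, of \<epsilon>] by metis
    then have "integrable lborel (\<lambda>y. h y *\<^sub>R hk \<epsilon> (x - y))"
      by (intro integrable_conv_bounded[OF int, of _ K]) (auto simp: hk_nonneg)
    then have "integrable (distr lborel borel (\<lambda>y. x - y)) (\<lambda>u. h (x - u) * hk \<epsilon> u)"
      by (subst integrable_distr_eq) simp_all
    then show ?thesis by (simp only: lborel_eq_distr_diff[symmetric])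
  qed
  have int3: "integrable lborel (\<lambda>u. hk \<epsilon> (u::'a) * norm u)"
  proof (rule integrableI_nonneg)
    show "(\<integral>\<^sup>+u. ennreal (hk \<epsilon> (u::'a) * norm u) \<partial>lborel) < \<infinity>"
      using nn_integral_hk_norm_le[OF \<epsilon>, where 'a='a] by (rule le_less_trans) simp
  qed (auto simp: hk_nonneg)
  have int3_le: "(\<integral>u. hk \<epsilon> (u::'a) * norm u \<partial>lborel) \<le> sqrt (real DIM('a) * \<epsilon>)"
  proof -
    have "ennreal (\<integral>u. hk \<epsilon> (u::'a) * norm u \<partial>lborel) = (\<integral>\<^sup>+u. hk \<epsilon> (u::'a) * norm u \<partial>lborel)"
      using int3 by (subst nn_integral_eq_integral) (auto simp: hk_nonneg)
    also note nn_integral_hk_norm_le[OF \<epsilon>, where 'a='a]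
    finally show ?thesis using \<epsilon> by simp
  qed
  have close: "\<bar>k0 x - h x\<bar> \<le> c" for x
  proof -
    have "k0 x - h x = (\<integral>u. h (x - u) * hk \<epsilon> u - h x * hk \<epsilon> u \<partial>lborel)"
      unfolding k0_eq using int2[of x] integrable_hk[OF \<epsilon>, where 'a='a] integral_hk[OF \<epsilon>, where 'a='a]
      by (subst Bochner_Integration.integral_diff) simp_all
    also have "\<bar>\<dots>\<bar> \<le> (\<integral>u. L * (hk \<epsilon> (u::'a) * norm u) \<partial>lborel)"
    proof (rule Bochner_Integration.integral_abs_bound_integral)
      fix u
      have "\<bar>h (x - u) * hk \<epsilon> u - h x * hk \<epsilon> u\<bar> = \<bar>h (x - u) - h x\<bar> * hk \<epsilon> u"
        by (simp add: left_diff_distrib[symmetric] abs_mult hk_nonneg)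
      also have "\<dots> \<le> (L * norm u) * hk \<epsilon> u"
        using L[of "x - u" x] by (intro mult_right_mono) (auto simp: hk_nonneg)
      finally show "\<bar>h (x - u) * hk \<epsilon> u - h x * hk \<epsilon> u\<bar> \<le> L * (hk \<epsilon> u * norm u)" by (simp add: mult_ac)
    qed (use int2 int3 integrable_hk[OF \<epsilon>] in auto)
    also have "\<dots> \<le> L * sqrt (real DIM('a) * \<epsilon>)"
      using int3_le L0 by (simp add: mult_left_mono)
    finally show ?thesis using sq by linarith
  qed
  have lip0: "\<bar>k0 y - k0 x\<bar> \<le> L * norm (y - x)" for x y
  proof -
    have "k0 y - k0 x = (\<integral>u. h (y - u) * hk \<epsilon> u - h (x - u) * hk \<epsilon> u \<partial>lborel)"
      unfolding k0_eq using int2 by (simp add: Bochner_Integration.integral_diff)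
    also have "\<bar>\<dots>\<bar> \<le> (\<integral>u. (L * norm (y - x)) * hk \<epsilon> (u::'a) \<partial>lborel)"
    proof (rule Bochner_Integration.integral_abs_bound_integral)
      fix u
      have "\<bar>h (y - u) * hk \<epsilon> u - h (x - u) * hk \<epsilon> u\<bar> = \<bar>h (y - u) - h (x - u)\<bar> * hk \<epsilon> u"
        by (simp add: left_diff_distrib[symmetric] abs_mult hk_nonneg)
      also have "\<dots> \<le> (L * norm (y - x)) * hk \<epsilon> u"
        using L[of "y - u" "x - u"] by (intro mult_right_mono) (auto simp: hk_nonneg)
      finally show "\<bar>h (y - u) * hk \<epsilon> u - h (x - u) * hk \<epsilon> u\<bar> \<le> (L * norm (y - x)) * hk \<epsilon> u" .
    qed (use int2 integrable_hk[OF \<epsilon>] in auto)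
    also have "\<dots> = L * norm (y - x)" using integral_hk[OF \<epsilon>, where 'a='a] by simp
    finally show ?thesis .
  qed
  have k0_nonneg: "k0 x \<ge> 0" for x
    unfolding k0_eq by (intro integral_nonneg_AE AE_I2) (simp add: h hk_nonneg)
  have d0: "(k0 has_derivative (\<lambda>e. heat_grad h \<epsilon> x \<bullet> e)) (at x)" for x
    unfolding k0_def by (rule has_derivative_heat[OF int \<epsilon>])
  have g0: "norm (heat_grad h \<epsilon> x) \<le> L" for x
  proof -
    have "norm (heat_grad h \<epsilon> x) * norm (heat_grad h \<epsilon> x) \<le> L * norm (heat_grad h \<epsilon> x)"
      using lipschitz_derivative_bound[OF d0 lip0, of x "heat_grad h \<epsilon> x"]
      by (simp add: power2_norm_eq_inner[symmetric] power2_eq_square)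
    then show ?thesis using L0 by (cases "heat_grad h \<epsilon> x = 0") auto
  qed
  define th' where "th' s = 1 - c\<^sup>2 / (max c s)\<^sup>2" for s
  have th': "0 \<le> th' s" "th' s \<le> 1" for s
  proof -
    have "c\<^sup>2 \<le> (max c s)\<^sup>2" using c by (intro power_mono) auto
    then show "0 \<le> th' s" using c by (simp add: th'_def max_def divide_le_eq_1)
  qed (simp add: th'_def)
  define k where "k x = soft_threshold c (k0 x)" for x
  define k' where "k' x = th' (k0 x) *\<^sub>R heat_grad h \<epsilon> x" for x
  have cont0: "continuous_on UNIV k0" 
    using d0 by (auto intro: has_derivative_continuous continuous_at_imp_continuous_on)
  have contg: "continuous_on UNIV (heat_grad h \<epsilon>)"
    using has_derivative_heat_grad[OF int \<epsilon>]
    by (auto intro: has_derivative_continuous continuous_at_imp_continuous_on)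
  show ?thesis
  proof (rule that[of k k'])
    show "(k has_derivative (\<lambda>e. k' x \<bullet> e)) (at x)" for x
    proof -
      have "(k has_derivative (\<lambda>e. (1 - c\<^sup>2 / (max c (k0 x))\<^sup>2) * (heat_grad h \<epsilon> x \<bullet> e))) (at x)"
        unfolding k_def[abs_def]
        by (rule has_derivative_compose[OF d0 has_field_derivative_imp_has_derivative[OF has_real_derivative_soft_threshold[OF c]]])
      then show ?thesis by (simp add: k'_def th'_def)
    qed
    show "continuous_on UNIV k'"
      unfolding k'_def th'_def using c cont0 contg
      by (intro continuous_intros) (auto simp: max_def)
    show "norm (k' x) \<le> L" for x
      using mult_mono[OF th'(2)[of "k0 x"] g0[of x]] th'(1)[of "k0 x"] by (simp add: k'_def)
    show "\<bar>k x - h x\<bar> \<le> \<eta>" for x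
    proof -
      have "\<eta> = 2 * c + c" by (simp add: c_def)
      then show ?thesis
        using soft_threshold_approx[OF c k0_nonneg, of x] close[of x] unfolding k_def by linarith
    qed
    show "k x = 0 \<and> k' x = 0" if "h x = 0" for x
    proof -
      have "k0 x \<le> c" using close[of x] that by simp
      then show ?thesis using c by (simp add: k_def k'_def th'_def soft_threshold_def max_def)
    qed
  qed
qed

lemma integrable_continuous_compact_support:
  fixes f :: "'a::euclidean_space \<Rightarrow> real"
  assumes "continuous_on UNIV f" "\<And>x. norm x > R \<Longrightarrow> f x = 0"
  shows "integrable lborel f"
proof -
  have "integrable lborel (\<lambda>x. indicator (cball 0 R) x *\<^sub>R f x)"
    by (rule borel_integrable_compact) (use assms in \<open>auto elim: continuous_on_subset\<close>)
  moreover have "(\<lambda>x. indicator (cball 0 R) x *\<^sub>R f x) = f"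
    using assms(2) by (auto simp: fun_eq_iff indicator_def not_le)
  ultimately show ?thesis by simp
qed

section \<open>The heat evolution paired with compactly supported functions\<close>

context prob_density
begin

text \<open>The integrand is the divergence of \<kappa> times \<open>heat_grad p s\<close>. Its
  coordinate parts \<open>D b\<close> are directional derivatives of compactly supported C^1
  functions and integrate to 0.\<close>

lemma heat_integration_by_parts:
  fixes \<kappa> :: "'a \<Rightarrow> real"
  assumes s: "s > 0" and deriv: "\<And>z. (\<kappa> has_derivative \<kappa>' z) (at z)"
    and cont: "\<And>b. b \<in> Basis \<Longrightarrow> continuous_on UNIV (\<lambda>z. \<kappa>' z b)"
    and supp: "\<And>z. norm z > R \<Longrightarrow> \<kappa> z = 0" "\<And>z b. norm z > R \<Longrightarrow> \<kappa>' z b = 0"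
  shows "integrable lborel (\<lambda>z. heat_lap p s z * \<kappa> z + \<kappa>' z (heat_grad p s z))"
    and "(\<integral>z. heat_lap p s z * \<kappa> z + \<kappa>' z (heat_grad p s z) \<partial>lborel) = 0"
proof -
  have contk: "continuous_on UNIV \<kappa>"
    using deriv by (auto intro: has_derivative_continuous continuous_at_imp_continuous_on)
  have contg: "continuous_on UNIV (heat_grad p s)"
    using has_derivative_heat_grad[OF p_int s]
    by (auto intro: has_derivative_continuous continuous_at_imp_continuous_on)
  have conth: "continuous_on UNIV (\<lambda>z. heat_hess p s z b)" for b
  proof -
    have "continuous_on UNIV (\<lambda>z::'a. (s, z))" "range (\<lambda>z::'a. (s, z)) \<subseteq> {s..s} \<times> UNIV"
      by (auto intro!: continuous_intros)
    from continuous_on_compose2[OF continuous_on_heat(4)[OF p_int s, of s b] this] show ?thesis by simp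
  qed
  define D where "D b z = (heat_hess p s z b \<bullet> b) * \<kappa> z + (heat_grad p s z \<bullet> b) * \<kappa>' z b" for b z
  have Dc: "continuous_on UNIV (D b)" if "b \<in> Basis" for b
    unfolding D_def by (intro continuous_intros contk contg conth cont that)
  have Di: "integrable lborel (D b)" if "b \<in> Basis" for b
    by (rule integrable_continuous_compact_support[OF Dc[OF that], of R]) (simp add: D_def supp)
  have D0: "(\<integral>z. D b z \<partial>lborel) = 0" if b: "b \<in> Basis" for b
  proof -
    let ?f' = "\<lambda>z e. (heat_hess p s z e \<bullet> b) * \<kappa> z + (heat_grad p s z \<bullet> b) * \<kappa>' z e"
    have "(\<integral>z. ?f' z b \<partial>lborel) = 0"
    proof (rule integral_directional_derivative_eq_0[where f'="?f'" and e=b and f="\<lambda>z. (heat_grad p s z \<bullet> b) * \<kappa> z"])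
      show "((\<lambda>z. (heat_grad p s z \<bullet> b) * \<kappa> z) has_derivative ?f' z) (at z)" for z
        by (rule has_derivative_eq_rhs[OF has_derivative_mult[OF has_derivative_inner_left[OF has_derivative_heat_grad[OF p_int s]] deriv]])
          (simp add: fun_eq_iff)
      show "continuous_on UNIV (\<lambda>z. ?f' z b)" using Dc[OF b] unfolding D_def .
      show "integrable lborel (\<lambda>z. ?f' z b)" using Di[OF b] unfolding D_def .
      show "integrable lborel (\<lambda>z. (heat_grad p s z \<bullet> b) * \<kappa> z)"
        by (rule integrable_continuous_compact_support[of _ R]) (auto intro!: continuous_intros contk contg simp: supp)
    qed
    then show ?thesis by (simp add: D_def)
  qed
  have eq: "heat_lap p s z * \<kappa> z + \<kappa>' z (heat_grad p s z) = (\<Sum>b\<in>Basis. D b z)" for z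
  proof -
    have "linear (\<kappa>' z)" using deriv by (rule has_derivative_linear)
    from linear_sum[OF this, of "\<lambda>b. (heat_grad p s z \<bullet> b) *\<^sub>R b" Basis]
    have "\<kappa>' z (heat_grad p s z) = (\<Sum>b\<in>Basis. (heat_grad p s z \<bullet> b) * \<kappa>' z b)"
      by (simp add: euclidean_representation linear_cmul[OF \<open>linear (\<kappa>' z)\<close>])
    then show ?thesis
      by (simp add: heat_lap_eq_trace[OF p_int s] D_def sum.distrib sum_distrib_right)
  qed
  show "integrable lborel (\<lambda>z. heat_lap p s z * \<kappa> z + \<kappa>' z (heat_grad p s z))"
    unfolding eq using Di by (intro Bochner_Integration.integrable_sum) auto
  show "(\<integral>z. heat_lap p s z * \<kappa> z + \<kappa>' z (heat_grad p s z) \<partial>lborel) = 0"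
    unfolding eq using Di D0 by (subst Bochner_Integration.integral_sum) auto
qed

lemma heat_bounds:
  assumes "0 < a"
  obtains K where "K > 0" "\<And>\<tau> y. \<tau> \<in> {a..b} \<Longrightarrow> \<bar>heat p \<tau> y\<bar> \<le> K" "\<And>\<tau> y. \<tau> \<in> {a..b} \<Longrightarrow> \<bar>heat_lap p \<tau> y\<bar> \<le> K"
proof -
  obtain K where K: "K > 0"
    "\<And>\<tau> u. \<tau> \<in> {a..b} \<Longrightarrow> hk \<tau> (u::'a::euclidean_space) \<le> K"
    "\<And>\<tau> u. \<tau> \<in> {a..b} \<Longrightarrow> \<bar>hk_lap \<tau> (u::'a)\<bar> \<le> K"
    using hk_kernel_bounds[OF assms(1)] by metis
  show ?thesis
  proof (rule that[OF K(1)])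
    fix \<tau> y assume t: "\<tau> \<in> {a..b}"
    have 1: "(\<integral>x. \<bar>p x\<bar> \<partial>lborel) = 1" using p_one p_nonneg by simp
    show "\<bar>heat p \<tau> y\<bar> \<le> K"
      using norm_conv_bounded_le[OF p_int, of "hk \<tau>" K y] K(2)[OF t] 1 by (simp add: heat_def hk_nonneg)
    show "\<bar>heat_lap p \<tau> y\<bar> \<le> K"
      using norm_conv_bounded_le[OF p_int, of "hk_lap \<tau>" K y] K(3)[OF t] 1 by (simp add: heat_lap_def)
  qed
qed

end

section \<open>Transport along the flow\<close>

text \<open>The function already vanishes on the shell between the two radii, so the cut at the
  outer sphere creates no kink. This serves test functions composed with an Euler step, whose
  displacement is controlled only inside a ball.\<close>

lemma has_derivative_zero_outside:
  fixes f :: "'a::euclidean_space \<Rightarrow> 'b::real_normed_vector"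
  assumes in1: "\<And>z. norm z < R' \<Longrightarrow> (f has_derivative f' z) (at z)"
    and out: "\<And>z. R < norm z \<Longrightarrow> norm z < R' \<Longrightarrow> f z = 0 \<and> f' z = (\<lambda>_. 0)" and "R < R'"
  shows "((\<lambda>z. if norm z < R' then f z else 0) has_derivative (if norm z < R' then f' z else (\<lambda>_. 0))) (at z)"
proof (cases "norm z < R'")
  case True
  have "((\<lambda>z. if norm z < R' then f z else 0) has_derivative f' z) (at z)"
    by (rule has_derivative_transform_within_open[OF in1[OF True], of "ball 0 R'"]) (use True in auto)
  then show ?thesis using True by simp
next
  case False
  have "((\<lambda>_. 0) has_derivative (\<lambda>_. 0)) (at z)" by simp
  then have "((\<lambda>z. if norm z < R' then f z else 0) has_derivative (\<lambda>_. 0)) (at z)"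
    by (rule has_derivative_transform_within_open[of _ _ _ _ "- cball 0 R"]) (use False out \<open>R < R'\<close> in auto)
  then show ?thesis using False by simp
qed

lemma continuous_on_zero_outside:
  fixes f :: "'a::euclidean_space \<Rightarrow> 'b::real_normed_vector"
  assumes cont: "continuous_on (ball 0 R') f"
    and out: "\<And>z. R < norm z \<Longrightarrow> norm z < R' \<Longrightarrow> f z = 0" and "R < R'"
  shows "continuous_on UNIV (\<lambda>z. if norm z < R' then f z else 0)"
proof -
  let ?g = "\<lambda>z. if norm z < R' then f z else 0"
  have "continuous_on (ball 0 R') ?g"
    using cont by (rule continuous_on_cong[THEN iffD1, rotated 2]) auto
  moreover have "continuous_on (- cball 0 R) ?g"
    by (rule continuous_on_cong[THEN iffD1, OF refl _ continuous_on_const[of _ 0]]) (use out in auto)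
  moreover have "ball 0 R' \<union> - cball (0::'a) R = UNIV" using \<open>R < R'\<close> by auto
  ultimately show ?thesis
    using continuous_on_open_Un[of "ball 0 R'" "- cball 0 R" ?g] by auto
qed

context prob_density
begin

text \<open>\<open>z + (t/2) hscore r z\<close> is an explicit Euler step of the flow from time \<open>r + t\<close> down to \<open>r\<close>.
  Only the size of the gradient of \<open>k\<close> enters the error, so the bound survives passing to
  Lipschitz functions.\<close>
lemma transport_euler_step_C1:
  fixes k :: "'a \<Rightarrow> real"
  assumes ab: "0 < a" "a < r" "r + \<delta> < b" "0 \<le> \<delta>"
    and V: "V > 0" "\<And>\<tau> y. \<tau> \<in> {a..b} \<Longrightarrow> norm y \<le> R + 1 \<Longrightarrow> norm (hscore \<tau> y) \<le> V"
      "\<And>\<tau> y e. \<tau> \<in> {a..b} \<Longrightarrow> norm y \<le> R + 1 \<Longrightarrow> norm (hscore_deriv \<tau> y e) \<le> V * norm e"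
    and \<delta>V: "\<delta> * V < 1"
    and \<epsilon>: "\<epsilon> \<ge> 0" "\<And>\<tau> y. \<tau> \<in> {r..r + \<delta>} \<Longrightarrow> norm y \<le> R + 1 \<Longrightarrow> norm (hscore \<tau> y - hscore r y) \<le> \<epsilon>"
    and k: "\<And>x. (k has_derivative (\<lambda>e. k' x \<bullet> e)) (at x)" "continuous_on UNIV k'"
    and L: "\<And>x. norm (k' x) \<le> L"
    and supp: "\<And>x. norm x > R \<Longrightarrow> k x = 0 \<and> k' x = 0"
  defines "H \<equiv> \<lambda>z. if norm z < R + 1 then k (z + (\<delta>/2) *\<^sub>R hscore r z) else 0"
  shows "\<bar>(\<integral>z. heat p (r + \<delta>) z * H z \<partial>lborel) - (\<integral>z. heat p r z * k z \<partial>lborel)\<bar> \<le> L * (\<epsilon> + \<delta> * V\<^sup>2) * \<delta>"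
proof -
  have r: "r > 0" "r \<in> {a..b}" using ab by auto
  have L0: "L \<ge> 0" using order_trans[OF norm_ge_zero L] .
  have contk: "continuous_on UNIV k"
    using k(1) by (auto intro: has_derivative_continuous continuous_at_imp_continuous_on)
  have conts: "continuous_on UNIV (hscore r)"
    using has_derivative_hscore[OF r(1)] by (auto intro: has_derivative_continuous continuous_at_imp_continuous_on)
  have contD: "continuous_on UNIV (\<lambda>z. hscore_deriv r z e)" for e
  proof -
    have "continuous_on UNIV (\<lambda>z::'a. (r, z))" "range (\<lambda>z::'a. (r, z)) \<subseteq> {r..r} \<times> UNIV"
      by (auto intro!: continuous_intros)
    from continuous_on_compose2[OF continuous_on_heat(4)[OF p_int r(1), of r e] this]
    have 1: "continuous_on UNIV (\<lambda>z. heat_hess p r z e)" by simp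
    have 2: "continuous_on UNIV (heat p r)"
      using has_derivative_heat[OF p_int r(1)] by (auto intro: has_derivative_continuous continuous_at_imp_continuous_on)
    have "heat p r z \<noteq> 0" for z using heat_pos[OF r(1), of z] by simp
    then show ?thesis
      unfolding hscore_deriv_def by (intro continuous_intros 1 2 conts) auto
  qed
  obtain B where B: "\<And>x. \<bar>k x\<bar> \<le> B"
  proof -
    have "bounded (k ` cball 0 R)"
      by (intro compact_imp_bounded compact_continuous_image continuous_on_subset[OF contk]) auto
    then obtain B where B: "\<forall>x\<in>cball 0 R. \<bar>k x\<bar> \<le> B" unfolding bounded_iff by auto
    have "\<bar>k x\<bar> \<le> \<bar>B\<bar>" for x
    proof (cases "norm x \<le> R")
      case True
      then have "\<bar>k x\<bar> \<le> B" using B by simp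
      then show ?thesis by linarith
    qed (use supp[of x] in simp)
    then show ?thesis using that by blast
  qed
  obtain K where K: "K > 0" "\<And>\<tau> y. \<tau> \<in> {a..b} \<Longrightarrow> \<bar>heat p \<tau> y\<bar> \<le> K" "\<And>\<tau> y. \<tau> \<in> {a..b} \<Longrightarrow> \<bar>heat_lap p \<tau> y\<bar> \<le> K"
    using heat_bounds[OF ab(1)] by metis
  \<comment> \<open>An open interval of step lengths around \<open>{0..\<delta>}\<close> on which
    the times stay in \<open>{a..b}\<close> and the Euler step moves points of the ball by less than
    1/2.\<close>
  define W where "W = {max (a - r) (- (1/V)) <..< min (b - r) (1/V)}"
  have "t * V < 1" if "t \<in> {0..\<delta>}" for t
  proof -
    have "t * V \<le> \<delta> * V" using that V(1) by (intro mult_right_mono) auto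
    then show ?thesis using \<delta>V by linarith
  qed
  moreover have "- 1 < t * V" if "t \<in> {0..\<delta>}" for t
  proof -
    have "0 \<le> t * V" using that V(1) by (intro mult_nonneg_nonneg) auto
    then show ?thesis by linarith
  qed
  ultimately have W: "open W" "convex W" "{0..\<delta>} \<subseteq> W"
    using ab V(1) by (auto simp: W_def field_simps)
  have Wr: "r + t \<in> {a..b}" "r + t > 0" "\<bar>t\<bar> * V < 1" if "t \<in> W" for t
    using that ab V(1) by (auto simp: W_def field_simps abs_less_iff)
  define X where "X t z = z + (t/2) *\<^sub>R hscore r z" for t z
  \<comment> \<open>Points of the outer half shell cannot be carried back into the support of
    \<open>k\<close>; this is what makes the cut at radius \<open>R + 1\<close> smooth.\<close>
  have Xfar: "norm (X t z) > R" if "t \<in> W" "R + 1/2 < norm z" "norm z < R + 1" for t z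
  proof -
    have "norm ((t/2) *\<^sub>R hscore r z) \<le> \<bar>t\<bar> / 2 * V"
      using V(2)[OF r(2), of z] that(3) by (simp add: mult_left_mono)
    also have "\<dots> < 1/2" using Wr(3)[OF that(1)] by simp
    finally show ?thesis using norm_diff_ineq[of z "(t/2) *\<^sub>R hscore r z"] that(2) by (simp add: X_def)
  qed
  define \<kappa> where "\<kappa> t z = (if norm z < R + 1 then k (X t z) else 0)" for t z
  define \<kappa>' where "\<kappa>' t z = (if norm z < R + 1 then (\<lambda>e. k' (X t z) \<bullet> (e + (t/2) *\<^sub>R hscore_deriv r z e)) else (\<lambda>_. 0))" for t z
  have contX: "continuous_on UNIV (X t)" for t
    unfolding X_def by (intro continuous_intros conts)
  have d\<kappa>: "(\<kappa> t has_derivative \<kappa>' t z) (at z)" if t: "t \<in> W" for t z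
    unfolding \<kappa>_def[abs_def] \<kappa>'_def
  proof (rule has_derivative_zero_outside)
    show "((\<lambda>z. k (X t z)) has_derivative (\<lambda>e. k' (X t z) \<bullet> (e + (t/2) *\<^sub>R hscore_deriv r z e))) (at z)" for z
      unfolding X_def
      by (rule has_derivative_compose[OF _ k(1)])
        (auto intro!: derivative_eq_intros has_derivative_hscore r)
    show "k (X t z) = 0 \<and> (\<lambda>e. k' (X t z) \<bullet> (e + (t/2) *\<^sub>R hscore_deriv r z e)) = (\<lambda>_. 0)"
      if "R + 1/2 < norm z" "norm z < R + 1" for z
      using supp[OF Xfar[OF t that]] by simp
  qed simp
  have c\<kappa>': "continuous_on UNIV (\<lambda>z. \<kappa>' t z e)" if t: "t \<in> W" for t e
  proof -
    have "continuous_on UNIV (\<lambda>z. if norm z < R + 1 then k' (X t z) \<bullet> (e + (t/2) *\<^sub>R hscore_deriv r z e) else 0)"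
    proof (rule continuous_on_zero_outside)
      show "continuous_on (ball 0 (R + 1)) (\<lambda>z. k' (X t z) \<bullet> (e + (t/2) *\<^sub>R hscore_deriv r z e))"
        by (intro continuous_intros continuous_on_compose2[OF k(2)]
            continuous_on_subset[OF contX] continuous_on_subset[OF contD]) auto
      show "k' (X t z) \<bullet> (e + (t/2) *\<^sub>R hscore_deriv r z e) = 0"
        if "R + 1/2 < norm z" "norm z < R + 1" for z
        using supp[OF Xfar[OF t that]] by simp
    qed simp
    moreover have "(\<lambda>z. \<kappa>' t z e) = (\<lambda>z. if norm z < R + 1 then k' (X t z) \<bullet> (e + (t/2) *\<^sub>R hscore_deriv r z e) else 0)"
      by (auto simp: \<kappa>'_def)
    ultimately show ?thesis by (simp only:)
  qed
  have ibp: "integrable lborel (\<lambda>z. heat_lap p (r + t) z * \<kappa> t z + \<kappa>' t z (heat_grad p (r + t) z))"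
    "(\<integral>z. heat_lap p (r + t) z * \<kappa> t z + \<kappa>' t z (heat_grad p (r + t) z) \<partial>lborel) = 0" if t: "t \<in> W" for t
    using heat_integration_by_parts[OF Wr(2)[OF t] d\<kappa>[OF t] c\<kappa>'[OF t], of "R + 1"]
    by (simp_all add: \<kappa>_def \<kappa>'_def)
  define I :: "'a \<Rightarrow> real" where "I = indicator (ball 0 (R + 1))"
  define F where "F t z = heat p (r + t) z * \<kappa> t z" for t z
  \<comment> \<open>The derivative of \<open>F\<close> in the step length: the heat equation
    contributes half the Laplacian, the moving argument half the score, and \<open>I\<close>
    restricts the latter to the ball.\<close>
  define F' where "F' t z = heat_lap p (r + t) z / 2 * \<kappa> t z + heat p (r + t) z * (I z * (k' (X t z) \<bullet> ((1/2) *\<^sub>R hscore r z)))" for t z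
  have [measurable]: "I \<in> borel_measurable borel" unfolding I_def by (intro borel_measurable_indicator) simp
  have [measurable]: "k' \<in> borel_measurable borel" using k(2) by (rule borel_measurable_continuous_onI)
  have [measurable]: "k \<in> borel_measurable borel" using contk by (rule borel_measurable_continuous_onI)
  have [measurable]: "X t \<in> borel_measurable borel" for t using contX by (rule borel_measurable_continuous_onI)
  have [measurable]: "hscore r \<in> borel_measurable borel" using r by simp
  have m\<kappa>[measurable]: "\<kappa> t \<in> borel_measurable borel" for t unfolding \<kappa>_def by measurable
  have mlap: "heat_lap p (r + t) \<in> borel_measurable borel" if "t \<in> W" for t
  proof (rule borel_measurable_continuous_onI)
    have "continuous_on UNIV (\<lambda>z::'a. (r + t, z))" "range (\<lambda>z::'a. (r + t, z)) \<subseteq> {r + t..r + t} \<times> UNIV"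
      by (auto intro!: continuous_intros)
    from continuous_on_compose2[OF continuous_on_heat(3)[OF p_int Wr(2)[OF that], of "r + t"] this]
    show "continuous_on UNIV (heat_lap p (r + t))" by simp
  qed
  have mF': "F' t \<in> borel_measurable borel" if t: "t \<in> W" for t
  proof -
    note [measurable] = mlap[OF t] heat_measurable[OF Wr(2)[OF t]]
    show ?thesis unfolding F'_def by measurable
  qed
  define C where "C = K * B + K * (L * V)"
  have B0: "B \<ge> 0" using order_trans[OF abs_ge_zero B] .
  have F'_bound: "\<bar>F' t z\<bar> \<le> C * I z" if t: "t \<in> W" for t z
  proof (cases "norm z < R + 1")
    case True
    have "\<bar>heat_lap p (r + t) z / 2 * \<kappa> t z\<bar> \<le> K * B"
      unfolding abs_mult using K(3)[OF Wr(1)[OF t], of z] K(1) B True B0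
      by (intro mult_mono) (auto simp: \<kappa>_def)
    moreover have "\<bar>heat p (r + t) z * (I z * (k' (X t z) \<bullet> ((1/2) *\<^sub>R hscore r z)))\<bar> \<le> K * (L * V)"
    proof -
      have "\<bar>k' (X t z) \<bullet> ((1/2) *\<^sub>R hscore r z)\<bar> \<le> norm (k' (X t z)) * norm ((1/2) *\<^sub>R hscore r z)"
        by (rule Cauchy_Schwarz_ineq2)
      also have "\<dots> \<le> L * V"
        using L V(2)[OF r(2), of z] True L0 V(1) by (intro mult_mono) auto
      finally have "\<bar>I z * (k' (X t z) \<bullet> ((1/2) *\<^sub>R hscore r z))\<bar> \<le> L * V"
        using True by (simp add: I_def)
      then show ?thesis
        unfolding abs_mult[of "heat p (r + t) z"] using K(1) K(2)[OF Wr(1)[OF t], of z]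
        by (intro mult_mono) auto
    qed
    ultimately show ?thesis using True unfolding F'_def C_def by (simp add: I_def)
  next
    case False
    then show ?thesis by (simp add: F'_def \<kappa>_def I_def)
  qed
  have intI: "integrable lborel (\<lambda>z. C * I z)"
    unfolding I_def using emeasure_lborel_ball_finite[of "0::'a" "R + 1"]
    by (intro integrable_mult_right integrable_real_indicator) simp_all
  have intF': "integrable lborel (F' t)" if t: "t \<in> W" for t
    by (rule Bochner_Integration.integrable_bound[OF intI])
      (use mF'[OF t] F'_bound[OF t] in \<open>auto intro!: AE_I2 order_trans[OF F'_bound[OF t]]\<close>)
  define m where "m t = (\<integral>z. F t z \<partial>lborel)" for t
  have dm: "(m has_derivative (\<lambda>h. \<integral>z. h * F' t z \<partial>lborel)) (at t)" if t: "t \<in> W" for t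
    unfolding m_def[abs_def]
  proof (rule has_derivative_lebesgue_integral[OF W(1,2) t])
    fix v assume v: "v \<in> W"
    note [measurable] = heat_measurable[OF Wr(2)[OF v]]
    show "integrable lborel (F v)"
    proof (rule Bochner_Integration.integrable_bound)
      show "integrable lborel (\<lambda>z. B * heat p (r + v) z)" using integrable_heat[OF Wr(2)[OF v]] by simp
      show "F v \<in> borel_measurable lborel" unfolding F_def by measurable
      have "\<bar>\<kappa> v z\<bar> \<le> B" for z using B B0 by (simp add: \<kappa>_def)
      then show "AE z in lborel. norm (F v z) \<le> norm (B * heat p (r + v) z)"
        using B0 by (auto simp: F_def abs_mult mult.commute intro!: mult_right_mono)
    qed
    fix z :: 'a
    show "((\<lambda>v. F v z) has_derivative (\<lambda>h. h * F' v z)) (at v)"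
    proof -
      have "((\<lambda>t. heat p t z) has_real_derivative heat_lap p (r + v) z / 2) (at (r + v))"
        by (rule has_real_derivative_heat_time[OF p_int Wr(2)[OF v]])
      moreover have "((\<lambda>t. r + t) has_real_derivative 1) (at v)" by (auto intro!: derivative_eq_intros)
      ultimately have 1: "((\<lambda>t. heat p (r + t) z) has_real_derivative heat_lap p (r + v) z / 2) (at v)"
        using DERIV_chain'[of "\<lambda>t. r + t" 1 v UNIV "\<lambda>t. heat p t z"] by simp
      have "((\<lambda>t. k (X t z)) has_derivative (\<lambda>h. k' (X v z) \<bullet> (h *\<^sub>R ((1/2) *\<^sub>R hscore r z)))) (at v)"
        by (rule has_derivative_compose[OF _ k(1)]) (auto simp: X_def intro!: derivative_eq_intros)
      then have "((\<lambda>t. k (X t z)) has_real_derivative k' (X v z) \<bullet> ((1/2) *\<^sub>R hscore r z)) (at v)"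
        unfolding has_field_derivative_def by (rule has_derivative_eq_rhs) (simp add: fun_eq_iff)
      then have 2: "((\<lambda>t. \<kappa> t z) has_real_derivative I z * (k' (X v z) \<bullet> ((1/2) *\<^sub>R hscore r z))) (at v)"
        by (cases "norm z < R + 1") (simp_all add: \<kappa>_def I_def)
      from DERIV_mult[OF 1 2] have "((\<lambda>v. F v z) has_real_derivative F' v z) (at v)"
        unfolding F_def F'_def by (simp add: algebra_simps)
      then show ?thesis by (simp add: has_field_derivative_def mult_commute_abs)
    qed
    show "norm (h * F' v z) \<le> (C * I z) * norm h" for h
      using mult_right_mono[OF F'_bound[OF v, of z], of "\<bar>h\<bar>"] by (simp add: abs_mult mult.commute)
  next
    show "(\<lambda>x. h * F' t x) \<in> borel_measurable lborel" for h using mF'[OF t] by simp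
  qed (rule intI)
  have F'_int: "\<bar>\<integral>z. F' t z \<partial>lborel\<bar> \<le> L * (\<epsilon> + \<delta> * V\<^sup>2)" if t: "t \<in> {0..\<delta>}" for t
  proof -
    have tW: "t \<in> W" using t W by auto
    \<comment> \<open>Subtracting half of the integration by parts identity removes the Laplacian
      without changing the integral. What remains pairs \<open>k'\<close> with the change of the
      score over the step, of size \<epsilon>, and with a second-order term of the Euler map, of
      size \<open>\<delta> * V\<^sup>2\<close>.\<close>
    define G where "G z = F' t z - (1/2) * (heat_lap p (r + t) z * \<kappa> t z + \<kappa>' t z (heat_grad p (r + t) z))" for z
    have "(\<integral>z. G z \<partial>lborel) = (\<integral>z. F' t z \<partial>lborel)"
      unfolding G_def using ibp[OF tW] intF'[OF tW] by simp
    moreover have intG: "integrable lborel G" unfolding G_def using ibp[OF tW] intF'[OF tW] by simp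
    moreover have Gb: "\<bar>G z\<bar> \<le> heat p (r + t) z * (L * (\<epsilon> + \<delta> * V\<^sup>2))" for z
    proof (cases "norm z < R + 1")
      case True
      let ?S = "hscore (r + t) z" and ?q = "heat p (r + t) z"
      have lin: "linear (hscore_deriv r z)" using has_derivative_hscore[OF r(1)] by (rule has_derivative_linear)
      have G_eq: "G z = ?q * (k' (X t z) \<bullet> ((1/2) *\<^sub>R (hscore r z - ?S - (t/2) *\<^sub>R hscore_deriv r z ?S)))"
        using True unfolding G_def F'_def \<kappa>'_def heat_grad_eq_hscore[OF Wr(2)[OF tW]]
        by (simp add: I_def linear_cmul[OF lin] inner_diff_right inner_add_right algebra_simps)
      have "\<bar>k' (X t z) \<bullet> ((1/2) *\<^sub>R (hscore r z - ?S - (t/2) *\<^sub>R hscore_deriv r z ?S))\<bar> \<le> L * (\<epsilon> + \<delta> * V\<^sup>2)"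
      proof -
        have "norm (hscore r z - ?S) \<le> \<epsilon>"
          using \<epsilon>(2)[of "r + t" z] t True by (simp add: norm_minus_commute)
        moreover have "norm ((t/2) *\<^sub>R hscore_deriv r z ?S) \<le> \<delta> * V\<^sup>2"
        proof -
          have "norm (hscore_deriv r z ?S) \<le> V * V"
            using order_trans[OF V(3)[OF r(2)] mult_left_mono[OF V(2)[OF Wr(1)[OF tW]]]] True V(1) by simp
          then have "\<bar>t/2\<bar> * norm (hscore_deriv r z ?S) \<le> \<delta> * (V * V)"
            using t by (intro mult_mono) auto
          then show ?thesis by (simp add: power2_eq_square)
        qed
        ultimately have "norm (hscore r z - ?S - (t/2) *\<^sub>R hscore_deriv r z ?S) \<le> \<epsilon> + \<delta> * V\<^sup>2"
          using norm_triangle_ineq4[of "hscore r z - ?S" "(t/2) *\<^sub>R hscore_deriv r z ?S"] by linarith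
        then have "norm ((1/2) *\<^sub>R (hscore r z - ?S - (t/2) *\<^sub>R hscore_deriv r z ?S)) \<le> \<epsilon> + \<delta> * V\<^sup>2"
          using norm_ge_zero[of "hscore r z - ?S - (t/2) *\<^sub>R hscore_deriv r z ?S"] by (simp del: norm_ge_zero)
        then show ?thesis
          using order_trans[OF Cauchy_Schwarz_ineq2 mult_mono[OF L _ L0 norm_ge_zero]] by blast
      qed
      then show ?thesis
        unfolding G_eq abs_mult[of ?q] using heat_pos[OF Wr(2)[OF tW], of z]
        by (simp only: abs_of_pos mult_left_mono less_imp_le)
    next
      case False
      have "0 \<le> L * (\<epsilon> + \<delta> * V\<^sup>2)" using L0 ab \<epsilon>(1) by simp
      then show ?thesis using False heat_pos[OF Wr(2)[OF tW], of z] by (simp add: G_def F'_def \<kappa>_def \<kappa>'_def I_def)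
    qed
    ultimately have "\<bar>\<integral>z. F' t z \<partial>lborel\<bar> \<le> (\<integral>z. heat p (r + t) z * (L * (\<epsilon> + \<delta> * V\<^sup>2)) \<partial>lborel)"
      using Bochner_Integration.integral_abs_bound_integral[OF intG _ Gb] integrable_heat[OF Wr(2)[OF tW]] by simp
    then show ?thesis by (simp add: integral_heat[OF Wr(2)[OF tW]])
  qed
  have "norm (m \<delta> - m 0) \<le> L * (\<epsilon> + \<delta> * V\<^sup>2) * norm (\<delta> - 0)"
  proof (rule differentiable_bound[of "{0..\<delta>}"])
    fix t assume t: "t \<in> {0..\<delta>}"
    show "(m has_derivative (\<lambda>h. \<integral>z. h * F' t z \<partial>lborel)) (at t within {0..\<delta>})"
      by (rule has_derivative_at_withinI, rule dm) (use t W in auto)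
    have "0 \<le> L * (\<epsilon> + \<delta> * V\<^sup>2)" using order_trans[OF abs_ge_zero F'_int[OF t]] .
    then show "onorm (\<lambda>h. \<integral>z. h * F' t z \<partial>lborel) \<le> L * (\<epsilon> + \<delta> * V\<^sup>2)"
      using mult_left_mono[OF F'_int[OF t]] by (intro onorm_bound) (auto simp: abs_mult mult.commute)
  qed (use ab in auto)
  moreover have "m \<delta> = (\<integral>z. heat p (r + \<delta>) z * H z \<partial>lborel)"
    unfolding m_def F_def \<kappa>_def X_def H_def ..
  moreover have "m 0 = (\<integral>z. heat p r z * k z \<partial>lborel)"
    unfolding m_def F_def using supp
    by (intro Bochner_Integration.integral_cong) (auto simp: \<kappa>_def X_def)
  ultimately show ?thesis using ab by simp
qed

end

lemma continuous_on_of_lipschitz: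
  fixes h :: "'a::euclidean_space \<Rightarrow> real"
  assumes "\<And>x y. \<bar>h x - h y\<bar> \<le> L * norm (x - y)"
  shows "continuous_on UNIV h"
proof -
  obtain b :: 'a where "b \<in> Basis" using nonempty_Basis by blast
  then have "L \<ge> 0" using order_trans[OF abs_ge_zero assms[of b 0]] by simp
  then have "L-lipschitz_on UNIV h"
    using assms by (intro lipschitz_onI) (auto simp: dist_norm)
  then show ?thesis by (rule lipschitz_on_continuous_on)
qed

context prob_density
begin

lemma integrable_heat_mult_bounded:
  assumes "\<tau> > 0" and [measurable]: "f \<in> borel_measurable borel" and f: "\<And>z. \<bar>f z\<bar> \<le> B"
  shows "integrable lborel (\<lambda>z. heat p \<tau> z * f z)"
proof (rule Bochner_Integration.integrable_bound)
  note [measurable] = heat_measurable[OF assms(1)]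
  show "integrable lborel (\<lambda>z. B * heat p \<tau> z)" using integrable_heat[OF assms(1)] by simp
  show "(\<lambda>z. heat p \<tau> z * f z) \<in> borel_measurable lborel" by measurable
  have "norm (heat p \<tau> z * f z) \<le> norm (B * heat p \<tau> z)" for z
  proof -
    have "\<bar>f z\<bar> \<le> \<bar>B\<bar>" using f[of z] by linarith
    from mult_right_mono[OF this, of "\<bar>heat p \<tau> z\<bar>"] show ?thesis by (simp add: abs_mult mult.commute)
  qed
  then show "AE z in lborel. norm (heat p \<tau> z * f z) \<le> norm (B * heat p \<tau> z)" by simp
qed

lemma integral_heat_mult_le_add:
  assumes "\<tau> > 0" and m: "f \<in> borel_measurable borel" "g \<in> borel_measurable borel"
    and b: "\<And>z. \<bar>f z\<bar> \<le> B" "\<And>z. \<bar>g z\<bar> \<le> B'" and le: "\<And>z. f z \<le> g z + c"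
  shows "(\<integral>z. heat p \<tau> z * f z \<partial>lborel) \<le> (\<integral>z. heat p \<tau> z * g z \<partial>lborel) + c"
proof -
  note i = integrable_heat_mult_bounded[OF assms(1) m(1) b(1)] integrable_heat_mult_bounded[OF assms(1) m(2) b(2)]
  have "(\<integral>z. heat p \<tau> z * f z \<partial>lborel) \<le> (\<integral>z. heat p \<tau> z * g z + c * heat p \<tau> z \<partial>lborel)"
  proof (rule integral_mono)
    show "integrable lborel (\<lambda>z. heat p \<tau> z * g z + c * heat p \<tau> z)"
      using i integrable_heat[OF assms(1)] by simp
    show "heat p \<tau> z * f z \<le> heat p \<tau> z * g z + c * heat p \<tau> z" for z
      using mult_left_mono[OF le[of z], of "heat p \<tau> z"] heat_pos[OF assms(1), of z] by (simp add: algebra_simps)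
  qed (rule i)
  also have "\<dots> = (\<integral>z. heat p \<tau> z * g z \<partial>lborel) + c"
    using i integrable_heat[OF assms(1)] by (simp add: integral_heat[OF assms(1)])
  finally show ?thesis .
qed

text \<open>Composing a test function with the flow leaves it merely Lipschitz, hence this form. The
  C^1 case is applied to an approximation with the same Lipschitz bound that vanishes wherever
  \<open>h\<close> does; each of the two replacements costs \<eta>, because \<open>heat\<close> has
  mass 1.\<close>

lemma transport_euler_step_lipschitz:
  fixes h :: "'a \<Rightarrow> real"
  assumes ab: "0 < a" "a < r" "r + \<delta> < b" "0 \<le> \<delta>"
    and V: "V > 0" "\<And>\<tau> y. \<tau> \<in> {a..b} \<Longrightarrow> norm y \<le> R + 1 \<Longrightarrow> norm (hscore \<tau> y) \<le> V"
      "\<And>\<tau> y e. \<tau> \<in> {a..b} \<Longrightarrow> norm y \<le> R + 1 \<Longrightarrow> norm (hscore_deriv \<tau> y e) \<le> V * norm e"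
    and \<delta>V: "\<delta> * V < 1"
    and \<epsilon>: "\<epsilon> \<ge> 0" "\<And>\<tau> y. \<tau> \<in> {r..r + \<delta>} \<Longrightarrow> norm y \<le> R + 1 \<Longrightarrow> norm (hscore \<tau> y - hscore r y) \<le> \<epsilon>"
    and h: "\<And>x. h x \<ge> 0" "\<And>x. h x \<le> B" and L: "\<And>x y. \<bar>h x - h y\<bar> \<le> L * norm (x - y)"
    and supp: "\<And>x. norm x > R \<Longrightarrow> h x = 0"
  defines "H \<equiv> \<lambda>z. if norm z < R + 1 then h (z + (\<delta>/2) *\<^sub>R hscore r z) else 0"
  shows "(\<integral>z. heat p (r + \<delta>) z * H z \<partial>lborel) \<le> (\<integral>z. heat p r z * h z \<partial>lborel) + L * (\<epsilon> + \<delta> * V\<^sup>2) * \<delta>"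
proof (rule field_le_epsilon)
  fix e :: real assume "e > 0"
  define \<eta> where "\<eta> = e / 2"
  have \<eta>: "\<eta> > 0" using \<open>e > 0\<close> by (simp add: \<eta>_def)
  have ch: "continuous_on UNIV h" using L by (rule continuous_on_of_lipschitz)
  have inth: "integrable lborel h" using ch supp by (rule integrable_continuous_compact_support)
  obtain k k' where k: "\<And>x. (k has_derivative (\<lambda>e. k' x \<bullet> e)) (at x)" "continuous_on UNIV k'"
    "\<And>x. norm (k' x) \<le> L" "\<And>x. \<bar>k x - h x\<bar> \<le> \<eta>" "\<And>x. h x = 0 \<Longrightarrow> k x = 0 \<and> k' x = 0"
    using lipschitz_C1_approximation[OF h(1) L inth \<eta>] by metis
  have r: "r > 0" "r + \<delta> > 0" using ab by auto
  define Hk where "Hk = (\<lambda>z. if norm z < R + 1 then k (z + (\<delta>/2) *\<^sub>R hscore r z) else 0)"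
  have ck: "continuous_on UNIV k"
    using k(1) by (auto intro: has_derivative_continuous continuous_at_imp_continuous_on)
  have [measurable]: "h \<in> borel_measurable borel" "k \<in> borel_measurable borel" "hscore r \<in> borel_measurable borel"
    using ch ck r by (auto intro: borel_measurable_continuous_onI)
  have [measurable]: "H \<in> borel_measurable borel" "Hk \<in> borel_measurable borel"
    unfolding H_def Hk_def by measurable
  have hb: "\<bar>h x\<bar> \<le> B" for x using h[of x] by simp
  have kb: "\<bar>k x\<bar> \<le> B + \<eta>" for x using hb[of x] k(4)[of x] by linarith
  have B: "0 \<le> B" using order_trans[OF h(1) h(2)] .
  have Hb: "\<bar>H z\<bar> \<le> B" for z using hb B by (simp add: H_def)
  have Hkb: "\<bar>Hk z\<bar> \<le> B + \<eta>" for z using kb B \<eta> by (simp add: Hk_def)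
  have "H z \<le> Hk z + \<eta>" for z
  proof (cases "norm z < R + 1")
    case True
    then show ?thesis using k(4)[of "z + (\<delta>/2) *\<^sub>R hscore r z"] unfolding H_def Hk_def by auto
  qed (use \<eta> in \<open>simp add: H_def Hk_def\<close>)
  then have "(\<integral>z. heat p (r + \<delta>) z * H z \<partial>lborel) \<le> (\<integral>z. heat p (r + \<delta>) z * Hk z \<partial>lborel) + \<eta>"
    by (intro integral_heat_mult_le_add[OF r(2) _ _ Hb Hkb]) auto
  also have "(\<integral>z. heat p (r + \<delta>) z * Hk z \<partial>lborel) \<le> (\<integral>z. heat p r z * k z \<partial>lborel) + L * (\<epsilon> + \<delta> * V\<^sup>2) * \<delta>"
  proof -
    have "\<bar>(\<integral>z. heat p (r + \<delta>) z * Hk z \<partial>lborel) - (\<integral>z. heat p r z * k z \<partial>lborel)\<bar> \<le> L * (\<epsilon> + \<delta> * V\<^sup>2) * \<delta>"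
      unfolding Hk_def
      by (rule transport_euler_step_C1[OF ab V \<delta>V \<epsilon> k(1-3)]) (use supp k(5) in auto)
    then show ?thesis by linarith
  qed
  also have "(\<integral>z. heat p r z * k z \<partial>lborel) \<le> (\<integral>z. heat p r z * h z \<partial>lborel) + \<eta>"
  proof (rule integral_heat_mult_le_add[OF r(1) _ _ kb hb])
    show "k z \<le> h z + \<eta>" for z using k(4)[of z] by linarith
  qed auto
  finally show "(\<integral>z. heat p (r + \<delta>) z * H z \<partial>lborel) \<le> (\<integral>z. heat p r z * h z \<partial>lborel) + L * (\<epsilon> + \<delta> * V\<^sup>2) * \<delta> + e"
    by (simp add: \<eta>_def)
qed

section \<open>Dependence of trajectories on the end point, and the error of an Euler step\<close>

lemma heat_traj_bounded:
  assumes "heat_traj s0 r y"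
  obtains R where "R \<ge> 0" "\<And>t. t \<in> {s0..r} \<Longrightarrow> norm (y t) \<le> R"
proof -
  have "bounded (y ` {s0..r})"
    using assms by (intro compact_imp_bounded compact_continuous_image) (auto simp: heat_traj_def)
  then obtain R where "\<forall>t\<in>{s0..r}. norm (y t) \<le> R" unfolding bounded_iff by auto
  then have "norm (y t) \<le> \<bar>R\<bar>" if "t \<in> {s0..r}" for t using that by force
  then show ?thesis using that[of "\<bar>R\<bar>"] by auto
qed

text \<open>The form of stability used for uniqueness and for continuity of the flow. The constant
  depends on \<open>y\<close> through the ball that contains it, and it serves as closeness
  threshold and as Lipschitz constant at once.\<close>

lemma heat_traj_locally_lipschitz:
  assumes "0 < s0" "s0 \<le> r" "heat_traj s0 r y"
  obtains C where "C > 0" "\<And>y' s. heat_traj s0 r y' \<Longrightarrow> norm (y r - y' r) < 1 / C \<Longrightarrow> s \<in> {s0..r} \<Longrightarrow>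
    norm (y s - y' s) \<le> C * norm (y r - y' r)"
proof -
  obtain R where R: "R \<ge> 0" "\<And>t. t \<in> {s0..r} \<Longrightarrow> norm (y t) \<le> R"
    using heat_traj_bounded[OF assms(3)] by metis
  obtain V where V: "V > 0" "\<And>\<tau> y y'. \<tau> \<in> {s0..r} \<Longrightarrow> norm y \<le> R + 1 \<Longrightarrow> norm y' \<le> R + 1 \<Longrightarrow> norm (hscore \<tau> y - hscore \<tau> y') \<le> V * norm (y - y')"
    using hscore_local_bounds[OF assms(1), of r "R + 1"] by metis
  show ?thesis
  proof (rule that[of "exp (V * r)"])
    fix y' s assume *: "heat_traj s0 r y'" "norm (y r - y' r) < 1 / exp (V * r)" "s \<in> {s0..r}"
    have "norm (y r - y' r) < exp (- V * r)" using *(2) by (simp add: exp_minus field_simps)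
    then show "norm (y s - y' s) \<le> exp (V * r) * norm (y r - y' r)"
      using heat_traj_stability[OF assms(1,2) order_refl assms(3) *(1) _ V(2) R(2) _ *(3)] V(1) by simp
  qed simp
qed

lemma heat_traj_unique:
  assumes "0 < s0" "heat_traj s0 r y" "heat_traj s0 r y'" "y r = y' r" "s \<in> {s0..r}"
  shows "y s = y' s"
proof -
  have "s0 \<le> r" using assms by auto
  then obtain C where "C > 0" "\<And>y' s. heat_traj s0 r y' \<Longrightarrow> norm (y r - y' r) < 1 / C \<Longrightarrow> s \<in> {s0..r} \<Longrightarrow>
    norm (y s - y' s) \<le> C * norm (y r - y' r)"
    using heat_traj_locally_lipschitz[OF assms(1) _ assms(2)] by metis
  from this(1) this(2)[OF assms(3) _ assms(5)] assms(4) show ?thesis by simp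
qed

lemma heat_traj_euler_error:
  assumes "r \<le> r'" "heat_traj r r' y" and V: "V \<ge> 0"
    "\<And>\<tau>. \<tau> \<in> {r..r'} \<Longrightarrow> norm (hscore \<tau> (y \<tau>)) \<le> V"
    "\<And>\<tau>. \<tau> \<in> {r..r'} \<Longrightarrow> norm (hscore \<tau> (y \<tau>) - hscore \<tau> (y r')) \<le> V * norm (y \<tau> - y r')"
    and \<epsilon>: "\<And>\<tau>. \<tau> \<in> {r..r'} \<Longrightarrow> norm (hscore \<tau> (y r') - hscore r (y r')) \<le> \<epsilon>"
  shows "norm (y r - (y r' + ((r' - r) / 2) *\<^sub>R hscore r (y r'))) \<le> (\<epsilon> + (r' - r) * V\<^sup>2) * (r' - r)"
proof -
  have cont: "continuous_on {r..r'} y" and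
    d: "\<And>s. s \<in> {r<..<r'} \<Longrightarrow> (y has_vector_derivative (- 1 / 2) *\<^sub>R hscore s (y s)) (at s)"
    using assms(2) by (auto simp: heat_traj_def)
  have move: "norm (y t - y r') \<le> V * (r' - r)" if t: "t \<in> {r..r'}" for t
  proof -
    have "norm (y t - y r') = norm (y r' - y t)" by (rule norm_minus_commute)
    also have "\<dots> \<le> V * (r' - t)"
    proof (cases "t = r'")
      case False
      then have "t < r'" using t by auto
      moreover have "continuous_on {t..r'} y" using cont t by (auto elim: continuous_on_subset)
      ultimately obtain x where "x \<in> {t<..<r'}" "norm (y r' - y t) \<le> norm ((r' - t) *\<^sub>R ((- 1 / 2) *\<^sub>R hscore x (y x)))"
        using mvt_general[of t r' y "\<lambda>x h. h *\<^sub>R ((- 1 / 2) *\<^sub>R hscore x (y x))"] d t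
        by (auto simp: has_vector_derivative_def)
      note x = this
      have "norm (hscore x (y x)) \<le> V" using V(2)[of x] t x(1) by auto
      then have N: "1/2 * norm (hscore x (y x)) \<le> V" using V(1) by linarith
      have "norm ((r' - t) *\<^sub>R ((- 1 / 2) *\<^sub>R hscore x (y x))) = (r' - t) * (1/2 * norm (hscore x (y x)))"
        using t by simp
      also have "\<dots> \<le> (r' - t) * V"
        using t by (intro mult_left_mono[OF N]) simp
      finally show ?thesis using x(2) by (simp add: mult.commute)
    qed simp
    also have "\<dots> \<le> V * (r' - r)" using t V(1) by (intro mult_left_mono) auto
    finally show ?thesis .
  qed
  \<comment> \<open>Adding the Euler drift backward turns the error into an increment of
    \<open>f\<close>, whose derivative is half a difference of scores. That difference splits into
    the change along the trajectory, bounded with \<open>move\<close>, and the change in time,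
    bounded by \<epsilon>.\<close>
  define f where "f t = y t + ((t - r) / 2) *\<^sub>R hscore r (y r')" for t
  have e: "f r - f r' = y r - (y r' + ((r' - r) / 2) *\<^sub>R hscore r (y r'))" by (simp add: f_def)
  show ?thesis
  proof (cases "r = r'")
    case False
    then have "r < r'" using assms(1) by auto
    moreover have "continuous_on {r..r'} f" unfolding f_def by (intro continuous_intros cont) auto
    moreover have "(f has_derivative (\<lambda>h. h *\<^sub>R ((- 1 / 2) *\<^sub>R (hscore x (y x) - hscore r (y r'))))) (at x)"
      if "x \<in> {r<..<r'}" for x
    proof -
      have "(f has_derivative (\<lambda>h. h *\<^sub>R ((- 1 / 2) *\<^sub>R hscore x (y x)) + (h / 2) *\<^sub>R hscore r (y r'))) (at x)"
        unfolding f_def using d[OF that] unfolding has_vector_derivative_def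
        by (auto intro!: derivative_eq_intros)
      then show ?thesis
        by (rule has_derivative_eq_rhs) (auto simp: fun_eq_iff algebra_simps)
    qed
    ultimately obtain x where x: "x \<in> {r<..<r'}"
      "norm (f r' - f r) \<le> norm ((r' - r) *\<^sub>R ((- 1 / 2) *\<^sub>R (hscore x (y x) - hscore r (y r'))))"
      using mvt_general[of r r' f "\<lambda>x h. h *\<^sub>R ((- 1 / 2) *\<^sub>R (hscore x (y x) - hscore r (y r')))"]
      by auto
    have xI: "x \<in> {r..r'}" using x by auto
    have "norm (hscore x (y x) - hscore r (y r')) \<le> norm (hscore x (y x) - hscore x (y r')) + norm (hscore x (y r') - hscore r (y r'))"
      using norm_triangle_ineq[of "hscore x (y x) - hscore x (y r')" "hscore x (y r') - hscore r (y r')"] by simp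
    also have "\<dots> \<le> V * (V * (r' - r)) + \<epsilon>"
      using V(3)[OF xI] mult_left_mono[OF move[OF xI] V(1)] \<epsilon>[OF xI] by linarith
    finally have "norm (hscore x (y x) - hscore r (y r')) \<le> \<epsilon> + (r' - r) * V\<^sup>2"
      by (simp add: power2_eq_square mult_ac)
    then have "1/2 * norm (hscore x (y x) - hscore r (y r')) \<le> \<epsilon> + (r' - r) * V\<^sup>2"
      using norm_ge_zero[of "hscore x (y x) - hscore r (y r')"] by linarith
    then have "(r' - r) * (1/2 * norm (hscore x (y x) - hscore r (y r'))) \<le> (r' - r) * (\<epsilon> + (r' - r) * V\<^sup>2)"
      using assms(1) by (intro mult_left_mono) auto
    moreover have "norm ((r' - r) *\<^sub>R ((- 1 / 2) *\<^sub>R (hscore x (y x) - hscore r (y r')))) = (r' - r) * (1/2 * norm (hscore x (y x) - hscore r (y r')))"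
      using assms(1) by simp
    ultimately have "norm (f r' - f r) \<le> (\<epsilon> + (r' - r) * V\<^sup>2) * (r' - r)"
      using x(2) by (simp only: mult.commute)
    then show ?thesis unfolding e[symmetric] by (simp add: norm_minus_commute)
  qed simp
qed

end

section \<open>The transport inequality\<close>

context prob_density
begin

text \<open>The forward flow expands distances by at most \<open>sqrt (t / s0)\<close>, so the trajectories that end up
  in the support of the test function at time \<open>s0\<close> stay in one ball.\<close>
lemma heat_traj_confinement:
  assumes "0 < s0" "s0 \<le> T" "heat_traj s0 T y0"
  obtains R where "R \<ge> 0" "\<And>r y t. r \<le> T \<Longrightarrow> heat_traj s0 r y \<Longrightarrow> norm (y s0) \<le> \<rho> \<Longrightarrow> t \<in> {s0..r} \<Longrightarrow> norm (y t) \<le> R"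
proof -
  obtain B where B: "B \<ge> 0" "\<And>t. t \<in> {s0..T} \<Longrightarrow> norm (y0 t) \<le> B"
    using heat_traj_bounded[OF assms(3)] by metis
  \<comment> \<open>\<open>?D\<close> bounds the distance at time \<open>s0\<close> between the
    reference trajectory \<open>y0\<close> and any trajectory that starts in the ball of radius
    \<rho>.\<close>
  let ?D = "\<bar>\<rho>\<bar> + B"
  show ?thesis
  proof (rule that[of "B + sqrt (T / s0) * ?D"])
    show "B + sqrt (T / s0) * ?D \<ge> 0" using B assms by (intro add_nonneg_nonneg mult_nonneg_nonneg) auto
    fix r y t assume *: "r \<le> T" "heat_traj s0 r y" "norm (y s0) \<le> \<rho>" "t \<in> {s0..r}"
    have "(norm (y t - y0 t))\<^sup>2 / t \<le> (norm (y s0 - y0 s0))\<^sup>2 / s0"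
      using * assms by (intro heat_traj_dist_growth) (auto elim: heat_traj_subset)
    then have "(norm (y t - y0 t))\<^sup>2 \<le> t / s0 * (norm (y s0 - y0 s0))\<^sup>2"
      using * assms(1) by (simp add: field_simps)
    also have "\<dots> \<le> T / s0 * ?D\<^sup>2"
    proof -
      have "norm (y s0 - y0 s0) \<le> ?D"
        using norm_triangle_ineq4[of "y s0" "y0 s0"] *(3) B(2)[of s0] assms(2) by auto
      then show ?thesis
        using * assms(1) by (intro mult_mono power_mono divide_right_mono) auto
    qed
    also have "\<dots> = (sqrt (T / s0) * ?D)\<^sup>2" using assms by (simp add: power_mult_distrib)
    finally have "norm (y t - y0 t) \<le> sqrt (T / s0) * ?D"
      by (rule power2_le_imp_le) (use B assms in \<open>auto intro!: mult_nonneg_nonneg\<close>)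
    moreover have "norm (y t) \<le> norm (y0 t) + norm (y t - y0 t)" by (metis norm_triangle_sub)
    ultimately show "norm (y t) \<le> B + sqrt (T / s0) * ?D" using B(2)[of t] * by auto
  qed
qed

lemma hscore_equicontinuous_time:
  assumes "0 < a" "e > 0"
  obtains d where "d > 0" "\<And>\<tau> \<tau>' y. \<tau> \<in> {a..b} \<Longrightarrow> \<tau>' \<in> {a..b} \<Longrightarrow> norm y \<le> R \<Longrightarrow> \<bar>\<tau> - \<tau>'\<bar> < d \<Longrightarrow>
    norm (hscore \<tau> y - hscore \<tau>' y) \<le> e"
proof -
  let ?C = "{a..b} \<times> cball (0::'a) R"
  have "uniformly_continuous_on ?C (\<lambda>(\<tau>, y). hscore \<tau> y)"
    by (intro compact_uniformly_continuous continuous_on_subset[OF continuous_on_hscore[OF assms(1)]] compact_Times) auto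
  then obtain d where d: "d > 0" "\<And>x x'. x \<in> ?C \<Longrightarrow> x' \<in> ?C \<Longrightarrow> dist x' x < d \<Longrightarrow>
      dist ((\<lambda>(\<tau>, y). hscore \<tau> y) x') ((\<lambda>(\<tau>, y). hscore \<tau> y) x) < e"
    unfolding uniformly_continuous_on_def using assms(2) by metis
  show ?thesis
  proof (rule that[OF d(1)])
    fix \<tau> \<tau>' and y :: 'a assume "\<tau> \<in> {a..b}" "\<tau>' \<in> {a..b}" "norm y \<le> R" "\<bar>\<tau> - \<tau>'\<bar> < d"
    then show "norm (hscore \<tau> y - hscore \<tau>' y) \<le> e"
      using d(2)[of "(\<tau>', y)" "(\<tau>, y)"] by (simp add: dist_Pair_Pair dist_norm)
  qed
qed

text \<open>In terms of measures: on the test function \<open>g\<close>, the image of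
  \<open>heat p T\<close> under the backward flow weighs at most as much as
  \<open>heat p s0\<close>. Trajectories are given separately for each end time; uniqueness makes
  them consistent, so \<open>h (r + \<delta>)\<close> at \<open>z\<close> equals \<open>h r\<close>
  at the point which the trajectory of \<open>z\<close> passes at time \<open>r\<close>.\<close>

lemma flow_transport_le:
  fixes Y :: "real \<Rightarrow> 'a \<Rightarrow> real \<Rightarrow> 'a" and g :: "'a \<Rightarrow> real"
  assumes s0: "0 < s0" "s0 \<le> T"
    and Y: "\<And>r z. s0 \<le> r \<Longrightarrow> r \<le> T \<Longrightarrow> heat_traj s0 r (Y r z)" "\<And>r z. s0 \<le> r \<Longrightarrow> r \<le> T \<Longrightarrow> Y r z r = z"
    and g: "\<And>x. g x \<ge> 0" "\<And>x. g x \<le> Bg" and Lg: "\<And>x y. \<bar>g x - g y\<bar> \<le> Lg * norm (x - y)"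
    and supp: "\<And>x. norm x > \<rho> \<Longrightarrow> g x = 0"
  shows "(\<integral>z. heat p T z * g (Y T z s0) \<partial>lborel) \<le> (\<integral>z. heat p s0 z * g z \<partial>lborel)"
proof -
  obtain R where R: "R \<ge> 0" "\<And>r y t. r \<le> T \<Longrightarrow> heat_traj s0 r y \<Longrightarrow> norm (y s0) \<le> \<rho> \<Longrightarrow> t \<in> {s0..r} \<Longrightarrow> norm (y t) \<le> R"
    using heat_traj_confinement[OF s0 Y(1)[OF s0(2) order_refl, of 0]] by metis
  define a b where "a = s0 / 2" and "b = T + 1"
  have ab: "0 < a" "a < s0" "T < b" using s0 by (auto simp: a_def b_def)
  obtain V where V: "V > 0" "\<And>\<tau> y. \<tau> \<in> {a..b} \<Longrightarrow> norm y \<le> R + 1 \<Longrightarrow> norm (hscore \<tau> y) \<le> V"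
    "\<And>\<tau> y e. \<tau> \<in> {a..b} \<Longrightarrow> norm y \<le> R + 1 \<Longrightarrow> norm (hscore_deriv \<tau> y e) \<le> V * norm e"
    "\<And>\<tau> y y'. \<tau> \<in> {a..b} \<Longrightarrow> norm y \<le> R + 1 \<Longrightarrow> norm y' \<le> R + 1 \<Longrightarrow> norm (hscore \<tau> y - hscore \<tau> y') \<le> V * norm (y - y')"
    using hscore_local_bounds[OF ab(1), of b "R + 1"] by metis
  define h where "h r z = g (Y r z s0)" for r z
  define E where "E = exp (V * T)"
  \<comment> \<open>A Lipschitz constant of \<open>h r\<close> for all \<open>r\<close>. For close
    points stability gives the part with \<open>Lg\<close>; for points at distance at least
    \<open>1 / E\<close> the bound \<open>Bg\<close> on the values is itself at most
    \<open>Bg * E\<close> times the distance.\<close>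
  define L where "L = (\<bar>Lg\<bar> + Bg) * E"
  have E: "E > 0" by (simp add: E_def)
  have Bg: "Bg \<ge> 0" using order_trans[OF g(1) g(2)] .
  have h0: "h r z \<ge> 0" "h r z \<le> Bg" for r z by (simp_all add: h_def g)
  \<comment> \<open>Where \<open>h r\<close> is nonzero the trajectory reaches the support of
    \<open>g\<close> at time \<open>s0\<close>, so the confinement lemma applies to all of
    it.\<close>
  have in_ball: "norm (Y r z t) \<le> R" if "s0 \<le> r" "r \<le> T" "h r z \<noteq> 0" "t \<in> {s0..r}" for r z t
  proof (rule R(2)[OF that(2) Y(1)[OF that(1,2)] _ that(4)])
    show "norm (Y r z s0) \<le> \<rho>" using supp[of "Y r z s0"] that(3) by (force simp: h_def)
  qed
  have hsupp: "h r z = 0" if "s0 \<le> r" "r \<le> T" "norm z > R" for r z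
    using in_ball[OF that(1,2), of z r] that Y(2)[OF that(1,2), of z] by force
  have lip1: "\<bar>h r z - h r z'\<bar> \<le> L * norm (z - z')" if r: "s0 \<le> r" "r \<le> T" and nz: "h r z \<noteq> 0" for r z z'
  proof (cases "norm (z - z') < exp (- V * T)")
    case True
    have "norm (Y r z s0 - Y r z' s0) \<le> exp (V * T) * norm (Y r z r - Y r z' r)"
    proof (rule heat_traj_stability[OF s0(1) r Y(1)[OF r] Y(1)[OF r], where R=R])
      show "norm (hscore t u - hscore t v) \<le> V * norm (u - v)"
        if "t \<in> {s0..T}" "norm u \<le> R + 1" "norm v \<le> R + 1" for t u v
        using that ab by (intro V(4)) auto
      show "norm (Y r z r - Y r z' r) < exp (- V * T)" using True by (simp add: Y(2) r)
    qed (use V(1) in_ball[OF r nz] r in auto)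
    then have "norm (Y r z s0 - Y r z' s0) \<le> E * norm (z - z')" by (simp add: Y(2) r E_def)
    then have "\<bar>Lg\<bar> * norm (Y r z s0 - Y r z' s0) \<le> \<bar>Lg\<bar> * (E * norm (z - z'))" by (rule mult_left_mono) simp
    moreover have "Lg * norm (Y r z s0 - Y r z' s0) \<le> \<bar>Lg\<bar> * norm (Y r z s0 - Y r z' s0)" by (intro mult_right_mono) auto
    ultimately have "\<bar>h r z - h r z'\<bar> \<le> \<bar>Lg\<bar> * (E * norm (z - z'))"
      using Lg[of "Y r z s0" "Y r z' s0"] unfolding h_def by linarith
    also have "\<dots> \<le> L * norm (z - z')"
      using Bg E by (simp add: L_def algebra_simps)
    finally show ?thesis .
  next
    case False
    then have "1 \<le> E * norm (z - z')" using E by (simp add: E_def exp_minus field_simps)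
    then have "Bg * 1 \<le> Bg * (E * norm (z - z'))" using Bg by (rule mult_left_mono)
    also have "\<dots> \<le> L * norm (z - z')"
      using E by (simp add: L_def algebra_simps)
    finally show ?thesis using h0[of r z] h0[of r z'] by linarith
  qed
  have lip: "\<bar>h r z - h r z'\<bar> \<le> L * norm (z - z')" if r: "s0 \<le> r" "r \<le> T" for r z z'
  proof (cases "h r z = 0 \<and> h r z' = 0")
    case True
    moreover have "L \<ge> 0" using Bg E by (simp add: L_def)
    ultimately show ?thesis by simp
  next
    case False
    then show ?thesis
      using lip1[OF r, of z z'] lip1[OF r, of z' z] by (auto simp: norm_minus_commute abs_minus_commute)
  qed
  have L0: "L \<ge> 0" using Bg E by (simp add: L_def)
  have hm: "h r \<in> borel_measurable borel" if "s0 \<le> r" "r \<le> T" for r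
    using continuous_on_of_lipschitz[OF lip[OF that]] by (rule borel_measurable_continuous_onI)
  define I where "I r = (\<integral>z. heat p r z * h r z \<partial>lborel)" for r
  \<comment> \<open>The factor 2 counts two errors: replacing the flow by an Euler step in the
    argument of a Lipschitz function, and the change of the integral over that Euler step.\<close>
  have step: "I (r + \<delta>) \<le> I r + 2 * L * (\<epsilon> + \<delta> * V\<^sup>2) * \<delta>"
    if r: "s0 \<le> r" "0 \<le> \<delta>" "r + \<delta> \<le> T" and small: "\<delta> * V < 1" "\<epsilon> > 0"
      and eps: "\<And>\<tau> y. \<tau> \<in> {r..r + \<delta>} \<Longrightarrow> norm y \<le> R + 1 \<Longrightarrow> norm (hscore \<tau> y - hscore r y) \<le> \<epsilon>" for r \<delta> \<epsilon>
  proof -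
    let ?r' = "r + \<delta>"
    define H where "H = (\<lambda>z. if norm z < R + 1 then h r (z + (\<delta>/2) *\<^sub>R hscore r z) else 0)"
    have r'': "s0 \<le> ?r'" "r \<le> T" "r > 0" "?r' > 0" using r s0 by auto
    have Hm: "H \<in> borel_measurable borel"
    proof -
      note [measurable] = hm[OF r(1) r''(2)] hscore_measurable[OF r''(3)]
      show ?thesis unfolding H_def by measurable
    qed
    have H0: "H z \<ge> 0" "H z \<le> Bg" for z using h0 Bg by (auto simp: H_def)
    have "h ?r' z \<le> H z + L * (\<epsilon> + \<delta> * V\<^sup>2) * \<delta>" for z
    proof (cases "h ?r' z = 0")
      case True
      then show ?thesis using H0[of z] L0 r small(2) by (simp add: add_nonneg_nonneg)
    next
      case False
      let ?y = "Y ?r' z"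
      have yend: "?y ?r' = z" using Y(2)[OF r''(1) r(3)] .
      have tr: "heat_traj s0 ?r' ?y" using Y(1)[OF r''(1) r(3)] .
      have yR: "norm (?y t) \<le> R" if "t \<in> {s0..?r'}" for t using in_ball[OF r''(1) r(3) False that] .
      have zR: "norm z \<le> R" using yR[of ?r'] yend r'' by auto
      have "?y s0 = Y r (?y r) s0"
        by (rule heat_traj_unique[OF s0(1) heat_traj_subset[OF tr order_refl] Y(1)[OF r(1) r''(2)]])
          (use r Y(2)[OF r(1) r''(2)] in auto)
      then have "h ?r' z = h r (?y r)" by (simp add: h_def)
      also have "\<dots> \<le> h r (z + (\<delta>/2) *\<^sub>R hscore r z) + L * norm (?y r - (z + (\<delta>/2) *\<^sub>R hscore r z))"
        using lip[OF r(1) r''(2), of "?y r" "z + (\<delta>/2) *\<^sub>R hscore r z"] by linarith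
      also have "norm (?y r - (z + (\<delta>/2) *\<^sub>R hscore r z)) \<le> (\<epsilon> + \<delta> * V\<^sup>2) * \<delta>"
      proof -
        have "norm (?y r - (?y ?r' + ((?r' - r)/2) *\<^sub>R hscore r (?y ?r'))) \<le> (\<epsilon> + (?r' - r) * V\<^sup>2) * (?r' - r)"
        proof (rule heat_traj_euler_error)
          show "r \<le> ?r'" using r by simp
          show "heat_traj r ?r' ?y" using heat_traj_subset[OF tr r(1)] by simp
          show "V \<ge> 0" using V(1) by simp
          fix \<tau> assume t: "\<tau> \<in> {r..?r'}"
          then have t': "\<tau> \<in> {a..b}" "\<tau> \<in> {s0..?r'}" using r ab by auto
          show "norm (hscore \<tau> (?y \<tau>)) \<le> V" using V(2)[OF t'(1)] yR[OF t'(2)] by simp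
          show "norm (hscore \<tau> (?y \<tau>) - hscore \<tau> (?y ?r')) \<le> V * norm (?y \<tau> - ?y ?r')"
            using yR[OF t'(2)] zR yend by (intro V(4)[OF t'(1)]) auto
          show "norm (hscore \<tau> (?y ?r') - hscore r (?y ?r')) \<le> \<epsilon>"
            using eps[OF t] zR yend by simp
        qed
        then show ?thesis by (simp add: yend)
      qed
      finally have "h ?r' z \<le> h r (z + (\<delta>/2) *\<^sub>R hscore r z) + L * ((\<epsilon> + \<delta> * V\<^sup>2) * \<delta>)"
        using L0 by (simp add: mult_left_mono)
      moreover have "H z = h r (z + (\<delta>/2) *\<^sub>R hscore r z)" using zR unfolding H_def by simp
      ultimately show ?thesis by (simp add: mult.assoc)
    qed
    then have "I ?r' \<le> (\<integral>z. heat p ?r' z * H z \<partial>lborel) + L * (\<epsilon> + \<delta> * V\<^sup>2) * \<delta>"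
      unfolding I_def
      by (intro integral_heat_mult_le_add[where B=Bg and B'=Bg] hm Hm r'' r) (use h0 H0 in auto)
    also have "(\<integral>z. heat p ?r' z * H z \<partial>lborel) \<le> I r + L * (\<epsilon> + \<delta> * V\<^sup>2) * \<delta>"
      unfolding I_def H_def
      by (rule transport_euler_step_lipschitz[OF ab(1) _ _ r(2) V(1-3) small(1) _ eps h0 lip[OF r(1) r''(2)] hsupp[OF r(1) r''(2)]])
        (use r ab small in auto)
    finally show ?thesis by (simp add: mult.assoc mult.commute[of \<delta>] mult.left_commute[of \<delta>])
  qed
  have "I T \<le> I s0 + e" if "e > 0" for e
  proof -
    \<comment> \<open>Once \<open>\<delta> * V\<^sup>2 \<le> \<epsilon>\<close>, the error per unit
      of time is \<open>4 * L * \<epsilon>\<close>; the added 1 keeps \<open>M\<close>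
      positive.\<close>
    define M where "M = 4 * L * (T - s0) + 1"
    have M: "M > 0" using L0 s0 by (simp add: M_def add_nonneg_pos)
    define \<epsilon> where "\<epsilon> = e / M"
    have \<epsilon>: "\<epsilon> > 0" using that M by (simp add: \<epsilon>_def)
    obtain d0 where d0: "d0 > 0" "\<And>\<tau> \<tau>' y. \<tau> \<in> {a..b} \<Longrightarrow> \<tau>' \<in> {a..b} \<Longrightarrow> norm y \<le> R + 1 \<Longrightarrow> \<bar>\<tau> - \<tau>'\<bar> < d0 \<Longrightarrow>
        norm (hscore \<tau> y - hscore \<tau>' y) \<le> \<epsilon>"
      using hscore_equicontinuous_time[OF ab(1) \<epsilon>, of b "R + 1"] by metis
    \<comment> \<open>Steps shorter than \<open>c\<close> meet three demands: the score changes by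
      at most \<epsilon> in time, \<open>\<delta> * V < 1\<close>, and
      \<open>\<delta> * V\<^sup>2 \<le> \<epsilon>\<close>.\<close>
    define c where "c = min d0 (min (1 / V) (\<epsilon> / V\<^sup>2))"
    have c: "c > 0" using d0 V(1) \<epsilon> by (simp add: c_def)
    obtain N :: nat where N: "(T - s0) / c < real N" using reals_Archimedean2 by blast
    have N0: "N > 0" using N s0 c by (metis divide_nonneg_pos diff_ge_0_iff_ge gr0I not_less of_nat_0)
    define \<delta> where "\<delta> = (T - s0) / real N"
    have \<delta>: "0 \<le> \<delta>" "\<delta> < c" "real N * \<delta> = T - s0"
      using N N0 s0 c by (auto simp: \<delta>_def field_simps)
    have \<delta>V: "\<delta> * V < 1" "\<delta> * V\<^sup>2 \<le> \<epsilon>"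
      using \<delta>(2) V(1) by (auto simp: c_def field_simps)
    have "I (s0 + real n * \<delta>) \<le> I s0 + real n * \<delta> * (4 * L * \<epsilon>)" if "n \<le> N" for n
      using that
    proof (induction n)
      case (Suc n)
      let ?r = "s0 + real n * \<delta>"
      have "real (Suc n) * \<delta> \<le> real N * \<delta>" using Suc.prems \<delta>(1) by (intro mult_right_mono) auto
      then have rT: "?r + \<delta> \<le> T" using \<delta>(3) by (simp add: algebra_simps)
      have s0r: "s0 \<le> ?r" using \<delta>(1) by simp
      have "I (?r + \<delta>) \<le> I ?r + 2 * L * (\<epsilon> + \<delta> * V\<^sup>2) * \<delta>"
      proof (rule step[OF s0r \<delta>(1) rT \<delta>V(1) \<epsilon>])
        fix \<tau> y assume \<tau>: "\<tau> \<in> {?r..?r + \<delta>}" and y: "norm (y::'a) \<le> R + 1"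
        have "\<tau> \<in> {a..b}" "?r \<in> {a..b}" using \<tau> rT s0r ab \<delta>(1) unfolding atLeastAtMost_iff by linarith+
        then show "norm (hscore \<tau> y - hscore ?r y) \<le> \<epsilon>"
          using \<delta>(2) \<tau> by (intro d0(2)[OF _ _ y]) (auto simp: c_def)
      qed
      also have "2 * L * (\<epsilon> + \<delta> * V\<^sup>2) * \<delta> \<le> 2 * L * (\<epsilon> + \<epsilon>) * \<delta>"
        using \<delta>V(2) L0 \<delta>(1) by (intro mult_right_mono mult_left_mono) auto
      finally show ?case using Suc by (simp add: algebra_simps)
    qed simp
    from this[of N] have "I T \<le> I s0 + (T - s0) * (4 * L * \<epsilon>)" using \<delta>(3) by simp
    also have "(T - s0) * (4 * L * \<epsilon>) \<le> M * \<epsilon>" using \<epsilon> by (simp add: M_def algebra_simps)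
    also have "M * \<epsilon> = e" using M by (simp add: \<epsilon>_def)
    finally show ?thesis by simp
  qed
  then have "I T \<le> I s0" by (rule field_le_epsilon)
  moreover have "h s0 = g" using Y(2)[OF order_refl s0(2)] by (auto simp: h_def)
  ultimately show ?thesis by (simp add: I_def h_def)
qed

end

section \<open>Fisher information and displacement of the flow\<close>

text \<open>Fatou's lemma, in the form that carries a bound through the removal of truncations and
  through the limit of small starting times.\<close>

lemma nn_integral_le_of_tendsto:
  fixes u :: "nat \<Rightarrow> 'b \<Rightarrow> ennreal"
  assumes "\<And>n. u n \<in> borel_measurable M" "\<And>x. x \<in> space M \<Longrightarrow> (\<lambda>n. u n x) \<longlonglongrightarrow> f x"
    and "\<And>n. (\<integral>\<^sup>+x. u n x \<partial>M) \<le> C"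
  shows "(\<integral>\<^sup>+x. f x \<partial>M) \<le> C"
proof -
  have "(\<integral>\<^sup>+x. f x \<partial>M) = (\<integral>\<^sup>+x. liminf (\<lambda>n. u n x) \<partial>M)"
    using lim_imp_Liminf[OF sequentially_bot assms(2)] by (intro nn_integral_cong) simp
  also have "\<dots> \<le> liminf (\<lambda>n. \<integral>\<^sup>+x. u n x \<partial>M)"
    using assms(1) by (rule nn_integral_liminf)
  also have "\<dots> \<le> C"
    by (rule Liminf_le) (use assms(3) in \<open>auto intro!: always_eventually\<close>)
  finally show ?thesis .
qed

section \<open>Fisher information under the heat evolution\<close>

lemma integrable_conv_hk:
  fixes f :: "'a::euclidean_space \<Rightarrow> real"
  assumes "\<tau> > 0" "integrable lborel f"
  shows "integrable lborel (\<lambda>x. f x * hk \<tau> (y - x))"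
proof -
  obtain K where "\<And>\<tau>' u. \<tau>' \<in> {\<tau>..\<tau>} \<Longrightarrow> hk \<tau>' (u::'a) \<le> K"
    using hk_kernel_bounds[OF assms(1), of \<tau>] by metis
  then have "norm (hk \<tau> u) \<le> K" for u :: 'a by (simp add: hk_nonneg)
  from integrable_conv_bounded[OF assms(2) hk_measurable this] show ?thesis by simp
qed

text \<open>The quotient below is the Fisher information density; it is \<open>0\<close> where \<open>p\<close> vanishes, since \<open>x / 0 = 0\<close>.\<close>
locale fisher_density = prob_density p for p :: "'a::euclidean_space \<Rightarrow> real" +
  fixes gp :: "'a \<Rightarrow> 'a"
  assumes p_deriv: "\<And>x. (p has_derivative (\<lambda>e. gp x \<bullet> e)) (at x)"
    and gp_cont: "continuous_on UNIV gp"
    and fisher_int: "integrable lborel (\<lambda>x. (norm (gp x))\<^sup>2 / p x)"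
begin

definition fisher_dens :: "'a \<Rightarrow> real" where
  "fisher_dens x = (norm (gp x))\<^sup>2 / p x"

definition fisher :: real where
  "fisher = (\<integral>x. fisher_dens x \<partial>lborel)"

lemma fisher_dens_nonneg: "fisher_dens x \<ge> 0"
  by (simp add: fisher_dens_def p_nonneg)

lemma fisher_nonneg: "fisher \<ge> 0"
  unfolding fisher_def by (intro integral_nonneg_AE AE_I2) (rule fisher_dens_nonneg)

lemma integrable_fisher_dens: "integrable lborel fisher_dens"
  using fisher_int by (simp add: fisher_dens_def[abs_def])

lemma gp_measurable [measurable]: "gp \<in> borel_measurable borel"
  using gp_cont by (rule borel_measurable_continuous_onI)

lemma gp_eq_0: "p x = 0 \<Longrightarrow> gp x = 0"
proof -
  assume "p x = 0"
  then have "(\<lambda>e. gp x \<bullet> e) = (\<lambda>e. 0)"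
    by (intro has_derivative_local_min[OF p_deriv]) (simp add: p_nonneg)
  from fun_cong[OF this, of "gp x"] show ?thesis by simp
qed

lemma fisher_dens_measurable [measurable]: "fisher_dens \<in> borel_measurable borel"
  using integrable_fisher_dens by auto

text \<open>A weighted arithmetic-geometric mean inequality that acts as a pointwise Cauchy-Schwarz
  inequality. At a zero of \<open>p\<close> both sides vanish, since \<open>p\<close> has a minimum
  there and \<open>gp\<close> is 0.\<close>

lemma norm_gp_le: "norm (gp x) * c \<le> (l * fisher_dens x + p x * c\<^sup>2 / l) / 2" if "l > 0"
proof (cases "p x = 0")
  case False
  then have p: "p x > 0" using p_nonneg[of x] by simp
  have "0 \<le> (l * norm (gp x) - p x * c)\<^sup>2 / (2 * l * p x)" using p that by simp
  also have "\<dots> = (l * fisher_dens x + p x * c\<^sup>2 / l) / 2 - norm (gp x) * c"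
    using p that by (simp add: fisher_dens_def field_simps power2_eq_square)
  finally show ?thesis by simp
qed (simp add: gp_eq_0 fisher_dens_def)

lemma integrable_gp: "integrable lborel gp"
proof (rule Bochner_Integration.integrable_bound)
  show "integrable lborel (\<lambda>x. (fisher_dens x + p x) / 2)" using integrable_fisher_dens p_int by simp
  have "norm (gp x) \<le> (fisher_dens x + p x) / 2" for x
    using norm_gp_le[of 1 x 1] by simp
  then show "AE x in lborel. norm (gp x) \<le> norm ((fisher_dens x + p x) / 2)"
    by (auto intro!: AE_I2 order_trans[OF _ abs_ge_self])
qed simp

text \<open>The derivative moves from the kernel onto \<open>p\<close>, because the derivative in
  \<open>x\<close> of \<open>p x * hk \<tau> (y - x)\<close> integrates to 0. This ties the evolved
  score to the score of \<open>p\<close>.\<close>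

lemma heat_grad_eq_conv_gp:
  assumes "\<tau> > 0"
  shows "heat_grad p \<tau> y \<bullet> e = (\<integral>x. (gp x \<bullet> e) * hk \<tau> (y - x) \<partial>lborel)"
proof -
  let ?f' = "\<lambda>x e. (gp x \<bullet> e) * hk \<tau> (y - x) - p x * (hk_grad \<tau> (y - x) \<bullet> e)"
  have i1: "integrable lborel (\<lambda>x. (gp x \<bullet> e) * hk \<tau> (y - x))"
    using integrable_gp by (intro integrable_conv_hk[OF assms] integrable_inner_left) auto
  have i2: "integrable lborel (\<lambda>x. p x * (hk_grad \<tau> (y - x) \<bullet> e))"
    using integrable_inner_left[OF integrable_p_hk_grad[OF assms, of y], of e] by simp
  have chk: "continuous_on UNIV (hk \<tau> :: 'a \<Rightarrow> real)" "continuous_on UNIV (hk_grad \<tau> :: 'a \<Rightarrow> 'a)"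
    using has_derivative_hk[OF assms] has_derivative_hk_grad[OF assms]
    by (auto intro: has_derivative_continuous continuous_at_imp_continuous_on)
  have cp: "continuous_on UNIV p"
    using p_deriv by (auto intro: has_derivative_continuous continuous_at_imp_continuous_on)
  have "(\<integral>x. ?f' x e \<partial>lborel) = 0"
  proof (rule integral_directional_derivative_eq_0[where f="\<lambda>x. p x * hk \<tau> (y - x)" and f'="?f'" and e=e])
    show "((\<lambda>x. p x * hk \<tau> (y - x)) has_derivative ?f' x) (at x)" for x
    proof -
      have "((\<lambda>x. hk \<tau> (y - x)) has_derivative (\<lambda>e. hk_grad \<tau> (y - x) \<bullet> (- e))) (at x)"
        by (rule has_derivative_compose[of "\<lambda>x. y - x", OF _ has_derivative_hk[OF assms]])
          (auto intro!: derivative_eq_intros)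
      from has_derivative_mult[OF p_deriv this] show ?thesis
        by (rule has_derivative_eq_rhs) (simp add: fun_eq_iff)
    qed
    show "continuous_on UNIV (\<lambda>x. ?f' x e)"
      by (intro continuous_intros gp_cont cp continuous_on_compose2[OF chk(1)] continuous_on_compose2[OF chk(2)]) auto
    show "integrable lborel (\<lambda>x. p x * hk \<tau> (y - x))" by (rule integrable_p_hk[OF assms])
    show "integrable lborel (\<lambda>x. ?f' x e)" using i1 i2 by simp
  qed
  then have "(\<integral>x. (gp x \<bullet> e) * hk \<tau> (y - x) \<partial>lborel) = (\<integral>x. p x * (hk_grad \<tau> (y - x) \<bullet> e) \<partial>lborel)"
    using i1 i2 by simp
  also have "\<dots> = heat_grad p \<tau> y \<bullet> e"
    using integral_inner_left[OF integrable_p_hk_grad[OF assms, of y], of e] by (simp add: heat_grad_def)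
  finally show ?thesis by simp
qed

text \<open>The evolved score is the posterior mean of the score of \<open>p\<close>, so this is
  Jensen's inequality for the squared norm. The gradient is tested on itself, and
  \<open>norm_gp_le\<close> is used with the weight \<open>?q\<close>: its second summand then
  integrates to half of the left side and is absorbed.\<close>

lemma heat_mult_hscore_le:
  assumes "\<tau> > 0"
  shows "heat p \<tau> y * (norm (hscore \<tau> y))\<^sup>2 \<le> (\<integral>x. fisher_dens x * hk \<tau> (y - x) \<partial>lborel)"
proof -
  let ?g = "heat_grad p \<tau> y" and ?q = "heat p \<tau> y"
  let ?A = "\<integral>x. fisher_dens x * hk \<tau> (y - x) \<partial>lborel"
  have q: "?q > 0" by (rule heat_pos[OF assms])
  have i: "integrable lborel (\<lambda>x. fisher_dens x * hk \<tau> (y - x))"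
    by (rule integrable_conv_hk[OF assms integrable_fisher_dens])
  have i1: "integrable lborel (\<lambda>x. (gp x \<bullet> ?g) * hk \<tau> (y - x))"
    using integrable_gp by (intro integrable_conv_hk[OF assms] integrable_inner_left) auto
  have "(norm ?g)\<^sup>2 = (\<integral>x. (gp x \<bullet> ?g) * hk \<tau> (y - x) \<partial>lborel)"
    by (simp add: power2_norm_eq_inner heat_grad_eq_conv_gp[OF assms])
  also have "\<dots> \<le> (\<integral>x. (?q/2) * (fisher_dens x * hk \<tau> (y - x)) + ((norm ?g)\<^sup>2 / ?q / 2) * (p x * hk \<tau> (y - x)) \<partial>lborel)"
  proof (rule integral_mono[OF i1])
    show "integrable lborel (\<lambda>x. (?q/2) * (fisher_dens x * hk \<tau> (y - x)) + ((norm ?g)\<^sup>2 / ?q / 2) * (p x * hk \<tau> (y - x)))"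
      using i integrable_p_hk[OF assms, of y] by (intro Bochner_Integration.integrable_add integrable_mult_right) auto
    fix x
    have "gp x \<bullet> ?g \<le> norm (gp x) * norm ?g" by (rule norm_cauchy_schwarz)
    also have "\<dots> \<le> (?q * fisher_dens x + p x * (norm ?g)\<^sup>2 / ?q) / 2" by (rule norm_gp_le[OF q])
    finally have "(gp x \<bullet> ?g) * hk \<tau> (y - x) \<le> (?q * fisher_dens x + p x * (norm ?g)\<^sup>2 / ?q) / 2 * hk \<tau> (y - x)"
      by (rule mult_right_mono) (rule hk_nonneg)
    also have "\<dots> = (?q/2) * (fisher_dens x * hk \<tau> (y - x)) + ((norm ?g)\<^sup>2 / ?q / 2) * (p x * hk \<tau> (y - x))"
      by (simp add: add_divide_distrib distrib_right mult.assoc mult.left_commute[of "p x"])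
    finally show "(gp x \<bullet> ?g) * hk \<tau> (y - x) \<le> \<dots>" .
  qed
  also have "\<dots> = (?q/2) * ?A + ((norm ?g)\<^sup>2 / ?q / 2) * ?q"
    using i integrable_p_hk[OF assms, of y] by (subst Bochner_Integration.integral_add) (simp_all add: heat_eq[symmetric])
  finally have "(norm ?g)\<^sup>2 \<le> ?q * ?A" using q by simp
  then have "?q * (norm (hscore \<tau> y))\<^sup>2 * ?q \<le> ?A * ?q"
    using q by (simp add: heat_grad_eq_hscore[OF assms] power_mult_distrib power2_eq_square mult_ac)
  then show ?thesis using mult_right_le_imp_le[OF _ q] by blast
qed

lemma nn_integral_hscore_le_fisher:
  assumes "\<tau> > 0"
  shows "(\<integral>\<^sup>+y. ennreal (heat p \<tau> y * (norm (hscore \<tau> y))\<^sup>2) \<partial>lborel) \<le> ennreal fisher"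
proof -
  have "(\<integral>\<^sup>+y. ennreal (heat p \<tau> y * (norm (hscore \<tau> y))\<^sup>2) \<partial>lborel)
      \<le> (\<integral>\<^sup>+y. \<integral>\<^sup>+x. ennreal (fisher_dens x * hk \<tau> (y - x)) \<partial>lborel \<partial>lborel)"
  proof (rule nn_integral_mono)
    fix y
    have "(\<integral>\<^sup>+x. ennreal (fisher_dens x * hk \<tau> (y - x)) \<partial>lborel) = ennreal (\<integral>x. fisher_dens x * hk \<tau> (y - x) \<partial>lborel)"
      by (rule nn_integral_eq_integral) (auto simp: integrable_conv_hk[OF assms integrable_fisher_dens] hk_nonneg fisher_dens_nonneg)
    then show "ennreal (heat p \<tau> y * (norm (hscore \<tau> y))\<^sup>2) \<le> (\<integral>\<^sup>+x. ennreal (fisher_dens x * hk \<tau> (y - x)) \<partial>lborel)"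
      using heat_mult_hscore_le[OF assms, of y] by (simp add: ennreal_leI)
  qed
  also have "\<dots> = (\<integral>\<^sup>+x. \<integral>\<^sup>+y. ennreal (fisher_dens x * hk \<tau> (y - x)) \<partial>lborel \<partial>lborel)"
    by (rule lborel_pair.Fubini'[symmetric]) measurable
  also have "\<dots> = (\<integral>\<^sup>+x. ennreal (fisher_dens x) \<partial>lborel)"
  proof (rule nn_integral_cong)
    fix x
    have "(\<integral>\<^sup>+y. ennreal (fisher_dens x * hk \<tau> (y - x)) \<partial>lborel) = ennreal (fisher_dens x) * (\<integral>\<^sup>+y. ennreal (hk \<tau> (y + - x)) \<partial>lborel)"
      by (simp add: ennreal_mult fisher_dens_nonneg hk_nonneg nn_integral_cmult)
    also have "(\<integral>\<^sup>+y. ennreal (hk \<tau> (y + - x)) \<partial>lborel) = 1"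
      by (subst nn_integral_lborel_translate) (auto simp: nn_integral_hk assms)
    finally show "(\<integral>\<^sup>+y. ennreal (fisher_dens x * hk \<tau> (y - x)) \<partial>lborel) = ennreal (fisher_dens x)" by simp
  qed
  also have "\<dots> = ennreal fisher"
    unfolding fisher_def by (rule nn_integral_eq_integral) (auto simp: integrable_fisher_dens fisher_dens_nonneg)
  finally show ?thesis .
qed

end

section \<open>Continuity of the flow map, truncated scores, and the displacement of one
  trajectory\<close>

context prob_density
begin

text \<open>Continuity is joint in time and end point, because the displacement estimate exchanges
  the integrals over these two variables.\<close>

lemma continuous_on_flow:
  assumes "0 < s0" "s0 \<le> T" and Y: "\<And>z. heat_traj s0 T (Y z)" "\<And>z. Y z T = z"
  shows "continuous_on ({s0..T} \<times> UNIV) (\<lambda>(t, z). Y z t)"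
  unfolding continuous_on_sequentially
proof (intro allI ballI impI, elim conjE)
  fix X :: "nat \<Rightarrow> real \<times> 'a" and l
  assume l: "l \<in> {s0..T} \<times> UNIV" and X: "\<forall>n. X n \<in> {s0..T} \<times> UNIV" "X \<longlonglongrightarrow> l"
  obtain t z where tz: "l = (t, z)" by (cases l)
  have Xt: "(\<lambda>n. fst (X n)) \<longlonglongrightarrow> t" "(\<lambda>n. snd (X n)) \<longlonglongrightarrow> z" using tendsto_fst[OF X(2)] tendsto_snd[OF X(2)] tz by simp_all
  obtain C where C: "C > 0" "\<And>y' s. heat_traj s0 T y' \<Longrightarrow> norm (Y z T - y' T) < 1 / C \<Longrightarrow> s \<in> {s0..T} \<Longrightarrow>
    norm (Y z s - y' s) \<le> C * norm (Y z T - y' T)"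
    using heat_traj_locally_lipschitz[OF assms(1,2) Y(1)[of z]] by metis
  have "continuous_on {s0..T} (Y z)" using Y(1) by (simp add: heat_traj_def)
  then have 1: "(\<lambda>n. Y z (fst (X n))) \<longlonglongrightarrow> Y z t"
    by (rule continuous_on_tendsto_compose[OF _ Xt(1)]) (use l X(1) tz in \<open>auto simp: mem_Times_iff\<close>)
  have d: "(\<lambda>n. norm (z - snd (X n))) \<longlonglongrightarrow> 0"
    using tendsto_norm[OF tendsto_diff[OF tendsto_const[of z] Xt(2)]] by simp
  have "eventually (\<lambda>n. norm (z - snd (X n)) < 1 / C) sequentially"
    using order_tendstoD(2)[OF d, of "1 / C"] C(1) by simp
  then have ev: "eventually (\<lambda>n. norm (Y z (fst (X n)) - Y (snd (X n)) (fst (X n))) \<le> norm (z - snd (X n)) * C) sequentially"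
  proof eventually_elim
    case (elim n)
    have "fst (X n) \<in> {s0..T}" using X(1) by (auto simp: mem_Times_iff)
    then show ?case using C(2)[OF Y(1)[of "snd (X n)"], of "fst (X n)"] elim by (simp add: Y(2) mult.commute)
  qed
  have "(\<lambda>n. Y z (fst (X n)) - Y (snd (X n)) (fst (X n))) \<longlonglongrightarrow> 0"
    by (rule tendsto_0_le[OF d, of _ C]) (use ev in simp)
  from tendsto_diff[OF 1 this] show "((\<lambda>(t, z). Y z t) \<circ> X) \<longlonglongrightarrow> (\<lambda>(t, z). Y z t) l"
    by (simp add: o_def case_prod_beta tz)
qed

end

context prob_density
begin

text \<open>Admissible test functions for \<open>flow_transport_le\<close> that exhaust the squared
  score: the factor \<open>ct\<close> falls linearly from 1 to 0 over the last unit before radius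
  \<open>n\<close>.\<close>

lemma hscore_truncation:
  assumes "\<tau> > 0"
  obtains g L B where "\<And>x. 0 \<le> g x" "\<And>x. g x \<le> B" "\<And>x y. \<bar>g x - g y\<bar> \<le> L * norm (x - y)"
    "\<And>x. norm x > real n \<Longrightarrow> g x = 0" "\<And>x. g x \<le> (norm (hscore \<tau> x))\<^sup>2"
    "\<And>x. norm x + 1 \<le> real n \<Longrightarrow> g x = (norm (hscore \<tau> x))\<^sup>2"
proof -
  let ?S = "hscore \<tau>"
  obtain V where V: "V > 0" "\<And>\<tau>' y. \<tau>' \<in> {\<tau>..\<tau>} \<Longrightarrow> norm y \<le> real n \<Longrightarrow> norm (hscore \<tau>' y) \<le> V"
    "\<And>\<tau>' y y'. \<tau>' \<in> {\<tau>..\<tau>} \<Longrightarrow> norm y \<le> real n \<Longrightarrow> norm y' \<le> real n \<Longrightarrow> norm (hscore \<tau>' y - hscore \<tau>' y') \<le> V * norm (y - y')"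
    using hscore_local_bounds[OF assms, of \<tau> "real n"] by metis
  define ct where "ct x = max 0 (min 1 (real n - norm x))" for x :: 'a
  define g where "g x = ct x * (norm (?S x))\<^sup>2" for x
  have ct: "0 \<le> ct x" "ct x \<le> 1" "norm x \<ge> real n \<Longrightarrow> ct x = 0" for x by (auto simp: ct_def)
  have ctL: "\<bar>ct x - ct y\<bar> \<le> norm (x - y)" for x y
    using norm_triangle_ineq2[of x y] norm_triangle_ineq2[of y x] by (auto simp: ct_def norm_minus_commute)
  have S2: "(norm (?S x))\<^sup>2 \<le> V\<^sup>2" if "norm x \<le> real n" for x
    using V(2)[of \<tau> x] that by (intro power_mono) auto
  have gV: "g x \<le> V\<^sup>2" for x
  proof (cases "norm x \<le> real n")
    case True
    have "g x \<le> 1 * V\<^sup>2" unfolding g_def using ct S2[OF True] by (intro mult_mono) auto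
    then show ?thesis by simp
  qed (use ct(3)[of x] in \<open>simp add: g_def\<close>)
  \<comment> \<open>By the product rule the squared norm contributes \<open>2 * V\<^sup>2\<close>
    and the cut-off \<open>V\<^sup>2\<close>.\<close>
  have lip_in: "\<bar>g x - g y\<bar> \<le> 3 * V\<^sup>2 * norm (x - y)" if "norm x \<le> real n" "norm y \<le> real n" for x y
  proof -
    have "(norm (?S x))\<^sup>2 - (norm (?S y))\<^sup>2 = (norm (?S x) - norm (?S y)) * (norm (?S x) + norm (?S y))"
      by (simp add: power2_eq_square algebra_simps)
    moreover have "\<bar>norm (?S x) - norm (?S y)\<bar> \<le> V * norm (x - y)"
      using norm_triangle_ineq3[of "?S x" "?S y"] V(3)[of \<tau> x y] that by simp
    moreover have "\<bar>norm (?S x) + norm (?S y)\<bar> \<le> 2 * V" using V(2)[of \<tau> x] V(2)[of \<tau> y] that by simp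
    ultimately have 1: "\<bar>(norm (?S x))\<^sup>2 - (norm (?S y))\<^sup>2\<bar> \<le> V * norm (x - y) * (2 * V)"
      unfolding abs_mult using V(1) by (simp only: abs_mult) (intro mult_mono, auto)
    have "g x - g y = ct x * ((norm (?S x))\<^sup>2 - (norm (?S y))\<^sup>2) + (ct x - ct y) * (norm (?S y))\<^sup>2"
      by (simp add: g_def algebra_simps)
    then have "\<bar>g x - g y\<bar> \<le> \<bar>ct x\<bar> * \<bar>(norm (?S x))\<^sup>2 - (norm (?S y))\<^sup>2\<bar> + \<bar>ct x - ct y\<bar> * (norm (?S y))\<^sup>2"
      by (metis abs_mult abs_power2 abs_triangle_ineq)
    also have "\<dots> \<le> 1 * (V * norm (x - y) * (2 * V)) + norm (x - y) * V\<^sup>2"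
      using ct[of x] 1 ctL[of x y] S2[OF that(2)] by (intro add_mono mult_mono) auto
    also have "\<dots> = 3 * V\<^sup>2 * norm (x - y)" by (simp add: power2_eq_square)
    finally show ?thesis .
  qed
  have lip_out: "\<bar>g x - g y\<bar> \<le> 3 * V\<^sup>2 * norm (x - y)" if "norm x \<le> real n" "norm y > real n" for x y
  proof -
    have gy: "g y = 0" using ct(3)[of y] that by (simp add: g_def)
    have "\<bar>g x - g y\<bar> = ct x * (norm (?S x))\<^sup>2" unfolding gy using ct(1)[of x] by (simp add: g_def)
    also have "\<dots> \<le> norm (x - y) * V\<^sup>2"
      using ctL[of x y] ct(3)[of y] that S2[OF that(1)] by (intro mult_mono) auto
    also have "\<dots> \<le> 3 * V\<^sup>2 * norm (x - y)" by simp
    finally show ?thesis .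
  qed
  show ?thesis
  proof (rule that[of g "V\<^sup>2" "3 * V\<^sup>2"])
    show "\<bar>g x - g y\<bar> \<le> 3 * V\<^sup>2 * norm (x - y)" for x y
    proof (cases "norm x \<le> real n"; cases "norm y \<le> real n")
      assume "norm x \<le> real n" "norm y \<le> real n" then show ?thesis by (rule lip_in)
    next
      assume "norm x \<le> real n" "\<not> norm y \<le> real n" then show ?thesis by (intro lip_out) auto
    next
      assume "\<not> norm x \<le> real n" "norm y \<le> real n"
      then show ?thesis using lip_out[of y x] by (simp add: norm_minus_commute abs_minus_commute)
    next
      assume "\<not> norm x \<le> real n" "\<not> norm y \<le> real n"
      then show ?thesis using ct(3)[of x] ct(3)[of y] by (simp add: g_def)
    qed
    show "0 \<le> g x" for x using ct by (simp add: g_def)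
    show "g x \<le> V\<^sup>2" for x by (rule gV)
    show "g x = 0" if "norm x > real n" for x using ct(3)[of x] that by (simp add: g_def)
    show "g x \<le> (norm (?S x))\<^sup>2" for x
      using mult_right_mono[OF ct(2)[of x], of "(norm (?S x))\<^sup>2"] by (simp add: g_def)
    show "g x = (norm (?S x))\<^sup>2" if "norm x + 1 \<le> real n" for x
      using that by (simp add: g_def ct_def)
  qed
qed

lemma flow_measurable:
  assumes "0 < s0" "s0 \<le> T" and Y: "\<And>z. heat_traj s0 T (Y z)" "\<And>z. Y z T = z" and "t \<in> {s0..T}"
  shows "(\<lambda>z. Y z t) \<in> borel_measurable borel"
proof (rule borel_measurable_continuous_onI)
  have "continuous_on UNIV (\<lambda>z::'a. (t, z))" "range (\<lambda>z::'a. (t, z)) \<subseteq> {s0..T} \<times> UNIV"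
    using assms(5) by (auto intro!: continuous_intros)
  from continuous_on_compose2[OF continuous_on_flow[OF assms(1-4)] this]
  show "continuous_on UNIV (\<lambda>z. Y z t)" by simp
qed

lemma flow_displacement_le:
  assumes "0 < s0" "s0 < T" "heat_traj s0 T y"
  shows "(norm (y T - y s0))\<^sup>2 \<le> (T - s0) / 4 * integral {s0..T} (\<lambda>t. (norm (hscore t (y t)))\<^sup>2)"
proof -
  have cont: "continuous_on {s0..T} y" and
    d: "\<And>s. s \<in> {s0<..<T} \<Longrightarrow> (y has_vector_derivative (- 1 / 2) *\<^sub>R hscore s (y s)) (at s)"
    using assms(3) by (auto simp: heat_traj_def)
  have "continuous_on {s0..T} (\<lambda>t. (t, y t))" by (intro continuous_intros cont)
  then have contS: "continuous_on {s0..T} (\<lambda>t. hscore t (y t))"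
    using continuous_on_compose2[OF continuous_on_hscore[OF assms(1), of T], of "{s0..T}" "\<lambda>t. (t, y t)"] by auto
  define A where "A = integral {s0..T} (\<lambda>t. (norm (hscore t (y t)))\<^sup>2)"
  have intA: "(\<lambda>t. (norm (hscore t (y t)))\<^sup>2) integrable_on {s0..T}"
    by (intro integrable_continuous_real continuous_intros contS)
  have A0: "A \<ge> 0" unfolding A_def by (rule integral_nonneg[OF intA]) simp
  define N where "N = norm (y T - y s0)"
  show ?thesis
  proof (cases "N = 0")
    case True
    then show ?thesis using A0 assms by (simp add: N_def A_def)
  next
    case False
    then have N: "N > 0" by (simp add: N_def)
    \<comment> \<open>Projecting on the direction of the displacement makes the integrand scalar.
      The weight \<open>l\<close> is chosen so that the constant part of the bound integrates to
      \<open>N / 2\<close>, half of the left side.\<close>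
    define u where "u = (1 / N) *\<^sub>R (y T - y s0)"
    define l where "l = 2 * N / (T - s0)"
    have l: "l > 0" using N assms by (simp add: l_def)
    have u: "norm u = 1" using N by (simp add: u_def N_def)
    have "((\<lambda>t. u \<bullet> ((- 1 / 2) *\<^sub>R hscore t (y t))) has_integral (u \<bullet> y T - u \<bullet> y s0)) {s0..T}"
    proof (rule fundamental_theorem_of_calculus_interior)
      show "continuous_on {s0..T} (\<lambda>t. u \<bullet> y t)" by (intro continuous_intros cont)
      show "((\<lambda>t. u \<bullet> y t) has_vector_derivative u \<bullet> ((- 1 / 2) *\<^sub>R hscore x (y x))) (at x)" if "x \<in> {s0<..<T}" for x
        using bounded_linear.has_vector_derivative[OF bounded_linear_inner_right d[OF that]] .
    qed (use assms in simp)
    then have "u \<bullet> y T - u \<bullet> y s0 = integral {s0..T} (\<lambda>t. u \<bullet> ((- 1 / 2) *\<^sub>R hscore t (y t)))"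
      by (rule integral_unique[symmetric])
    also have "\<dots> \<le> integral {s0..T} (\<lambda>t. l / 4 + 1 / (4 * l) * (norm (hscore t (y t)))\<^sup>2)"
    proof (rule integral_le)
      show "(\<lambda>t. u \<bullet> ((- 1 / 2) *\<^sub>R hscore t (y t))) integrable_on {s0..T}"
        by (intro integrable_continuous_real continuous_intros contS)
      show "(\<lambda>t. l / 4 + 1 / (4 * l) * (norm (hscore t (y t)))\<^sup>2) integrable_on {s0..T}"
        by (intro integrable_continuous_real continuous_intros contS)
      fix t
      let ?n = "norm (hscore t (y t))"
      have "u \<bullet> ((- 1 / 2) *\<^sub>R hscore t (y t)) \<le> norm u * norm ((- 1 / 2) *\<^sub>R hscore t (y t))"
        by (rule norm_cauchy_schwarz)
      also have "\<dots> = ?n / 2" by (simp add: u)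
      also have "?n / 2 \<le> l / 4 + 1 / (4 * l) * ?n\<^sup>2"
      proof -
        have "0 \<le> (l - ?n)\<^sup>2 / (4 * l)" using l by simp
        also have "\<dots> = l / 4 + 1 / (4 * l) * ?n\<^sup>2 - ?n / 2"
          using l by (simp add: field_simps power2_eq_square)
        finally show ?thesis by simp
      qed
      finally show "u \<bullet> ((- 1 / 2) *\<^sub>R hscore t (y t)) \<le> l / 4 + 1 / (4 * l) * ?n\<^sup>2" .
    qed
    also have "\<dots> = (T - s0) * (l / 4) + 1 / (4 * l) * A"
    proof -
      have "((\<lambda>t. l / 4 + 1 / (4 * l) * (norm (hscore t (y t)))\<^sup>2) has_integral ((T - s0) * (l / 4) + 1 / (4 * l) * A)) {s0..T}"
        using has_integral_const_real[of "l / 4" s0 T] assms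
        by (intro has_integral_add has_integral_mult_right) (auto simp: A_def intA integrable_integral)
      then show ?thesis by (rule integral_unique)
    qed
    also have "u \<bullet> y T - u \<bullet> y s0 = N"
    proof -
      have "u \<bullet> y T - u \<bullet> y s0 = (1 / N) * ((y T - y s0) \<bullet> (y T - y s0))" by (simp add: u_def inner_diff_right diff_divide_distrib)
      also have "\<dots> = (1 / N) * N\<^sup>2" by (simp add: N_def power2_norm_eq_inner)
      finally show ?thesis using N by (simp add: power2_eq_square)
    qed
    also have "(T - s0) * (l / 4) + 1 / (4 * l) * A = N / 2 + (T - s0) * A / (8 * N)"
      using assms N by (simp add: l_def field_simps)
    finally have "N / 2 \<le> (T - s0) * A / (8 * N)" by linarith
    then have "N\<^sup>2 \<le> (T - s0) / 4 * A" using N by (simp add: field_simps power2_eq_square)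
    then show ?thesis by (simp add: N_def A_def)
  qed
qed

end

section \<open>Mean squared displacement of the flow\<close>

context fisher_density
begin

text \<open>Here transport enters: a truncation of the squared score at time \<open>s0\<close>,
  evaluated along the flow, is moved to an integral against \<open>heat p s0\<close>, where it is
  bounded by the Fisher information at that time and hence by that of \<open>p\<close>. Fatou's
  lemma removes the truncation.\<close>

lemma flow_hscore_le_fisher:
  assumes s0: "0 < s0" "s0 \<le> T"
    and Y: "\<And>r z. s0 \<le> r \<Longrightarrow> r \<le> T \<Longrightarrow> heat_traj s0 r (Y r z)" "\<And>r z. s0 \<le> r \<Longrightarrow> r \<le> T \<Longrightarrow> Y r z r = z"
  shows "(\<integral>\<^sup>+z. ennreal (heat p T z * (norm (hscore s0 (Y T z s0)))\<^sup>2) \<partial>lborel) \<le> ennreal fisher"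
proof -
  let ?S = "\<lambda>x. (norm (hscore s0 x))\<^sup>2"
  have T: "T > 0" using s0 by simp
  note [measurable] = heat_measurable[OF T] heat_measurable[OF s0(1)]
  have "\<exists>g. (\<exists>L B. (\<forall>x. 0 \<le> g x) \<and> (\<forall>x. g x \<le> B) \<and> (\<forall>x y. \<bar>g x - g y\<bar> \<le> L * norm (x - y))
      \<and> (\<forall>x. norm x > real n \<longrightarrow> g x = 0) \<and> (\<forall>x. g x \<le> ?S x) \<and> (\<forall>x. norm x + 1 \<le> real n \<longrightarrow> g x = ?S x))" for n
    using hscore_truncation[OF s0(1), of n] by metis
  then obtain g where g: "\<And>n. \<exists>L B. (\<forall>x. 0 \<le> g n x) \<and> (\<forall>x. g n x \<le> B) \<and> (\<forall>x y. \<bar>g n x - g n y\<bar> \<le> L * norm (x - y))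
      \<and> (\<forall>x. norm x > real n \<longrightarrow> g n x = 0) \<and> (\<forall>x. g n x \<le> ?S x) \<and> (\<forall>x. norm x + 1 \<le> real n \<longrightarrow> g n x = ?S x)"
    by metis
  have [measurable]: "(\<lambda>z. Y T z s0) \<in> borel_measurable borel"
    by (rule flow_measurable[OF s0]) (use Y s0 in auto)
  have gm[measurable]: "g n \<in> borel_measurable borel" for n
  proof -
    obtain L where "\<forall>x y. \<bar>g n x - g n y\<bar> \<le> L * norm (x - y)" using g[of n] by blast
    then have "continuous_on UNIV (g n)" by (intro continuous_on_of_lipschitz[of _ L]) blast
    then show ?thesis by (rule borel_measurable_continuous_onI)
  qed
  show ?thesis
  proof (rule nn_integral_le_of_tendsto[where u="\<lambda>n z. ennreal (heat p T z * g n (Y T z s0))"])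
    show "(\<lambda>z. ennreal (heat p T z * g n (Y T z s0))) \<in> borel_measurable lborel" for n by measurable
    show "(\<lambda>n. ennreal (heat p T z * g n (Y T z s0))) \<longlonglongrightarrow> ennreal (heat p T z * ?S (Y T z s0))" for z
    proof (rule tendsto_eventually)
      obtain N :: nat where "norm (Y T z s0) + 1 \<le> real N" using real_arch_simple by blast
      then have "\<forall>n\<ge>N. norm (Y T z s0) + 1 \<le> real n" by (meson of_nat_mono order_trans)
      then have "\<forall>n\<ge>N. g n (Y T z s0) = ?S (Y T z s0)" using g by blast
      then show "eventually (\<lambda>n. ennreal (heat p T z * g n (Y T z s0)) = ennreal (heat p T z * ?S (Y T z s0))) sequentially"
        unfolding eventually_sequentially by (intro exI[of _ N]) simp
    qed
    fix n
    obtain L B where gn: "\<And>x. 0 \<le> g n x" "\<And>x. g n x \<le> B" "\<And>x y. \<bar>g n x - g n y\<bar> \<le> L * norm (x - y)"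
      "\<And>x. norm x > real n \<Longrightarrow> g n x = 0" "\<And>x. g n x \<le> ?S x" using g[of n] by blast
    have gb: "\<bar>g n x\<bar> \<le> B" for x using gn(1,2)[of x] by simp
    have "(\<integral>\<^sup>+z. ennreal (heat p T z * g n (Y T z s0)) \<partial>lborel) = ennreal (\<integral>z. heat p T z * g n (Y T z s0) \<partial>lborel)"
      by (rule nn_integral_eq_integral)
        (use gb in \<open>auto intro!: integrable_heat_mult_bounded[OF T] simp: gn(1) less_imp_le[OF heat_pos[OF T]]\<close>)
    also have "\<dots> \<le> ennreal (\<integral>z. heat p s0 z * g n z \<partial>lborel)"
      by (intro ennreal_leI flow_transport_le[OF s0 Y gn(1-4)]) auto
    also have "\<dots> = (\<integral>\<^sup>+z. ennreal (heat p s0 z * g n z) \<partial>lborel)"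
      by (rule nn_integral_eq_integral[symmetric])
        (use gb in \<open>auto intro!: integrable_heat_mult_bounded[OF s0(1)] simp: gn(1) less_imp_le[OF heat_pos[OF s0(1)]]\<close>)
    also have "\<dots> \<le> (\<integral>\<^sup>+z. ennreal (heat p s0 z * ?S z) \<partial>lborel)"
      using heat_pos[OF s0(1)] by (intro nn_integral_mono ennreal_leI mult_left_mono gn less_imp_le)
    also have "\<dots> \<le> ennreal fisher" by (rule nn_integral_hscore_le_fisher[OF s0(1)])
    finally show "(\<integral>\<^sup>+z. ennreal (heat p T z * g n (Y T z s0)) \<partial>lborel) \<le> ennreal fisher" .
  qed
qed

lemma flow_displacement_L2_interior:
  assumes s0: "0 < s0" "s0 < T"
    and Y: "\<And>r z. s0 \<le> r \<Longrightarrow> r \<le> T \<Longrightarrow> heat_traj s0 r (Y r z)" "\<And>r z. s0 \<le> r \<Longrightarrow> r \<le> T \<Longrightarrow> Y r z r = z"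
  shows "(\<integral>\<^sup>+z. ennreal (heat p T z * (norm (Y T z s0 - z))\<^sup>2) \<partial>lborel) \<le> ennreal (T\<^sup>2 / 4 * fisher)"
proof -
  have T: "T > 0" using s0 by simp
  note [measurable] = heat_measurable[OF T]
  define \<Phi> where "\<Phi> t z = indicator {s0..T} t * (norm (hscore t (Y T z t)))\<^sup>2" for t z
  have cont: "continuous_on ({s0..T} \<times> UNIV) (\<lambda>(t, z). (norm (hscore t (Y T z t)))\<^sup>2)"
  proof -
    have "continuous_on ({s0..T} \<times> UNIV) (\<lambda>(t, z). Y T z t)"
      by (rule continuous_on_flow) (use s0 Y in auto)
    then have "continuous_on ({s0..T} \<times> UNIV) (\<lambda>x. (fst x, Y T (snd x) (fst x)))"
      by (auto intro!: continuous_intros simp: case_prod_beta)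
    moreover have "(\<lambda>x. (fst x, Y T (snd x) (fst x))) ` ({s0..T} \<times> UNIV) \<subseteq> {s0..T} \<times> UNIV" by auto
    ultimately have "continuous_on ({s0..T} \<times> UNIV) (\<lambda>x. hscore (fst x) (Y T (snd x) (fst x)))"
      using continuous_on_compose2[OF continuous_on_hscore[OF s0(1), of T]] by fastforce
    then show ?thesis by (auto intro!: continuous_intros simp: case_prod_beta)
  qed
  have m\<Phi>[measurable]: "(\<lambda>x. \<Phi> (fst x) (snd x)) \<in> borel_measurable (borel \<Otimes>\<^sub>M borel)"
  proof -
    have "(\<lambda>x. indicator ({s0..T} \<times> UNIV) x *\<^sub>R (\<lambda>(t, z). (norm (hscore t (Y T z t)))\<^sup>2) x) \<in> borel_measurable borel"
      using cont by (intro borel_measurable_continuous_on_indicator) (auto intro!: borel_closed closed_Times)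
    moreover have "(\<lambda>x. indicator ({s0..T} \<times> UNIV) x *\<^sub>R (\<lambda>(t, z). (norm (hscore t (Y T z t)))\<^sup>2) x) = (\<lambda>x. \<Phi> (fst x) (snd x))"
      by (auto simp: \<Phi>_def indicator_def case_prod_beta mem_Times_iff fun_eq_iff)
    ultimately show ?thesis by (simp add: borel_prod)
  qed
  have jm: "(\<lambda>(z, t). ennreal (heat p T z * \<Phi> t z)) \<in> borel_measurable (lborel \<Otimes>\<^sub>M lborel)"
  proof -
    have "(\<lambda>x. \<Phi> (fst (snd x, fst x)) (snd (snd x, fst x))) \<in> borel_measurable (borel \<Otimes>\<^sub>M borel)"
      by (rule measurable_compose[OF _ m\<Phi>]) measurable
    moreover have "(\<lambda>x. heat p T (fst x)) \<in> borel_measurable (borel \<Otimes>\<^sub>M borel)"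
      by (rule measurable_compose[OF measurable_fst heat_measurable[OF T]])
    ultimately have "(\<lambda>x. ennreal (heat p T (fst x) * \<Phi> (snd x) (fst x))) \<in> borel_measurable (borel \<Otimes>\<^sub>M borel)"
      by simp
    then show ?thesis by (simp add: case_prod_beta cong: measurable_cong_sets sets_pair_measure_cong)
  qed
  have contz: "continuous_on {s0..T} (\<lambda>t. (norm (hscore t (Y T z t)))\<^sup>2)" for z
  proof -
    have "continuous_on {s0..T} (\<lambda>t. (t, z))" "(\<lambda>t. (t, z)) ` {s0..T} \<subseteq> {s0..T} \<times> UNIV" by (auto intro!: continuous_intros)
    from continuous_on_compose2[OF cont this] show ?thesis by simp
  qed
  have slice: "ennreal (integral {s0..T} (\<lambda>t. (norm (hscore t (Y T z t)))\<^sup>2)) = (\<integral>\<^sup>+t. ennreal (\<Phi> t z) \<partial>lborel)" for z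
  proof -
    from contz[of z] have si: "set_integrable lborel {s0..T} (\<lambda>t. (norm (hscore t (Y T z t)))\<^sup>2)"
      by (rule borel_integrable_atLeastAtMost')
    have "integral {s0..T} (\<lambda>t. (norm (hscore t (Y T z t)))\<^sup>2) = (\<integral>t. \<Phi> t z \<partial>lborel)"
      using set_borel_integral_eq_integral(2)[OF si] by (simp add: set_lebesgue_integral_def \<Phi>_def)
    moreover have "integrable lborel (\<lambda>t. \<Phi> t z)" using si by (simp add: set_integrable_def \<Phi>_def)
    ultimately show ?thesis
      by (simp add: nn_integral_eq_integral \<Phi>_def)
  qed
  have "(\<integral>\<^sup>+z. ennreal (heat p T z * (norm (Y T z s0 - z))\<^sup>2) \<partial>lborel)
      \<le> (\<integral>\<^sup>+z. ennreal ((T - s0) / 4) * (\<integral>\<^sup>+t. ennreal (heat p T z * \<Phi> t z) \<partial>lborel) \<partial>lborel)"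
  proof (rule nn_integral_mono)
    fix z
    let ?I = "integral {s0..T} (\<lambda>t. (norm (hscore t (Y T z t)))\<^sup>2)"
    have "(\<lambda>t. \<Phi> (fst (t, z)) (snd (t, z))) \<in> borel_measurable borel" by (rule measurable_compose[OF _ m\<Phi>]) measurable
    then have mz: "(\<lambda>t. ennreal (\<Phi> t z)) \<in> borel_measurable lborel" by simp
    have "(norm (Y T z s0 - z))\<^sup>2 \<le> (T - s0) / 4 * ?I"
      using flow_displacement_le[OF s0 Y(1)[of T z]] Y(2)[of T z] s0 by (simp add: norm_minus_commute)
    then have "ennreal (heat p T z * (norm (Y T z s0 - z))\<^sup>2) \<le> ennreal (heat p T z * ((T - s0) / 4 * ?I))"
      using heat_pos[OF T, of z] by (intro ennreal_leI mult_left_mono) auto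
    also have "\<dots> = ennreal ((T - s0) / 4) * (ennreal (heat p T z) * ennreal ?I)"
    proof -
      have "?I \<ge> 0" by (rule integral_nonneg[OF integrable_continuous_real[OF contz]]) simp
      then show ?thesis using s0 heat_pos[OF T, of z] by (simp add: ennreal_mult[symmetric] mult_ac)
    qed
    also have "ennreal (heat p T z) * ennreal ?I = (\<integral>\<^sup>+t. ennreal (heat p T z * \<Phi> t z) \<partial>lborel)"
      unfolding slice using heat_pos[OF T, of z] mz
      by (subst nn_integral_cmult[symmetric]) (auto simp: ennreal_mult \<Phi>_def)
    finally show "ennreal (heat p T z * (norm (Y T z s0 - z))\<^sup>2) \<le> ennreal ((T - s0) / 4) * (\<integral>\<^sup>+t. ennreal (heat p T z * \<Phi> t z) \<partial>lborel)" .
  qed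
  also have "\<dots> = ennreal ((T - s0) / 4) * (\<integral>\<^sup>+z. \<integral>\<^sup>+t. ennreal (heat p T z * \<Phi> t z) \<partial>lborel \<partial>lborel)"
    by (rule nn_integral_cmult[OF lborel.borel_measurable_nn_integral[OF jm]])
  also have "(\<integral>\<^sup>+z. \<integral>\<^sup>+t. ennreal (heat p T z * \<Phi> t z) \<partial>lborel \<partial>lborel) = (\<integral>\<^sup>+t. \<integral>\<^sup>+z. ennreal (heat p T z * \<Phi> t z) \<partial>lborel \<partial>lborel)"
    by (rule lborel_pair.Fubini'[OF jm, symmetric])
  also have "\<dots> \<le> (\<integral>\<^sup>+t. ennreal fisher * indicator {s0..T} t \<partial>lborel)"
  proof (rule nn_integral_mono)
    fix t
    show "(\<integral>\<^sup>+z. ennreal (heat p T z * \<Phi> t z) \<partial>lborel) \<le> ennreal fisher * indicator {s0..T} t"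
    proof (cases "t \<in> {s0..T}")
      case True
      \<comment> \<open>The previous lemma is applied with the intermediate time \<open>t\<close> in
        the role of its starting time.\<close>
      have "(\<integral>\<^sup>+z. ennreal (heat p T z * (norm (hscore t (Y T z t)))\<^sup>2) \<partial>lborel) \<le> ennreal fisher"
        by (rule flow_hscore_le_fisher) (use True s0 Y heat_traj_subset[OF Y(1)] in auto)
      then show ?thesis using True by (simp add: \<Phi>_def)
    qed (simp add: \<Phi>_def)
  qed
  also have "\<dots> = ennreal fisher * ennreal (T - s0)"
    using s0 by (simp add: nn_integral_cmult)
  finally have "(\<integral>\<^sup>+z. ennreal (heat p T z * (norm (Y T z s0 - z))\<^sup>2) \<partial>lborel)
     \<le> ennreal ((T - s0) / 4) * (ennreal fisher * ennreal (T - s0))"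
    by (simp add: mult_left_mono)
  also have "\<dots> = ennreal ((T - s0)\<^sup>2 / 4 * fisher)"
    using s0 fisher_nonneg by (simp add: ennreal_mult[symmetric] power2_eq_square mult_ac)
  also have "\<dots> \<le> ennreal (T\<^sup>2 / 4 * fisher)"
    using s0 fisher_nonneg by (intro ennreal_leI mult_right_mono divide_right_mono power_mono) auto
  finally show ?thesis .
qed

text \<open>The local bounds on the score do not reach time 0, so the flow is stopped at times
  \<open>s n\<close> that tend to 0. Continuity of trajectories at 0 gives the pointwise limit,
  which also yields measurability of the reconstruction, and Fatou's lemma passes the bound
  on.\<close>

lemma flow_displacement_L2:
  assumes T: "0 < T"
    and Y: "\<And>r z. 0 < r \<Longrightarrow> r \<le> T \<Longrightarrow> heat_traj 0 r (Y r z)" "\<And>r z. 0 < r \<Longrightarrow> r \<le> T \<Longrightarrow> Y r z r = z"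
  shows "(\<lambda>z. Y T z 0) \<in> borel_measurable borel"
    and "(\<integral>\<^sup>+z. ennreal (heat p T z * (norm (Y T z 0 - z))\<^sup>2) \<partial>lborel) \<le> ennreal (T\<^sup>2 / 4 * fisher)"
proof -
  note [measurable] = heat_measurable[OF T]
  \<comment> \<open>The denominator is at least 2, so every \<open>s n\<close> lies strictly below
    \<open>T\<close>, as the interior estimate demands.\<close>
  define s where "s n = T / real (n + 2)" for n
  have s: "0 < s n" "s n < T" for n
  proof -
    show "0 < s n" using T by (simp add: s_def)
    have "T * 1 < T * real (n + 2)" using T by (intro mult_strict_left_mono) auto
    then show "s n < T" by (simp add: s_def divide_less_eq)
  qed
  have s_lim: "s \<longlonglongrightarrow> 0" unfolding s_def
    by (intro real_tendsto_divide_at_top[OF tendsto_const] filterlim_compose[OF filterlim_real_sequentially] filterlim_add_const_nat_at_top)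
  have sub: "heat_traj (s n) r (Y r z)" if "s n \<le> r" "r \<le> T" for n r z
    using Y(1)[of r z] that s[of n] by (auto elim: heat_traj_subset)
  have m[measurable]: "(\<lambda>z. Y T z (s n)) \<in> borel_measurable borel" for n
    by (rule flow_measurable[of "s n" T "Y T" "s n"]) (use s[of n] sub Y(2)[OF T] T in auto)
  have lim: "(\<lambda>n. Y T z (s n)) \<longlonglongrightarrow> Y T z 0" for z
  proof -
    have "continuous_on {0..T} (Y T z)" using Y(1)[OF T order_refl] by (simp add: heat_traj_def)
    then show ?thesis
      by (rule continuous_on_tendsto_compose[OF _ s_lim]) (use s T in \<open>auto intro!: always_eventually less_imp_le\<close>)
  qed
  show "(\<lambda>z. Y T z 0) \<in> borel_measurable borel"
    by (rule borel_measurable_LIMSEQ_metric[OF m]) (rule lim)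
  show "(\<integral>\<^sup>+z. ennreal (heat p T z * (norm (Y T z 0 - z))\<^sup>2) \<partial>lborel) \<le> ennreal (T\<^sup>2 / 4 * fisher)"
  proof (rule nn_integral_le_of_tendsto[where u="\<lambda>n z. ennreal (heat p T z * (norm (Y T z (s n) - z))\<^sup>2)"])
    show "(\<lambda>z. ennreal (heat p T z * (norm (Y T z (s n) - z))\<^sup>2)) \<in> borel_measurable lborel" for n by measurable
    show "(\<lambda>n. ennreal (heat p T z * (norm (Y T z (s n) - z))\<^sup>2)) \<longlonglongrightarrow> ennreal (heat p T z * (norm (Y T z 0 - z))\<^sup>2)" for z
      by (intro tendsto_intros lim)
    show "(\<integral>\<^sup>+z. ennreal (heat p T z * (norm (Y T z (s n) - z))\<^sup>2) \<partial>lborel) \<le> ennreal (T\<^sup>2 / 4 * fisher)" for n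
      by (rule flow_displacement_L2_interior[OF s]) (use sub Y(2) s(1)[of n] in \<open>auto intro: less_le_trans\<close>)
  qed
qed

end

section \<open>Reconstruction errors in heat coordinates\<close>

text \<open>The cross term is split by Young's inequality. The free weight \<epsilon> becomes the
  square root of the heat time in the final limit.\<close>

lemma norm_diff_squared_perturbation:
  fixes u v w :: "'b::real_normed_vector"
  assumes "\<epsilon> > 0"
  shows "\<bar>(norm (u - w))\<^sup>2 - (norm (v - w))\<^sup>2\<bar> \<le> (1 + 1 / \<epsilon>) * (norm (u - v))\<^sup>2 + \<epsilon> * (norm (v - w))\<^sup>2"
proof -
  let ?a = "norm (u - w)" and ?b = "norm (v - w)" and ?c = "norm (u - v)"
  have d: "\<bar>?a - ?b\<bar> \<le> ?c" using norm_triangle_ineq3[of "u - w" "v - w"] by simp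
  have "\<bar>?a\<^sup>2 - ?b\<^sup>2\<bar> = \<bar>?a - ?b\<bar> * (?a + ?b)"
    by (simp add: power2_eq_square square_diff_square_factored abs_mult mult.commute)
  also have "\<dots> \<le> ?c * (?c + 2 * ?b)" using d by (intro mult_mono) auto
  also have "\<dots> = ?c\<^sup>2 + 2 * ?c * ?b" by (simp add: power2_eq_square algebra_simps)
  also have "2 * ?c * ?b \<le> 1 / \<epsilon> * ?c\<^sup>2 + \<epsilon> * ?b\<^sup>2"
  proof -
    have "0 \<le> (?c - \<epsilon> * ?b)\<^sup>2 / \<epsilon>" using assms by simp
    also have "\<dots> = 1 / \<epsilon> * ?c\<^sup>2 + \<epsilon> * ?b\<^sup>2 - 2 * ?c * ?b"
      using assms by (simp add: field_simps power2_eq_square)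
    finally show ?thesis by simp
  qed
  finally show ?thesis by (simp add: algebra_simps)
qed

context prob_density
begin

lemma noise_second_moment:
  assumes "\<tau> > 0"
  shows "integrable (lborel \<Otimes>\<^sub>M lborel) (\<lambda>(x, y). p x * hk \<tau> (y - x) * (norm (y - x))\<^sup>2)"
    and "(\<integral>w. (\<lambda>(x, y). p x * hk \<tau> (y - x) * (norm (y - x))\<^sup>2) w \<partial>(lborel \<Otimes>\<^sub>M lborel)) = real DIM('a) * \<tau>"
proof -
  let ?f = "\<lambda>(x, y). p x * hk \<tau> (y - x) * (norm (y - x))\<^sup>2"
  have nn: "?f w \<ge> 0" for w by (auto simp: p_nonneg hk_nonneg case_prod_beta)
  have "(\<integral>\<^sup>+w. ennreal (?f w) \<partial>(lborel \<Otimes>\<^sub>M lborel)) = (\<integral>\<^sup>+x. \<integral>\<^sup>+y. ennreal (?f (x, y)) \<partial>lborel \<partial>lborel)"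
    by (rule lborel.nn_integral_fst[symmetric]) measurable
  also have "\<dots> = (\<integral>\<^sup>+x. ennreal (p x) * ennreal (real DIM('a) * \<tau>) \<partial>lborel)"
  proof (rule nn_integral_cong)
    fix x
    have "(\<integral>\<^sup>+y. ennreal (?f (x, y)) \<partial>lborel) = (\<integral>\<^sup>+y. ennreal (p x) * ennreal (hk \<tau> (y + - x) * (norm (y + - x))\<^sup>2) \<partial>lborel)"
      by (simp add: ennreal_mult p_nonneg hk_nonneg mult.assoc)
    also have "\<dots> = ennreal (p x) * (\<integral>\<^sup>+y. ennreal (hk \<tau> (y + - x) * (norm (y + - x))\<^sup>2) \<partial>lborel)"
      by (rule nn_integral_cmult) measurable
    also have "(\<integral>\<^sup>+y. ennreal (hk \<tau> (y + - x) * (norm (y + - x))\<^sup>2) \<partial>lborel) = ennreal (real DIM('a) * \<tau>)"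
      by (subst nn_integral_lborel_translate[of "\<lambda>u. ennreal (hk \<tau> u * (norm u)\<^sup>2)"]) (auto simp: nn_integral_hk_norm2 assms)
    finally show "(\<integral>\<^sup>+y. ennreal (?f (x, y)) \<partial>lborel) = ennreal (p x) * ennreal (real DIM('a) * \<tau>)" .
  qed
  also have "\<dots> = ennreal (real DIM('a) * \<tau>)"
    by (simp add: nn_integral_multc nn_integral_p)
  finally have *: "(\<integral>\<^sup>+w. ennreal (?f w) \<partial>(lborel \<Otimes>\<^sub>M lborel)) = ennreal (real DIM('a) * \<tau>)" .
  show int: "integrable (lborel \<Otimes>\<^sub>M lborel) ?f"
    by (rule integrableI_nonneg) (use * nn in auto)
  show "(\<integral>w. ?f w \<partial>(lborel \<Otimes>\<^sub>M lborel)) = real DIM('a) * \<tau>"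
    using * assms nn by (subst integral_eq_nn_integral) auto
qed

text \<open>Returning the noisy value itself has mean squared error exactly
  \<open>real DIM('a) * \<tau>\<close>. Any \<open>H\<close> near the identity in mean square is
  compared with that choice, on the joint law of data and noisy value.\<close>

lemma reconstruction_error_perturbation:
  fixes H :: "'a \<Rightarrow> 'a"
  assumes \<tau>: "\<tau> > 0" and [measurable]: "H \<in> borel_measurable borel"
    and D: "(\<integral>\<^sup>+y. ennreal (heat p \<tau> y * (norm (H y - y))\<^sup>2) \<partial>lborel) \<le> ennreal D" "D \<ge> 0" and \<epsilon>: "\<epsilon> > 0"
  shows "\<bar>(\<integral>x. \<integral>y. p x * hk \<tau> (y - x) * (norm (H y - x))\<^sup>2 \<partial>lborel \<partial>lborel) - real DIM('a) * \<tau>\<bar>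
    \<le> (1 + 1 / \<epsilon>) * D + \<epsilon> * (real DIM('a) * \<tau>)"
proof -
  define f0 where "f0 = (\<lambda>(x::'a, y). p x * hk \<tau> (y - x) * (norm (y - x))\<^sup>2)"
  define f1 where "f1 = (\<lambda>(x::'a, y). p x * hk \<tau> (y - x) * (norm (H y - x))\<^sup>2)"
  define f2 where "f2 = (\<lambda>(x::'a, y). p x * hk \<tau> (y - x) * (norm (H y - y))\<^sup>2)"
  let ?M = "lborel \<Otimes>\<^sub>M lborel :: ('a \<times> 'a) measure"
  have [measurable]: "f1 \<in> borel_measurable ?M" "f2 \<in> borel_measurable ?M" unfolding f1_def f2_def by measurable
  have nn: "f0 w \<ge> 0" "f1 w \<ge> 0" "f2 w \<ge> 0" for w by (auto simp: f0_def f1_def f2_def p_nonneg hk_nonneg case_prod_beta)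
  have i0: "integrable ?M f0" "(\<integral>w. f0 w \<partial>?M) = real DIM('a) * \<tau>"
    unfolding f0_def by (rule noise_second_moment[OF \<tau>])+
  have n2: "(\<integral>\<^sup>+w. ennreal (f2 w) \<partial>?M) \<le> ennreal D"
  proof -
    have m2: "(\<lambda>w. ennreal (f2 w)) \<in> borel_measurable ?M" by measurable
    have "(\<integral>\<^sup>+w. ennreal (f2 w) \<partial>?M) = (\<integral>\<^sup>+y. \<integral>\<^sup>+x. ennreal (f2 (x, y)) \<partial>lborel \<partial>lborel)"
      by (rule lborel_pair.nn_integral_snd[symmetric]) (use m2 in simp)
    also have "\<dots> = (\<integral>\<^sup>+y. ennreal (heat p \<tau> y * (norm (H y - y))\<^sup>2) \<partial>lborel)"
    proof (rule nn_integral_cong)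
      fix y
      have "(\<integral>\<^sup>+x. ennreal (f2 (x, y)) \<partial>lborel) = (\<integral>\<^sup>+x. ennreal (p x * hk \<tau> (y - x)) * ennreal ((norm (H y - y))\<^sup>2) \<partial>lborel)"
        by (simp add: f2_def ennreal_mult p_nonneg hk_nonneg)
      also have "\<dots> = (\<integral>\<^sup>+x. ennreal (p x * hk \<tau> (y - x)) \<partial>lborel) * ennreal ((norm (H y - y))\<^sup>2)"
        by (rule nn_integral_multc) measurable
      also have "\<dots> = ennreal (heat p \<tau> y * (norm (H y - y))\<^sup>2)"
        using heat_pos[OF \<tau>, of y] by (simp add: ennreal_heat[OF \<tau>, symmetric] ennreal_mult)
      finally show "(\<integral>\<^sup>+x. ennreal (f2 (x, y)) \<partial>lborel) = ennreal (heat p \<tau> y * (norm (H y - y))\<^sup>2)" .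
    qed
    finally show ?thesis using D(1) by simp
  qed
  have i2: "integrable ?M f2"
    by (rule integrableI_nonneg) (use n2 nn in \<open>auto elim: le_less_trans\<close>)
  have b2: "(\<integral>w. f2 w \<partial>?M) \<le> D"
  proof -
    have "ennreal (\<integral>w. f2 w \<partial>?M) \<le> ennreal D" using n2 i2 nn by (subst nn_integral_eq_integral[symmetric]) auto
    then show ?thesis using D(2) by simp
  qed
  have pert: "\<bar>f1 w - f0 w\<bar> \<le> (1 + 1 / \<epsilon>) * f2 w + \<epsilon> * f0 w" for w
  proof -
    obtain x y where w: "w = (x, y)" by (cases w)
    have "\<bar>f1 w - f0 w\<bar> = p x * hk \<tau> (y - x) * \<bar>(norm (H y - x))\<^sup>2 - (norm (y - x))\<^sup>2\<bar>"
      by (simp add: w f1_def f0_def right_diff_distrib[symmetric] abs_mult p_nonneg hk_nonneg)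
    also have "\<dots> \<le> p x * hk \<tau> (y - x) * ((1 + 1 / \<epsilon>) * (norm (H y - y))\<^sup>2 + \<epsilon> * (norm (y - x))\<^sup>2)"
      by (intro mult_left_mono norm_diff_squared_perturbation \<epsilon>) (simp add: p_nonneg hk_nonneg)
    also have "\<dots> = (1 + 1 / \<epsilon>) * f2 w + \<epsilon> * f0 w"
      by (simp add: w f2_def f0_def distrib_left mult_ac)
    finally show ?thesis .
  qed
  have ib: "integrable ?M (\<lambda>w. (1 + 1 / \<epsilon>) * f2 w + \<epsilon> * f0 w)" using i0 i2 by simp
  have i1: "integrable ?M f1"
  proof -
    have m0: "f0 \<in> borel_measurable ?M" using i0 by auto
    have "integrable ?M (\<lambda>w. f1 w - f0 w)"
      by (rule Bochner_Integration.integrable_bound[OF ib]) (use m0 pert in \<open>auto intro!: AE_I2 order_trans[OF pert abs_ge_self]\<close>)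
    from Bochner_Integration.integrable_add[OF this i0(1)] show ?thesis by simp
  qed
  have "(\<integral>x. \<integral>y. p x * hk \<tau> (y - x) * (norm (H y - x))\<^sup>2 \<partial>lborel \<partial>lborel) = (\<integral>w. f1 w \<partial>?M)"
    using lborel_pair.integral_fst'[OF i1] by (simp add: f1_def)
  then have "\<bar>(\<integral>x. \<integral>y. p x * hk \<tau> (y - x) * (norm (H y - x))\<^sup>2 \<partial>lborel \<partial>lborel) - real DIM('a) * \<tau>\<bar>
      = \<bar>\<integral>w. f1 w - f0 w \<partial>?M\<bar>"
    using i0 i1 by simp
  also have "\<dots> \<le> (\<integral>w. (1 + 1 / \<epsilon>) * f2 w + \<epsilon> * f0 w \<partial>?M)"
    by (rule Bochner_Integration.integral_abs_bound_integral) (use i0 i1 ib pert in auto)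
  also have "\<dots> = (1 + 1 / \<epsilon>) * (\<integral>w. f2 w \<partial>?M) + \<epsilon> * (real DIM('a) * \<tau>)"
    using i0 i2 by simp
  also have "\<dots> \<le> (1 + 1 / \<epsilon>) * D + \<epsilon> * (real DIM('a) * \<tau>)"
    using b2 \<epsilon> by (intro add_right_mono mult_left_mono) auto
  finally show ?thesis .
qed

lemma integrable_p_hk_norm2:
  assumes "\<tau> > 0"
  shows "integrable lborel (\<lambda>x. p x * hk \<tau> (y - x) * (norm (x - y))\<^sup>2)"
proof -
  obtain K where K: "\<And>\<tau>' u. \<tau>' \<in> {\<tau>..\<tau>} \<Longrightarrow> hk \<tau>' (u::'a) * (1 + norm u)\<^sup>2 \<le> K"
    using hk_poly_bound[OF assms, of \<tau>] by metis
  have "norm (hk \<tau> u * (norm u)\<^sup>2) \<le> K" for u :: 'a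
  proof -
    have "hk \<tau> u * (norm u)\<^sup>2 \<le> hk \<tau> u * (1 + norm u)\<^sup>2"
      by (intro mult_left_mono power_mono) (auto simp: hk_nonneg)
    then show ?thesis using K[of \<tau> u] by (simp add: hk_nonneg)
  qed
  from integrable_conv_bounded[where k="\<lambda>u. hk \<tau> u * (norm u)\<^sup>2" and y=y, OF p_int _ this] show ?thesis
    by (simp add: mult.assoc norm_minus_commute)
qed

text \<open>Two independent draws from one law differ in mean square by twice its variance. The
  variance is the second moment about \<open>y\<close> minus the squared distance from
  \<open>y\<close> to the posterior mean, which is \<tau> times the score by Tweedie's formula; all
  is multiplied by \<open>heat p \<tau> y\<close>. In the proof \<open>m1\<close> and
  \<open>m2\<close> are the unnormalised moments of \<open>x - y\<close>.\<close>

lemma posterior_pair_error: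
  assumes \<tau>: "\<tau> > 0"
  shows "(\<integral>x. \<integral>x'. p x * hk \<tau> (y - x) * (p x' * hk \<tau> (y - x')) / heat p \<tau> y * (norm (x' - x))\<^sup>2 \<partial>lborel \<partial>lborel)
    = 2 * (\<integral>x. p x * hk \<tau> (y - x) * (norm (x - y))\<^sup>2 \<partial>lborel) - 2 * \<tau>\<^sup>2 * (heat p \<tau> y * (norm (hscore \<tau> y))\<^sup>2)"
proof -
  define w where "w x = p x * hk \<tau> (y - x)" for x
  let ?q = "heat p \<tau> y"
  define m1 where "m1 = \<tau> *\<^sub>R heat_grad p \<tau> y"
  define m2 where "m2 = (\<integral>x. w x * (norm (x - y))\<^sup>2 \<partial>lborel)"
  have q: "?q > 0" by (rule heat_pos[OF \<tau>])
  have h0: "has_bochner_integral lborel w ?q"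
    unfolding w_def heat_eq by (rule has_bochner_integral_integrable[OF integrable_p_hk[OF \<tau>]])
  have h1: "has_bochner_integral lborel (\<lambda>x. w x * ((x - y) \<bullet> e)) (m1 \<bullet> e)" for e
  proof -
    have "has_bochner_integral lborel (\<lambda>x. \<tau> *\<^sub>R (p x *\<^sub>R hk_grad \<tau> (y - x))) m1"
      unfolding m1_def heat_grad_def
      by (intro has_bochner_integral_scaleR_right has_bochner_integral_integrable integrable_p_hk_grad \<tau>)
    from has_bochner_integral_inner_left[OF this, of e] show ?thesis
      using \<tau> by (simp add: w_def hk_grad_def inner_diff_left algebra_simps)
  qed
  have h2: "has_bochner_integral lborel (\<lambda>x. w x * (norm (x - y))\<^sup>2) m2"
    unfolding m2_def w_def by (rule has_bochner_integral_integrable[OF integrable_p_hk_norm2[OF \<tau>]])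
  have sq: "(norm (x' - x))\<^sup>2 = (norm (x' - y))\<^sup>2 + (norm (x - y))\<^sup>2 - 2 * ((x' - y) \<bullet> (x - y))" for x x'
    by (simp add: power2_norm_eq_inner inner_diff_left inner_diff_right inner_commute algebra_simps)
  have inner: "(\<integral>x'. w x * w x' / ?q * (norm (x' - x))\<^sup>2 \<partial>lborel) = w x / ?q * (m2 + (norm (x - y))\<^sup>2 * ?q - 2 * (m1 \<bullet> (x - y)))" for x
  proof -
    have "has_bochner_integral lborel (\<lambda>x'. w x / ?q * (w x' * (norm (x' - y))\<^sup>2 + (norm (x - y))\<^sup>2 * w x' - 2 * (w x' * ((x' - y) \<bullet> (x - y)))))
       (w x / ?q * (m2 + (norm (x - y))\<^sup>2 * ?q - 2 * (m1 \<bullet> (x - y))))"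
      by (intro has_bochner_integral_mult_right has_bochner_integral_add has_bochner_integral_diff h0 h1 h2)
    moreover have "w x / ?q * (w x' * (norm (x' - y))\<^sup>2 + (norm (x - y))\<^sup>2 * w x' - 2 * (w x' * ((x' - y) \<bullet> (x - y))))
        = w x * w x' / ?q * (norm (x' - x))\<^sup>2" for x'
      unfolding sq[where x=x and x'=x'] by (simp add: divide_inverse algebra_simps)
    ultimately have "has_bochner_integral lborel (\<lambda>x'. w x * w x' / ?q * (norm (x' - x))\<^sup>2)
       (w x / ?q * (m2 + (norm (x - y))\<^sup>2 * ?q - 2 * (m1 \<bullet> (x - y))))" by (simp only:)
    then show ?thesis by (rule has_bochner_integral_integral_eq)
  qed
  have "has_bochner_integral lborel (\<lambda>x. m2 / ?q * w x + w x * (norm (x - y))\<^sup>2 - 2 / ?q * (w x * ((x - y) \<bullet> m1)))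
     (m2 / ?q * ?q + m2 - 2 / ?q * (m1 \<bullet> m1))"
    by (intro has_bochner_integral_mult_right has_bochner_integral_add has_bochner_integral_diff h0 h1 h2)
  moreover have "m2 / ?q * w x + w x * (norm (x - y))\<^sup>2 - 2 / ?q * (w x * ((x - y) \<bullet> m1))
     = w x / ?q * (m2 + (norm (x - y))\<^sup>2 * ?q - 2 * (m1 \<bullet> (x - y)))" for x
    using q by (simp add: divide_inverse algebra_simps inner_commute)
  ultimately have "(\<integral>x. \<integral>x'. w x * w x' / ?q * (norm (x' - x))\<^sup>2 \<partial>lborel \<partial>lborel) = m2 / ?q * ?q + m2 - 2 / ?q * (m1 \<bullet> m1)"
    unfolding inner by (simp add: has_bochner_integral_iff)
  also have "m1 \<bullet> m1 = \<tau>\<^sup>2 * (?q\<^sup>2 * (norm (hscore \<tau> y))\<^sup>2)"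
    unfolding m1_def heat_grad_eq_hscore[OF \<tau>] power2_norm_eq_inner by (simp add: power2_eq_square)
  also have "m2 / ?q * ?q + m2 - 2 / ?q * (\<tau>\<^sup>2 * (?q\<^sup>2 * (norm (hscore \<tau> y))\<^sup>2)) = 2 * m2 - 2 * \<tau>\<^sup>2 * (?q * (norm (hscore \<tau> y))\<^sup>2)"
    using q by (simp add: power2_eq_square)
  finally show ?thesis by (simp add: w_def m2_def)
qed

end

context fisher_density
begin

definition heat_fisher :: "real \<Rightarrow> real" where
  "heat_fisher \<tau> = (\<integral>y. heat p \<tau> y * (norm (hscore \<tau> y))\<^sup>2 \<partial>lborel)"

lemma integrable_heat_hscore:
  assumes "\<tau> > 0"
  shows "integrable lborel (\<lambda>y. heat p \<tau> y * (norm (hscore \<tau> y))\<^sup>2)"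
proof (rule integrableI_nonneg)
  note [measurable] = heat_measurable[OF assms] hscore_measurable[OF assms]
  show "(\<lambda>y. heat p \<tau> y * (norm (hscore \<tau> y))\<^sup>2) \<in> borel_measurable lborel" by measurable
  show "AE y in lborel. 0 \<le> heat p \<tau> y * (norm (hscore \<tau> y))\<^sup>2" by (simp add: less_imp_le[OF heat_pos[OF assms]])
  show "(\<integral>\<^sup>+y. ennreal (heat p \<tau> y * (norm (hscore \<tau> y))\<^sup>2) \<partial>lborel) < \<infinity>"
    using nn_integral_hscore_le_fisher[OF assms] by (rule le_less_trans) simp
qed

lemma heat_fisher_bounds:
  assumes "\<tau> > 0"
  shows "0 \<le> heat_fisher \<tau>" "heat_fisher \<tau> \<le> fisher"
proof -
  have nn: "0 \<le> heat p \<tau> y * (norm (hscore \<tau> y))\<^sup>2" for y by (simp add: less_imp_le[OF heat_pos[OF assms]])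
  then show "0 \<le> heat_fisher \<tau>" unfolding heat_fisher_def by (intro integral_nonneg_AE AE_I2)
  have "ennreal (heat_fisher \<tau>) \<le> ennreal fisher"
    unfolding heat_fisher_def using nn_integral_hscore_le_fisher[OF assms] integrable_heat_hscore[OF assms] nn
    by (subst nn_integral_eq_integral[symmetric]) auto
  then show "heat_fisher \<tau> \<le> fisher" using fisher_nonneg by simp
qed

lemma posterior_sampling_error:
  assumes \<tau>: "\<tau> > 0"
  shows "(\<integral>y. \<integral>x. \<integral>x'. p x * hk \<tau> (y - x) * (p x' * hk \<tau> (y - x')) / heat p \<tau> y * (norm (x' - x))\<^sup>2 \<partial>lborel \<partial>lborel \<partial>lborel)
    = 2 * (real DIM('a) * \<tau>) - 2 * \<tau>\<^sup>2 * heat_fisher \<tau>"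
proof -
  note n = noise_second_moment[OF \<tau>]
  have s: "(\<lambda>y. \<integral>x. p x * hk \<tau> (y - x) * (norm (y - x))\<^sup>2 \<partial>lborel) = (\<lambda>y. \<integral>x. p x * hk \<tau> (y - x) * (norm (x - y))\<^sup>2 \<partial>lborel)"
    by (simp add: norm_minus_commute)
  have "integrable lborel (\<lambda>y. \<integral>x. p x * hk \<tau> (y - x) * (norm (x - y))\<^sup>2 \<partial>lborel)"
    using lborel_pair.integrable_snd[OF n(1)] by (simp add: s)
  moreover have "(\<integral>y. \<integral>x. p x * hk \<tau> (y - x) * (norm (x - y))\<^sup>2 \<partial>lborel \<partial>lborel) = real DIM('a) * \<tau>"
    using lborel_pair.integral_snd[OF n(1)] n(2) by (simp add: s)
  ultimately show ?thesis
    unfolding posterior_pair_error[OF \<tau>] heat_fisher_def using integrable_heat_hscore[OF \<tau>] by simp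
qed

end

section \<open>The diffusion in heat coordinates\<close>

lemma grad_eqI:
  assumes "(f has_derivative (\<lambda>e. D \<bullet> e)) (at x)"
  shows "grad f x = D"
  unfolding grad_def
proof (rule the_equality)
  show "GDERIV f x :> D" using assms by (simp add: gderiv_def inner_commute)
  fix D' assume "GDERIV f x :> D'"
  then have "(\<lambda>e. e \<bullet> D') = (\<lambda>e. D \<bullet> e)"
    using assms by (intro has_derivative_unique[of f]) (simp_all add: gderiv_def)
  then have "e \<bullet> D' = e \<bullet> D" for e by (metis inner_commute)
  then have "(D' - D) \<bullet> (D' - D) = 0" by (simp add: inner_diff_right)
  then show "D' = D" by simp
qed

text \<open>No measurability is needed: if \<open>f\<close> is not measurable, both integrals are the junk value \<open>0\<close>.\<close>
lemma integral_lborel_scale: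
  fixes f :: "'a::euclidean_space \<Rightarrow> real"
  assumes "a > 0"
  shows "(\<integral>z. f z \<partial>lborel) = a ^ DIM('a) * (\<integral>y. f (a *\<^sub>R y) \<partial>lborel)"
proof (cases "f \<in> borel_measurable borel")
  case True
  then have [measurable]: "f \<in> borel_measurable borel" .
  have "(lborel :: 'a measure) = density (distr lborel borel (\<lambda>y. a *\<^sub>R y)) (\<lambda>_. ennreal (a ^ DIM('a)))"
    using lborel_affine[of a "0::'a"] assms by simp
  then have "(\<integral>z. f z \<partial>lborel) = (\<integral>z. f z \<partial>density (distr lborel borel (\<lambda>y. a *\<^sub>R y)) (\<lambda>_. ennreal (a ^ DIM('a))))"
    by simp
  also have "\<dots> = (\<integral>y. a ^ DIM('a) * f (a *\<^sub>R y) \<partial>lborel)"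
    using assms by (subst integral_density) (auto simp: integral_distr)
  finally show ?thesis by simp
next
  case False
  have "\<not> (\<lambda>y. f (a *\<^sub>R y)) \<in> borel_measurable borel"
  proof
    assume "(\<lambda>y. f (a *\<^sub>R y)) \<in> borel_measurable borel"
    then have "(\<lambda>z. f (a *\<^sub>R ((1 / a) *\<^sub>R z))) \<in> borel_measurable borel"
      by (rule measurable_compose[rotated]) measurable
    with False assms show False by simp
  qed
  with False have "\<not> integrable lborel f" "\<not> integrable lborel (\<lambda>y. f (a *\<^sub>R y))"
    by (auto dest: borel_measurable_integrable)
  then show ?thesis by (simp add: not_integrable_integral_eq)
qed

lemma gauss_scaled:
  assumes "a > 0" "\<tau> > 0" "s\<^sup>2 = a\<^sup>2 * \<tau>"
  shows "gauss s (a *\<^sub>R (u::'a::euclidean_space)) = hk \<tau> u / a ^ DIM('a)"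
proof -
  let ?d = "- real DIM('a) / 2"
  have "(2 * pi * s\<^sup>2) powr ?d = (a\<^sup>2 * (2 * pi * \<tau>)) powr ?d"
    using assms(3) by (simp add: mult_ac)
  also have "\<dots> = (a\<^sup>2) powr ?d * (2 * pi * \<tau>) powr ?d"
    using assms by (simp add: powr_mult)
  also have "(a\<^sup>2) powr ?d = 1 / a ^ DIM('a)"
  proof -
    have "(a\<^sup>2) powr ?d = (a powr 2) powr ?d" using assms by (simp add: powr_realpow)
    also have "\<dots> = a powr (- real DIM('a))" by (simp add: powr_powr)
    also have "\<dots> = 1 / a ^ DIM('a)" using assms by (simp add: powr_minus_divide powr_realpow)
    finally show ?thesis .
  qed
  finally have "(2 * pi * s\<^sup>2) powr ?d = (2 * pi * \<tau>) powr ?d / a ^ DIM('a)" by simp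
  moreover have "- (norm (a *\<^sub>R u))\<^sup>2 / (2 * s\<^sup>2) = - (norm u)\<^sup>2 / (2 * \<tau>)"
    using assms by (simp add: power_mult_distrib)
  ultimately show ?thesis by (simp add: gauss_def hk_def)
qed

section \<open>The noise schedule and its change of time\<close>

locale noise_schedule =
  fixes \<beta> :: "real \<Rightarrow> real"
  assumes beta_cont: "continuous_on {0..} \<beta>" and beta_pos: "\<And>t. t \<ge> 0 \<Longrightarrow> \<beta> t > 0"
begin

definition cumul :: "real \<Rightarrow> real" where "cumul t = integral {0..t} \<beta>"

text \<open>In the coordinates \<open>y = z / contraction t\<close>, \<open>\<tau> = heat_time t\<close> the forward process is a Brownian
  motion started at the data, and the probability flow loses its drift.\<close>
definition heat_time :: "real \<Rightarrow> real" where "heat_time t = exp (cumul t) - 1"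

definition contraction :: "real \<Rightarrow> real" where "contraction t = exp (- cumul t / 2)"

lemma contraction_pos: "contraction t > 0"
  by (simp add: contraction_def)

lemma cumul_within: "t \<in> {0..b} \<Longrightarrow> (cumul has_real_derivative \<beta> t) (at t within {0..b})"
  unfolding cumul_def[abs_def] has_real_derivative_iff_has_vector_derivative
  by (rule integral_has_vector_derivative) (auto intro: continuous_on_subset[OF beta_cont])

lemma cumul_deriv: "t > 0 \<Longrightarrow> (cumul has_real_derivative \<beta> t) (at t)"
  using cumul_within[of t "t + 1"] by (simp add: at_within_Icc_at)

lemma continuous_on_cumul: "continuous_on {0..b} cumul"
  by (rule DERIV_continuous_on) (rule cumul_within)

lemma cumul_0 [simp]: "cumul 0 = 0"
  by (simp add: cumul_def)

lemma heat_time_0 [simp]: "heat_time 0 = 0"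
  by (simp add: heat_time_def)

lemma heat_time_deriv: "t > 0 \<Longrightarrow> (heat_time has_real_derivative \<beta> t * exp (cumul t)) (at t)"
  unfolding heat_time_def[abs_def] by (auto intro!: derivative_eq_intros cumul_deriv)

lemma continuous_on_heat_time: "continuous_on {0..b} heat_time"
  unfolding heat_time_def[abs_def] by (intro continuous_intros continuous_on_cumul)

lemma cumul_less: "0 \<le> s \<Longrightarrow> s < t \<Longrightarrow> cumul s < cumul t"
proof -
  assume st: "0 \<le> s" "s < t"
  show ?thesis
  proof (rule DERIV_pos_imp_increasing_open[OF st(2)])
    show "\<exists>y. (cumul has_real_derivative y) (at x) \<and> 0 < y" if "s < x" "x < t" for x
      using cumul_deriv[of x] beta_pos[of x] st that by auto
    show "continuous_on {s..t} cumul" using continuous_on_cumul[of t] by (rule continuous_on_subset) (use st in auto)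
  qed
qed

lemma heat_time_less: "0 \<le> s \<Longrightarrow> s < t \<Longrightarrow> heat_time s < heat_time t"
  using cumul_less[of s t] by (simp add: heat_time_def)

lemma heat_time_pos: "t > 0 \<Longrightarrow> heat_time t > 0"
  using heat_time_less[of 0 t] by simp

lemma contraction_squared: "(contraction t)\<^sup>2 = exp (- cumul t)"
  unfolding contraction_def power2_eq_square exp_add[symmetric] by simp

lemma sig_squared_eq: "t > 0 \<Longrightarrow> (sig \<beta> t)\<^sup>2 = 1 - exp (- cumul t)"
  using cumul_less[of 0 t] by (simp add: sig_def cumul_def[symmetric])

lemma sig_squared: "t > 0 \<Longrightarrow> (sig \<beta> t)\<^sup>2 = (contraction t)\<^sup>2 * heat_time t"
  unfolding sig_squared_eq contraction_squared heat_time_def by (simp add: right_diff_distrib exp_minus)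

lemma sqrt_one_minus_sig: "t > 0 \<Longrightarrow> sqrt (1 - (sig \<beta> t)\<^sup>2) = contraction t"
  using contraction_squared[of t] contraction_pos[of t] by (simp add: sig_squared_eq real_sqrt_unique)

lemma joint_scaled:
  fixes p :: "'a::euclidean_space \<Rightarrow> real"
  assumes "t > 0"
  shows "joint p \<beta> t x (contraction t *\<^sub>R y) = p x * hk (heat_time t) (y - x) / contraction t ^ DIM('a)"
proof -
  have "contraction t *\<^sub>R y - contraction t *\<^sub>R x = contraction t *\<^sub>R (y - x)" by (simp add: scaleR_diff_right)
  then show ?thesis
    unfolding joint_def sqrt_one_minus_sig[OF assms]
    by (simp only: gauss_scaled[OF contraction_pos heat_time_pos[OF assms] sig_squared[OF assms]] times_divide_eq_right)
qed

lemma dens_scaled: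
  fixes p :: "'a::euclidean_space \<Rightarrow> real"
  assumes "t > 0"
  shows "dens p \<beta> t (contraction t *\<^sub>R y) = heat p (heat_time t) y / contraction t ^ DIM('a)"
proof -
  have "dens p \<beta> t (contraction t *\<^sub>R y) = (\<integral>x. p x * hk (heat_time t) (y - x) / contraction t ^ DIM('a) \<partial>lborel)"
    using assms by (simp only: dens_def joint_scaled) simp
  then show ?thesis unfolding heat_def by simp
qed

lemma tendsto_heat_time: "(heat_time \<longlongrightarrow> 0) (at_right 0)"
proof -
  have "(heat_time \<longlongrightarrow> heat_time 0) (at 0 within {0..1})"
    using continuous_on_heat_time[of 1] unfolding continuous_on_def by (rule bspec) simp
  then show ?thesis by (simp add: at_within_Icc_at_right)
qed

text \<open>The limit concerns small times, so the inverse is taken on \<open>{0..1}\<close>, where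
  \<open>heat_time\<close> is injective with compact domain and the inverse is continuous.\<close>

definition heat_time_inv :: "real \<Rightarrow> real" where
  "heat_time_inv = the_inv_into {0..1} heat_time"

lemma inj_on_heat_time: "inj_on heat_time {0..1}"
proof (rule inj_onI)
  fix s t assume "s \<in> {0..1}" "t \<in> {0..1}" "heat_time s = heat_time t"
  then show "s = t" using heat_time_less[of s t] heat_time_less[of t s] by (cases s t rule: linorder_cases) auto
qed

lemma heat_time_inv_left: "s \<in> {0..1} \<Longrightarrow> heat_time_inv (heat_time s) = s"
  unfolding heat_time_inv_def by (rule the_inv_into_f_f[OF inj_on_heat_time])

lemma heat_time_inv_right:
  assumes "r \<in> {0..heat_time 1}"
  shows "heat_time_inv r \<in> {0..1}" "heat_time (heat_time_inv r) = r"
proof -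
  obtain s where "s \<in> {0..1}" "heat_time s = r"
    using IVT'[of heat_time 0 r 1] continuous_on_heat_time[of 1] assms by auto
  then show "heat_time_inv r \<in> {0..1}" "heat_time (heat_time_inv r) = r"
    using heat_time_inv_left[of s] by auto
qed

lemma heat_time_inv_less:
  assumes "r \<in> {0..heat_time 1}" "r' \<in> {0..heat_time 1}" "r < r'"
  shows "heat_time_inv r < heat_time_inv r'"
proof (rule ccontr)
  assume "\<not> heat_time_inv r < heat_time_inv r'"
  then have "heat_time (heat_time_inv r') \<le> heat_time (heat_time_inv r)"
    using heat_time_less[of "heat_time_inv r'" "heat_time_inv r"] heat_time_inv_right(1)[OF assms(2)]
    by (cases "heat_time_inv r = heat_time_inv r'") auto
  then show False using assms by (simp add: heat_time_inv_right)
qed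

lemma continuous_on_heat_time_inv: "continuous_on {0..heat_time 1} heat_time_inv"
proof -
  have "continuous_on (heat_time ` {0..1}) heat_time_inv"
    by (rule continuous_on_inv[OF continuous_on_heat_time]) (auto simp: heat_time_inv_left)
  moreover have "{0..heat_time 1} \<subseteq> heat_time ` {0..1}"
    using heat_time_inv_right by (metis image_eqI subsetI)
  ultimately show ?thesis by (rule continuous_on_subset)
qed

lemma heat_time_inv_deriv:
  assumes "0 < r" "r < heat_time 1"
  shows "heat_time_inv r > 0"
    and "(heat_time_inv has_real_derivative inverse (\<beta> (heat_time_inv r) * exp (cumul (heat_time_inv r)))) (at r)"
proof -
  have r: "r \<in> {0..heat_time 1}" using assms by auto
  have "heat_time_inv 0 = 0" using heat_time_inv_left[of 0] by simp
  then show pos: "heat_time_inv r > 0" using heat_time_inv_less[of 0 r] assms r by auto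
  show "(heat_time_inv has_real_derivative inverse (\<beta> (heat_time_inv r) * exp (cumul (heat_time_inv r)))) (at r)"
  proof (rule DERIV_inverse_function[of heat_time _ _ _ 0 "heat_time 1"])
    show "(heat_time has_real_derivative \<beta> (heat_time_inv r) * exp (cumul (heat_time_inv r))) (at (heat_time_inv r))"
      using heat_time_deriv[OF pos] .
    show "\<beta> (heat_time_inv r) * exp (cumul (heat_time_inv r)) \<noteq> 0" using beta_pos[of "heat_time_inv r"] pos by simp
    show "isCont heat_time_inv r"
      using continuous_on_heat_time_inv assms by (simp add: continuous_on_interior)
  qed (use assms heat_time_inv_right in auto)
qed

end

section \<open>Scores, flow and errors of the diffusion, and the limit of the ratio\<close>

locale diffusion = fisher_density p gp + noise_schedule \<beta>
  for p :: "'a::euclidean_space \<Rightarrow> real" and gp \<beta>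
begin

text \<open>The power of the contraction that normalises the density is constant in \<open>z\<close>
  and disappears in the logarithmic derivative; the inner rescaling leaves one factor.\<close>

lemma score_eq_hscore:
  assumes "s > 0"
  shows "score p \<beta> s z = (1 / contraction s) *\<^sub>R hscore (heat_time s) ((1 / contraction s) *\<^sub>R z)"
proof -
  let ?a = "contraction s" and ?\<tau> = "heat_time s"
  have a: "?a > 0" by (rule contraction_pos)
  have \<tau>: "?\<tau> > 0" using assms by (rule heat_time_pos)
  have dens: "dens p \<beta> s z' = heat p ?\<tau> ((1 / ?a) *\<^sub>R z') / ?a ^ DIM('a)" for z'
    using dens_scaled[OF assms, of p "(1 / ?a) *\<^sub>R z'"] a by simp
  let ?w = "(1 / ?a) *\<^sub>R z" and ?c = "?a ^ DIM('a)"
  have q: "heat p ?\<tau> ?w / ?c > 0" using heat_pos[OF \<tau>] a by simp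
  have "((\<lambda>z. heat p ?\<tau> ((1 / ?a) *\<^sub>R z)) has_derivative (\<lambda>e. heat_grad p ?\<tau> ?w \<bullet> ((1 / ?a) *\<^sub>R e))) (at z)"
    by (rule has_derivative_compose[of "\<lambda>z. (1 / ?a) *\<^sub>R z", OF _ has_derivative_heat[OF p_int \<tau>]])
      (auto intro!: derivative_eq_intros)
  then have "((\<lambda>z. heat p ?\<tau> ((1 / ?a) *\<^sub>R z) * (1 / ?c)) has_derivative (\<lambda>e. (heat_grad p ?\<tau> ?w \<bullet> ((1 / ?a) *\<^sub>R e)) * (1 / ?c))) (at z)"
    by (rule has_derivative_mult_left)
  then have "(dens p \<beta> s has_derivative (\<lambda>e. (heat_grad p ?\<tau> ?w \<bullet> ((1 / ?a) *\<^sub>R e)) / ?c)) (at z)"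
    by (simp add: dens[abs_def])
  then have "((\<lambda>y. ln (dens p \<beta> s y)) has_derivative (\<lambda>e. (1 / dens p \<beta> s z) * ((heat_grad p ?\<tau> ?w \<bullet> ((1 / ?a) *\<^sub>R e)) / ?c))) (at z)"
    by (rule has_derivative_compose[OF _ has_field_derivative_imp_has_derivative[OF DERIV_ln_divide]])
      (use q in \<open>simp add: dens\<close>)
  moreover have "(1 / dens p \<beta> s z) * ((heat_grad p ?\<tau> ?w \<bullet> ((1 / ?a) *\<^sub>R e)) / ?c) = ((1 / ?a) *\<^sub>R hscore ?\<tau> ?w) \<bullet> e" for e
    using q a heat_pos[OF \<tau>, of ?w] by (simp add: dens heat_grad_eq_hscore[OF \<tau>])
  ultimately show ?thesis
    unfolding score_def by (intro grad_eqI) (simp only:)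
qed

text \<open>The integrating factor \<open>exp (cumul s / 2)\<close> removes the linear drift, and
  running time through \<open>heat_time_inv\<close> divides the speed by
  \<open>\<beta> s * exp (cumul s)\<close>, which leaves minus half the score. At time 0 the factor
  is 1, so the reconstructed point is unchanged.\<close>

lemma flow_reconstruction_heat_traj:
  assumes t: "0 < t" "t \<le> 1" and flow: "is_flow_reconstruction p \<beta> t z x0"
  obtains y where "heat_traj 0 (heat_time t) y" "y (heat_time t) = (1 / contraction t) *\<^sub>R z" "y 0 = x0"
proof -
  obtain \<phi> where \<phi>: "continuous_on {0..t} \<phi>" "\<phi> t = z" "\<phi> 0 = x0"
    "\<And>s. s \<in> {0<..t} \<Longrightarrow> (\<phi> has_vector_derivative
            (- (\<beta> s / 2) *\<^sub>R \<phi> s - (\<beta> s / 2) *\<^sub>R score p \<beta> s (\<phi> s))) (at s within {0..t})"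
    using flow unfolding is_flow_reconstruction_def by blast
  define w where "w s = exp (cumul s / 2) *\<^sub>R \<phi> s" for s
  let ?T = "heat_time t" and ?\<theta> = heat_time_inv
  have T: "?T \<le> heat_time 1" using t heat_time_less[of t 1] by (cases "t = 1") auto
  have tI: "t \<in> {0..1}" using t by auto
  have \<theta>t: "?\<theta> ?T = t" "?\<theta> 0 = 0" using heat_time_inv_left[OF tI] heat_time_inv_left[of 0] by auto
  have \<theta>I: "?\<theta> r \<in> {0..t}" if "r \<in> {0..?T}" for r
    using that heat_time_inv_right(1)[of r] heat_time_inv_less[of r ?T] T \<theta>t heat_time_pos[OF t(1)]
    by (cases "r = ?T") auto
  have expc: "exp (cumul s / 2) = 1 / contraction s" for s
  proof -
    have "exp (cumul s / 2) * contraction s = 1" unfolding contraction_def exp_add[symmetric] by simp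
    then show ?thesis using contraction_pos[of s] by (simp add: eq_divide_eq)
  qed
  have contw: "continuous_on {0..t} w"
    unfolding w_def[abs_def] by (intro continuous_on_scaleR continuous_on_exp continuous_on_divide continuous_on_cumul continuous_on_const \<phi>(1)) simp
  have dw: "(w has_vector_derivative (- (\<beta> s * exp (cumul s)) / 2) *\<^sub>R hscore (heat_time s) (w s)) (at s)" if s: "0 < s" "s < t" for s
  proof -
    have "at s within {0..t} = at s" using s by (simp add: at_within_Icc_at)
    with \<phi>(4)[of s] s have d\<phi>: "(\<phi> has_vector_derivative
            (- (\<beta> s / 2) *\<^sub>R \<phi> s - (\<beta> s / 2) *\<^sub>R score p \<beta> s (\<phi> s))) (at s)" by auto
    have de: "((\<lambda>s. exp (cumul s / 2)) has_real_derivative exp (cumul s / 2) * (\<beta> s / 2)) (at s)"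
      using s by (auto intro!: derivative_eq_intros cumul_deriv)
    have sc: "score p \<beta> s (\<phi> s) = exp (cumul s / 2) *\<^sub>R hscore (heat_time s) (w s)"
      unfolding w_def expc by (rule score_eq_hscore[OF s(1)])
    have ee: "exp (cumul s / 2) * exp (cumul s / 2) = exp (cumul s)" by (simp add: exp_add[symmetric])
    have "exp (cumul s / 2) *\<^sub>R (- (\<beta> s / 2) *\<^sub>R \<phi> s - (\<beta> s / 2) *\<^sub>R score p \<beta> s (\<phi> s)) + (exp (cumul s / 2) * (\<beta> s / 2)) *\<^sub>R \<phi> s
        = (- ((exp (cumul s / 2) * exp (cumul s / 2)) * (\<beta> s / 2))) *\<^sub>R hscore (heat_time s) (w s)"
      unfolding sc by (simp add: scaleR_diff_right algebra_simps)
    also have "\<dots> = (- (\<beta> s * exp (cumul s)) / 2) *\<^sub>R hscore (heat_time s) (w s)"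
      unfolding ee by (simp add: mult.commute)
    finally show ?thesis
      using has_vector_derivative_scaleR[OF de d\<phi>] by (simp add: w_def[abs_def])
  qed
  show ?thesis
  proof (rule that[of "\<lambda>r. w (?\<theta> r)"])
    show "heat_traj 0 ?T (\<lambda>r. w (?\<theta> r))"
      unfolding heat_traj_def
    proof (intro conjI ballI)
      show "continuous_on {0..?T} (\<lambda>r. w (?\<theta> r))"
        by (rule continuous_on_compose2[OF contw continuous_on_subset[OF continuous_on_heat_time_inv]]) (use T \<theta>I in auto)
      fix r assume r: "r \<in> {0<..<?T}"
      then have r': "0 < r" "r < heat_time 1" "r \<in> {0..heat_time 1}" "r < ?T" using T by auto
      have s: "0 < ?\<theta> r" "?\<theta> r < t" "heat_time (?\<theta> r) = r"
        using heat_time_inv_deriv(1)[OF r'(1,2)] heat_time_inv_less[OF r'(3) _ r'(4)] \<theta>t T heat_time_inv_right(2)[OF r'(3)] heat_time_pos[OF t(1)] by auto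
      let ?D = "\<beta> (?\<theta> r) * exp (cumul (?\<theta> r))"
      have D: "?D \<noteq> 0" using beta_pos[of "?\<theta> r"] s(1) by simp
      have "(?\<theta> has_vector_derivative inverse ?D) (at r)"
        using heat_time_inv_deriv(2)[OF r'(1,2)] by (simp only: has_real_derivative_iff_has_vector_derivative)
      from vector_diff_chain_at[OF this dw[OF s(1,2)]]
      have "((w \<circ> ?\<theta>) has_vector_derivative inverse ?D *\<^sub>R ((- ?D / 2) *\<^sub>R hscore (heat_time (?\<theta> r)) (w (?\<theta> r)))) (at r)" .
      moreover have *: "inverse d *\<^sub>R ((- d / 2) *\<^sub>R v) = (- 1 / 2) *\<^sub>R v" if "d \<noteq> 0" for d :: real and v :: 'a
        using that by simp
      ultimately show "((\<lambda>r. w (?\<theta> r)) has_vector_derivative (- 1 / 2) *\<^sub>R hscore r (w (?\<theta> r))) (at r)"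
        by (simp only: s(3) o_def *[OF D])
    qed
    show "w (?\<theta> ?T) = (1 / contraction t) *\<^sub>R z" unfolding \<theta>t w_def expc \<phi>(2) ..
    show "w (?\<theta> 0) = x0" unfolding \<theta>t w_def \<phi>(3) by simp
  qed
qed

text \<open>Two factors \<open>joint\<close> over one \<open>dens\<close> leave a single power of
  the contraction in the denominator, which the Jacobian of the rescaling of \<open>z\<close>
  cancels. The data variables are not rescaled.\<close>

lemma anc_err_eq:
  assumes "t > 0"
  shows "anc_err p \<beta> t = 2 * (real DIM('a) * heat_time t) - 2 * (heat_time t)\<^sup>2 * heat_fisher (heat_time t)"
proof -
  let ?a = "contraction t" and ?\<tau> = "heat_time t"
  let ?c = "?a ^ DIM('a)"
  have c: "?c > 0" using contraction_pos by simp
  have "anc_err p \<beta> t = ?c * (\<integral>y. \<integral>x. \<integral>x'. joint p \<beta> t x (?a *\<^sub>R y) * joint p \<beta> t x' (?a *\<^sub>R y) / dens p \<beta> t (?a *\<^sub>R y) * (norm (x' - x))\<^sup>2 \<partial>lborel \<partial>lborel \<partial>lborel)"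
    unfolding anc_err_def by (rule integral_lborel_scale[OF contraction_pos])
  also have "(\<lambda>y x x'. joint p \<beta> t x (?a *\<^sub>R y) * joint p \<beta> t x' (?a *\<^sub>R y) / dens p \<beta> t (?a *\<^sub>R y) * (norm (x' - x))\<^sup>2)
     = (\<lambda>y x x'. (1 / ?c) * (p x * hk ?\<tau> (y - x) * (p x' * hk ?\<tau> (y - x')) / heat p ?\<tau> y * (norm (x' - x))\<^sup>2))"
    using c by (simp add: fun_eq_iff joint_scaled[OF assms] dens_scaled[OF assms])
  also have "?c * (\<integral>y. \<integral>x. \<integral>x'. (1 / ?c) * (p x * hk ?\<tau> (y - x) * (p x' * hk ?\<tau> (y - x')) / heat p ?\<tau> y * (norm (x' - x))\<^sup>2) \<partial>lborel \<partial>lborel \<partial>lborel)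
     = (\<integral>y. \<integral>x. \<integral>x'. p x * hk ?\<tau> (y - x) * (p x' * hk ?\<tau> (y - x')) / heat p ?\<tau> y * (norm (x' - x))\<^sup>2 \<partial>lborel \<partial>lborel \<partial>lborel)"
    using c contraction_pos[of t] by (simp only: integral_mult_right_zero) simp
  finally show ?thesis by (simp only: posterior_sampling_error[OF heat_time_pos[OF assms]])
qed

lemma flow_err_eq:
  assumes "t > 0"
  shows "flow_err p \<beta> f t = (\<integral>x. \<integral>y. p x * hk (heat_time t) (y - x) * (norm (f (contraction t *\<^sub>R y) - x))\<^sup>2 \<partial>lborel \<partial>lborel)"
  unfolding flow_err_def
proof (rule Bochner_Integration.integral_cong)
  fix x
  let ?a = "contraction t" and ?\<tau> = "heat_time t"
  let ?c = "?a ^ DIM('a)"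
  have c: "?c > 0" using contraction_pos by simp
  have "(\<integral>z. joint p \<beta> t x z * (norm (f z - x))\<^sup>2 \<partial>lborel) = ?c * (\<integral>y. joint p \<beta> t x (?a *\<^sub>R y) * (norm (f (?a *\<^sub>R y) - x))\<^sup>2 \<partial>lborel)"
    by (rule integral_lborel_scale[OF contraction_pos])
  also have "\<dots> = ?c * (\<integral>y. (1 / ?c) * (p x * hk ?\<tau> (y - x) * (norm (f (?a *\<^sub>R y) - x))\<^sup>2) \<partial>lborel)"
    by (simp add: joint_scaled[OF assms])
  also have "\<dots> = (\<integral>y. p x * hk ?\<tau> (y - x) * (norm (f (?a *\<^sub>R y) - x))\<^sup>2 \<partial>lborel)"
    using c contraction_pos[of t] by (simp only: integral_mult_right_zero) simp
  finally show "(\<integral>z. joint p \<beta> t x z * (norm (f z - x))\<^sup>2 \<partial>lborel) = (\<integral>y. p x * hk ?\<tau> (y - x) * (norm (f (?a *\<^sub>R y) - x))\<^sup>2 \<partial>lborel)" .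
qed simp

lemma flow_err_bound:
  assumes flow: "\<And>t z. t > 0 \<Longrightarrow> is_flow_reconstruction p \<beta> t z (F t z)"
    and t: "0 < t" "t \<le> 1" and \<epsilon>: "\<epsilon> > 0"
  shows "\<bar>flow_err p \<beta> (F t) t - real DIM('a) * heat_time t\<bar>
    \<le> (1 + 1 / \<epsilon>) * ((heat_time t)\<^sup>2 / 4 * fisher) + \<epsilon> * (real DIM('a) * heat_time t)"
proof -
  let ?T = "heat_time t" and ?\<theta> = heat_time_inv
  have T0: "?T > 0" using heat_time_pos[OF t(1)] .
  have T: "?T \<le> heat_time 1" using t heat_time_less[of t 1] by (cases "t = 1") auto
  \<comment> \<open>Transport follows the flow through all intermediate times, so a trajectory
    ending at each heat time \<open>r\<close> is required; it comes from the reconstruction at the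
    original time \<open>heat_time_inv r\<close>.\<close>
  have "\<exists>y. heat_traj 0 r y \<and> y r = z \<and> y 0 = F (?\<theta> r) (contraction (?\<theta> r) *\<^sub>R z)" if r: "0 < r" "r \<le> ?T" for r z
  proof -
    have rI: "r \<in> {0..heat_time 1}" using r T by auto
    have s: "?\<theta> r \<le> 1" "heat_time (?\<theta> r) = r" "0 \<le> ?\<theta> r" using heat_time_inv_right[OF rI] by auto
    then have "?\<theta> r > 0" using r by (cases "?\<theta> r = 0") auto
    from flow_reconstruction_heat_traj[OF this s(1) flow[OF this], of "contraction (?\<theta> r) *\<^sub>R z"]
    show ?thesis using contraction_pos[of "?\<theta> r"] unfolding s(2) by auto
  qed
  then obtain Y where Y: "\<And>r z. 0 < r \<Longrightarrow> r \<le> ?T \<Longrightarrow> heat_traj 0 r (Y r z) \<and> Y r z r = z \<and> Y r z 0 = F (?\<theta> r) (contraction (?\<theta> r) *\<^sub>R z)"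
    by metis
  have \<theta>: "?\<theta> ?T = t" using heat_time_inv_left[of t] t by simp
  have Y0: "Y ?T z 0 = F t (contraction t *\<^sub>R z)" for z using Y[OF T0 order_refl, of z] by (simp add: \<theta>)
  have disp: "(\<lambda>z. Y ?T z 0) \<in> borel_measurable borel"
    "(\<integral>\<^sup>+z. ennreal (heat p ?T z * (norm (Y ?T z 0 - z))\<^sup>2) \<partial>lborel) \<le> ennreal (?T\<^sup>2 / 4 * fisher)"
    using Y by (intro flow_displacement_L2[OF T0]; blast)+
  have "0 \<le> ?T\<^sup>2 / 4 * fisher" using fisher_nonneg by simp
  from reconstruction_error_perturbation[OF T0 disp this \<epsilon>] show ?thesis
    unfolding flow_err_eq[OF t(1)] by (simp only: Y0)
qed

text \<open>On nonnegative times \<open>sig \<beta>\<close> is continuous, strictly increasing and 0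
  at 0, so the limit from the right at time 0 is the limit of vanishing noise level. Both errors are
  divided by the heat time: the quotients tend to the dimension and to twice the dimension.\<close>

theorem flow_anc_ratio_tendsto:
  assumes flow: "\<And>t z. t > 0 \<Longrightarrow> is_flow_reconstruction p \<beta> t z (F t z)"
  shows "((\<lambda>t. flow_err p \<beta> (F t) t / anc_err p \<beta> t) \<longlongrightarrow> 1 / 2) (at_right 0)"
proof -
  let ?M = "real DIM('a)" and ?T = heat_time
  have ev: "eventually (\<lambda>t. t \<in> {0<..<1}) (at_right (0::real))"
    by (rule eventually_at_right_real) simp
  have T: "(?T \<longlongrightarrow> 0) (at_right 0)" by (rule tendsto_heat_time)
  have lim1: "((\<lambda>t. flow_err p \<beta> (F t) t / ?T t - ?M) \<longlongrightarrow> 0) (at_right 0)"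
  proof (rule Lim_null_comparison)
    show "((\<lambda>t. ?T t * (fisher / 4) + sqrt (?T t) * (fisher / 4) + sqrt (?T t) * ?M) \<longlongrightarrow> 0) (at_right 0)"
      by (rule tendsto_eq_intros T refl | simp)+
    show "eventually (\<lambda>t. norm (flow_err p \<beta> (F t) t / ?T t - ?M) \<le> ?T t * (fisher / 4) + sqrt (?T t) * (fisher / 4) + sqrt (?T t) * ?M) (at_right 0)"
      using ev
    proof eventually_elim
      case (elim t)
      \<comment> \<open>With \<epsilon> equal to the square root of the heat time, the displacement
        term divided by \<epsilon> and the Young term are both of order 3/2 in the heat time, hence
        negligible.\<close>
      define r where "r = sqrt (?T t)"
      have r: "r > 0" "?T t = r * r" using heat_time_pos[of t] elim by (auto simp: r_def)
      have "\<bar>flow_err p \<beta> (F t) t - ?M * ?T t\<bar> \<le> (1 + 1 / r) * ((?T t)\<^sup>2 / 4 * fisher) + r * (?M * ?T t)"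
        using elim r by (intro flow_err_bound[OF flow]) auto
      also have "\<dots> = (?T t * (fisher / 4) + r * (fisher / 4) + r * ?M) * ?T t"
        using r by (simp add: field_simps power2_eq_square)
      finally have "\<bar>flow_err p \<beta> (F t) t - ?M * ?T t\<bar> / ?T t \<le> ?T t * (fisher / 4) + r * (fisher / 4) + r * ?M"
        using heat_time_pos[of t] elim by (simp add: divide_le_eq)
      moreover have "flow_err p \<beta> (F t) t / ?T t - ?M = (flow_err p \<beta> (F t) t - ?M * ?T t) / ?T t"
        using heat_time_pos[of t] elim by (simp add: diff_divide_distrib)
      then have "\<bar>flow_err p \<beta> (F t) t - ?M * ?T t\<bar> / ?T t = \<bar>flow_err p \<beta> (F t) t / ?T t - ?M\<bar>"
        using heat_time_pos[of t] elim by (simp only: abs_divide) simp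
      ultimately show ?case by (simp only: r_def real_norm_def)
    qed
  qed
  have lim2: "((\<lambda>t. anc_err p \<beta> t / ?T t - 2 * ?M) \<longlongrightarrow> 0) (at_right 0)"
  proof (rule Lim_null_comparison)
    show "((\<lambda>t. 2 * ?T t * fisher) \<longlongrightarrow> 0) (at_right 0)"
      by (rule tendsto_eq_intros T refl | simp)+
    show "eventually (\<lambda>t. norm (anc_err p \<beta> t / ?T t - 2 * ?M) \<le> 2 * ?T t * fisher) (at_right 0)"
      using ev
    proof eventually_elim
      case (elim t)
      have p: "?T t > 0" using heat_time_pos[of t] elim by simp
      have "anc_err p \<beta> t / ?T t - 2 * ?M = - (2 * ?T t * heat_fisher (?T t))"
        using p elim by (simp add: anc_err_eq field_simps power2_eq_square)
      then have "norm (anc_err p \<beta> t / ?T t - 2 * ?M) = 2 * ?T t * heat_fisher (?T t)"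
        using heat_fisher_bounds[OF p] p by simp
      also have "\<dots> \<le> 2 * ?T t * fisher"
        using heat_fisher_bounds[OF p] p by (intro mult_left_mono) auto
      finally show ?case .
    qed
  qed
  have "((\<lambda>t. (flow_err p \<beta> (F t) t / ?T t) / (anc_err p \<beta> t / ?T t)) \<longlongrightarrow> ?M / (2 * ?M)) (at_right 0)"
    using lim1 lim2 by (intro tendsto_divide) (simp_all add: LIM_zero_iff)
  moreover have "eventually (\<lambda>t. (flow_err p \<beta> (F t) t / ?T t) / (anc_err p \<beta> t / ?T t) = flow_err p \<beta> (F t) t / anc_err p \<beta> t) (at_right 0)"
    using ev
  proof eventually_elim
    case (elim t)
    then have "?T t \<noteq> 0" using heat_time_pos[of t] by simp
    then show ?case by simp
  qed
  ultimately have "((\<lambda>t. flow_err p \<beta> (F t) t / anc_err p \<beta> t) \<longlongrightarrow> ?M / (2 * ?M)) (at_right 0)"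
    by (rule Lim_transform_eventually)
  then show ?thesis by simp
qed

end

section \<open>From a smooth density with finite score energy to the locale assumptions\<close>

theorem theorem2:
  fixes p :: "'a::euclidean_space \<Rightarrow> real"
    and \<beta> :: "real \<Rightarrow> real"
    and F :: "real \<Rightarrow> 'a \<Rightarrow> 'a"
  assumes beta_cont: "continuous_on {0..} \<beta>"
    and beta_pos: "\<And>t. t \<ge> 0 \<Longrightarrow> \<beta> t > 0"
    and p_nonneg: "\<And>x. p x \<ge> 0"
    and p_int: "integrable lborel p"
    and p_one: "(\<integral>x. p x \<partial>lborel) = 1"
    and p_smooth: "smooth p"
    and fisher_finite: "integrable lborel
          (\<lambda>x. if p x > 0 then p x * (norm (grad (\<lambda>y. ln (p y)) x))\<^sup>2 else 0)"
    and flow: "\<And>t z. t > 0 \<Longrightarrow> is_flow_reconstruction p \<beta> t z (F t z)"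
  shows "((\<lambda>t. flow_err p \<beta> (F t) t / anc_err p \<beta> t) \<longlongrightarrow> 1 / 2) (at_right 0)"
proof -
  define gp where "gp x = (\<Sum>b\<in>Basis. frechet_derivative p (at x) b *\<^sub>R b)" for x
  \<comment> \<open>The empty list gives differentiability of \<open>p\<close>; the one-element
    lists \<open>[b]\<close> give continuity of its partial derivatives, and with it continuity of
    \<open>gp\<close>.\<close>
  have diff: "dirderiv vs p differentiable (at x)" for vs x
    using p_smooth by (simp add: smooth_def)
  have p_deriv: "(p has_derivative (\<lambda>e. gp x \<bullet> e)) (at x)" for x
  proof -
    have d: "(p has_derivative frechet_derivative p (at x)) (at x)"
      using diff[of "[]" x] by (simp add: frechet_derivative_works)
    have lin: "linear (frechet_derivative p (at x))" using d by (rule has_derivative_linear)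
    have "frechet_derivative p (at x) e = gp x \<bullet> e" for e
    proof -
      have "frechet_derivative p (at x) e = frechet_derivative p (at x) (\<Sum>b\<in>Basis. (e \<bullet> b) *\<^sub>R b)"
        by (simp add: euclidean_representation)
      also have "\<dots> = (\<Sum>b\<in>Basis. (e \<bullet> b) * frechet_derivative p (at x) b)"
        by (simp add: linear_sum[OF lin] linear_cmul[OF lin])
      also have "\<dots> = gp x \<bullet> e"
        unfolding gp_def inner_sum_left inner_scaleR_left
        by (intro sum.cong) (auto simp: inner_commute mult.commute)
      finally show ?thesis .
    qed
    then have "frechet_derivative p (at x) = (\<lambda>e. gp x \<bullet> e)" by auto
    with d show ?thesis by simp
  qed
  have gp_cont: "continuous_on UNIV gp"
  proof -
    have "continuous_on UNIV (\<lambda>x. frechet_derivative p (at x) b)" for b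
      using diff[of "[b]"] by (auto intro!: continuous_at_imp_continuous_on differentiable_imp_continuous_within)
    then show ?thesis unfolding gp_def by (intro continuous_intros)
  qed
  have "(\<lambda>x. if p x > 0 then p x * (norm (grad (\<lambda>y. ln (p y)) x))\<^sup>2 else 0) = (\<lambda>x. (norm (gp x))\<^sup>2 / p x)"
  proof
    fix x
    show "(if p x > 0 then p x * (norm (grad (\<lambda>y. ln (p y)) x))\<^sup>2 else 0) = (norm (gp x))\<^sup>2 / p x"
    proof (cases "p x > 0")
      case True
      have "((\<lambda>y. ln (p y)) has_derivative (\<lambda>e. (1 / p x) * (gp x \<bullet> e))) (at x)"
        by (rule has_derivative_compose[OF p_deriv has_field_derivative_imp_has_derivative[OF DERIV_ln_divide[OF True]]])
      then have "grad (\<lambda>y. ln (p y)) x = (1 / p x) *\<^sub>R gp x"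
        by (intro grad_eqI) simp
      then show ?thesis using True by (simp add: power_divide power2_eq_square)
    next
      case False
      then show ?thesis using p_nonneg[of x] by simp
    qed
  qed
  with fisher_finite have "integrable lborel (\<lambda>x. (norm (gp x))\<^sup>2 / p x)" by simp
  then interpret diffusion p gp \<beta>
    using p_nonneg p_int p_one p_deriv gp_cont beta_cont beta_pos by unfold_locales auto
  show ?thesis by (rule flow_anc_ratio_tendsto[OF flow])
qed

end
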